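(* Let $(c,\mu)$ be the exact solution of the classical convex-splitting step (CS) and let $(c_h,\mu_h)\in V_h\times V_h$ be the corresponding conforming finite element solution, i.e. the solution of (CS$_h$), where $c_h^n\in V_h$ is a given approximation of $c^n$ with $\int_\Omega c_h^n\,dx=\int_\Omega c^n\,dx$. Let $I\subset\mathbb R$ be an interval containing the essential ranges of $c,c_h,c^n,c_h^n$, and assume that $f_c$ is convex and that there is $L_I>0$ with $$|f_c'(r)-f_c'(s)|+|f_e'(r)-f_e'(s)|\le L_I|r-s|\qquad\forall r,s\in I.$$ Let $c,\mu\in H^{r_c+1}(\Omega)$, $c\in H^2(\Omega)$, and $\partial_n c=0$ on $\partial\Omega$. Then there exists a constant $C>0$, independent of $h$, but possibly depending on $\Omega$, $m$, $\tau$, $\varepsilon$ and the local Lipschitz interval $I$, such that $$\|c-c_h\|_{-1,h}+\|\nabla(c-c_h)\|_{L^2(\Omega)}+\|\nabla(\mu-\mu_h)\|_{L^2(\Omega)}\le C\Big(h^{r_c}\|c\|_{H^{r_c+1}(\Omega)}+h^{r_c}\|\mu\|_{H^{r_c+1}(\Omega)}+\|c^n-c_h^n\|_{-1,h}+\|c^n-c_h^n\|_{L^2(\Omega)}\Big).$$ Moreover, since $c-c_h$ has zero mean, the same right-hand side controls $\|c-c_h\|_{H^1(\Omega)}$ (i.e. the same bound holds for $\|c-c_h\|_{H^1(\Omega)}$, with a constant of the same type).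
   Context: $\Omega\subset\mathbb R^2$ is a bounded, connected, convex polygonal domain with outer unit normal $n$; $m,\varepsilon,\tau>0$ are constants; $f=f_c-f_e$ with $f_c,f_e\in C^1(\mathbb R)$ convex; $c^n\in H^1(\Omega)$. $(\cdot,\cdot)$ is the $L^2(\Omega)$ inner product. $G^n(c):=f_c'(c)-f_e'(c^n)$ and $G_h^n(c_h):=f_c'(c_h)-f_e'(c_h^n)$. (CS): $(c,\mu)\in H^1(\Omega)\times H^1(\Omega)$ satisfies $\big(\frac{c-c^n}{\tau},v\big)+m(\nabla\mu,\nabla v)=0$ for all $v\in H^1(\Omega)$ and $(\mu,w)-\varepsilon^2(\nabla c,\nabla w)-(G^n(c),w)=0$ for all $w\in H^1(\Omega)$. $\{\mathcal T_h\}_{h>0}$ is a shape-regular family of conforming triangulations of $\Omega$; $V_h\subset H^1(\Omega)$ is the conforming Lagrange finite element space of degree $r_c\ge1$ on $\mathcal T_h$, with the standard approximation property $\inf_{v_h\in V_h}\|v-v_h\|_{H^1(\Omega)}\le Ch^{r_c}\|v\|_{H^{r_c+1}(\Omega)}$ for $v\in H^{r_c+1}(\Omega)$, with $C$ independent of $h$ and $v$. (CS$_h$): $(c_h,\mu_h)\in V_h\times V_h$ satisfies $\big(\frac{c_h-c_h^n}{\tau},v_h\big)+m(\nabla\mu_h,\nabla v_h)=0$ for all $v_h\in V_h$ and $(\mu_h,w_h)-\varepsilon^2(\nabla c_h,\nabla w_h)-(G_h^n(c_h),w_h)=0$ for all $w_h\in V_h$. $L^2_0(\Omega)$ is the space of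 mean-zero $L^2(\Omega)$ functions and $V_{h,0}:=V_h\cap L^2_0(\Omega)$. For $g\in L^2_0(\Omega)$, $\mathcal N_hg\in V_{h,0}$ is defined by $(\nabla\mathcal N_hg,\nabla v_h)=(g,v_h)$ for all $v_h\in V_{h,0}$, and $\|g\|_{-1,h}:=\|\nabla\mathcal N_hg\|_{L^2(\Omega)}$ (a norm on $V_{h,0}$, a seminorm on $L^2_0(\Omega)$). *)

theory Defs
  imports "HOL-Analysis.Analysis"
begin

text \<open>
  Elements of the function spaces are represented by functions on the whole plane; only their
  values on the domain matter, and they matter up to null sets.
\<close>

section \<open>Polygonal domains\<close>

definition convex_polygonal_domain :: "(real^2) set \<Rightarrow> bool" where
  "convex_polygonal_domain \<Omega> \<longleftrightarrow>
     open \<Omega> \<and> \<Omega> \<noteq> {} \<and> bounded \<Omega> \<and> connected \<Omega> \<and> convex \<Omega> \<and> polytope (closure \<Omega>)"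

text \<open>Along an edge \<open>F\<close> of a convex polygon the supporting direction is unique.\<close>

definition outer_unit_normal :: "(real^2) set \<Rightarrow> (real^2) set \<Rightarrow> real^2 \<Rightarrow> bool" where
  "outer_unit_normal \<Omega> F \<nu> \<longleftrightarrow> norm \<nu> = 1 \<and> (\<forall>x\<in>F. \<forall>y\<in>\<Omega>. \<nu> \<bullet> (y - x) \<le> 0)"

section \<open>Square-integrable functions\<close>

definition L2 :: "'a measure \<Rightarrow> ('a \<Rightarrow> real) set" where
  "L2 M = {u \<in> borel_measurable M. integrable M (\<lambda>x. (u x)\<^sup>2)}"

definition L2_inner :: "'a measure \<Rightarrow> ('a \<Rightarrow> real) \<Rightarrow> ('a \<Rightarrow> real) \<Rightarrow> real" where
  "L2_inner M u v = (LINT x|M. u x * v x)"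

definition L2_norm :: "'a measure \<Rightarrow> ('a \<Rightarrow> real) \<Rightarrow> real" where
  "L2_norm M u = sqrt (L2_inner M u u)"

definition L2_zero_mean :: "'a measure \<Rightarrow> ('a \<Rightarrow> real) set" where
  "L2_zero_mean M = {u \<in> L2 M. (LINT x|M. u x) = 0}"

definition essential_range :: "(real^2) set \<Rightarrow> (real^2 \<Rightarrow> real) \<Rightarrow> real set" where
  "essential_range \<Omega> u = {y. \<forall>e>0. emeasure lebesgue {x \<in> \<Omega>. \<bar>u x - y\<bar> < e} > 0}"

section \<open>Weak derivatives and Sobolev spaces\<close>

definition partial_deriv :: "2 \<Rightarrow> (real^2 \<Rightarrow> real) \<Rightarrow> real^2 \<Rightarrow> real" where
  "partial_deriv i f x = frechet_derivative f (at x) (axis i 1)"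

definition smooth :: "(real^2 \<Rightarrow> real) \<Rightarrow> bool" where
  "smooth f \<longleftrightarrow> (\<forall>js x. foldr partial_deriv js f differentiable (at x))"

definition test_functions :: "(real^2) set \<Rightarrow> (real^2 \<Rightarrow> real) set" where
  "test_functions \<Omega> =
     {\<phi>. smooth \<phi> \<and> compact (closure {x. \<phi> x \<noteq> 0}) \<and> closure {x. \<phi> x \<noteq> 0} \<subseteq> \<Omega>}"

text \<open>Multi-indices are pairs \<open>(\<alpha>\<^sub>1, \<alpha>\<^sub>2)\<close>.\<close>

fun multi_deriv :: "nat \<times> nat \<Rightarrow> (real^2 \<Rightarrow> real) \<Rightarrow> real^2 \<Rightarrow> real" where
  "multi_deriv (i, j) f = (partial_deriv 1 ^^ i) ((partial_deriv 2 ^^ j) f)"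

definition has_weak_deriv ::
    "(real^2) set \<Rightarrow> nat \<times> nat \<Rightarrow> (real^2 \<Rightarrow> real) \<Rightarrow> (real^2 \<Rightarrow> real) \<Rightarrow> bool" where
  "has_weak_deriv \<Omega> \<alpha> u v \<longleftrightarrow>
     (\<forall>\<phi>\<in>test_functions \<Omega>.
        L2_inner (lebesgue_on \<Omega>) u (multi_deriv \<alpha> \<phi>) =
        (-1) ^ (fst \<alpha> + snd \<alpha>) * L2_inner (lebesgue_on \<Omega>) v \<phi>)"

text \<open>The choice is immaterial: weak derivatives are unique up to null sets.\<close>

definition weak_deriv :: "(real^2) set \<Rightarrow> nat \<times> nat \<Rightarrow> (real^2 \<Rightarrow> real) \<Rightarrow> real^2 \<Rightarrow> real" where
  "weak_deriv \<Omega> \<alpha> u = (SOME v. v \<in> L2 (lebesgue_on \<Omega>) \<and> has_weak_deriv \<Omega> \<alpha> u v)"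

definition sobolev :: "(real^2) set \<Rightarrow> nat \<Rightarrow> (real^2 \<Rightarrow> real) set" where
  "sobolev \<Omega> k =
     {u \<in> L2 (lebesgue_on \<Omega>).
        \<forall>\<alpha>. fst \<alpha> + snd \<alpha> \<le> k \<longrightarrow> (\<exists>v\<in>L2 (lebesgue_on \<Omega>). has_weak_deriv \<Omega> \<alpha> u v)}"

definition sobolev_norm :: "(real^2) set \<Rightarrow> nat \<Rightarrow> (real^2 \<Rightarrow> real) \<Rightarrow> real" where
  "sobolev_norm \<Omega> k u =
     sqrt (\<Sum>\<alpha> | fst \<alpha> + snd \<alpha> \<le> k. (L2_norm (lebesgue_on \<Omega>) (weak_deriv \<Omega> \<alpha> u))\<^sup>2)"

definition weak_grad :: "(real^2) set \<Rightarrow> (real^2 \<Rightarrow> real) \<Rightarrow> real^2 \<Rightarrow> real^2" where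
  "weak_grad \<Omega> u x = vector [weak_deriv \<Omega> (1, 0) u x, weak_deriv \<Omega> (0, 1) u x]"

definition grad_inner :: "(real^2) set \<Rightarrow> (real^2 \<Rightarrow> real) \<Rightarrow> (real^2 \<Rightarrow> real) \<Rightarrow> real" where
  "grad_inner \<Omega> u v = (LINT x|lebesgue_on \<Omega>. weak_grad \<Omega> u x \<bullet> weak_grad \<Omega> v x)"

definition grad_norm :: "(real^2) set \<Rightarrow> (real^2 \<Rightarrow> real) \<Rightarrow> real" where
  "grad_norm \<Omega> u = sqrt (grad_inner \<Omega> u u)"

section \<open>Traces and normal derivatives\<close>

text \<open>
  \<open>g\<close> is the trace of \<open>w \<in> H\<^sup>1(\<Omega>)\<close> if it is the \<open>L\<^sup>2\<close>-limit on the boundary of smooth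
  functions converging to \<open>w\<close> in \<open>H\<^sup>1(\<Omega>)\<close>. The boundary is treated edge by edge, each edge being
  parametrised by \<open>linepath\<close> over the unit interval; the omitted constant factor (the length of
  the edge) affects neither convergence nor null sets.
\<close>

definition has_trace :: "(real^2) set \<Rightarrow> (real^2 \<Rightarrow> real) \<Rightarrow> (real^2 \<Rightarrow> real) \<Rightarrow> bool" where
  "has_trace \<Omega> w g \<longleftrightarrow>
     w \<in> sobolev \<Omega> 1 \<and>
     (\<exists>\<phi> :: nat \<Rightarrow> real^2 \<Rightarrow> real.
        (\<forall>k. smooth (\<phi> k)) \<and>
        (\<lambda>k. sobolev_norm \<Omega> 1 (\<lambda>x. \<phi> k x - w x)) \<longlonglongrightarrow> 0 \<and>
        (\<forall>a b. closed_segment a b edge_of closure \<Omega> \<longrightarrow>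
           (\<lambda>t. g (linepath a b t)) \<in> L2 (lebesgue_on {0..1}) \<and>
           (\<lambda>k. L2_norm (lebesgue_on {0..1})
                  (\<lambda>t. \<phi> k (linepath a b t) - g (linepath a b t))) \<longlonglongrightarrow> 0))"

text \<open>The normal derivative of \<open>u\<close> is the trace of its gradient times the outer unit normal.\<close>

definition has_normal_derivative ::
    "(real^2) set \<Rightarrow> (real^2 \<Rightarrow> real) \<Rightarrow> (real^2 \<Rightarrow> real) \<Rightarrow> bool" where
  "has_normal_derivative \<Omega> u q \<longleftrightarrow>
     (\<exists>g :: real^2 \<Rightarrow> real^2.
        (\<forall>i. has_trace \<Omega> (\<lambda>x. weak_grad \<Omega> u x $ i) (\<lambda>x. g x $ i)) \<and>
        (\<forall>a b \<nu>. closed_segment a b edge_of closure \<Omega> \<longrightarrow>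
           outer_unit_normal \<Omega> (closed_segment a b) \<nu> \<longrightarrow>
           (AE t in lebesgue_on {0..1}. q (linepath a b t) = g (linepath a b t) \<bullet> \<nu>)))"

section \<open>Triangulations and Lagrange finite elements\<close>

text \<open>Conformity (two triangles meet in a common face) is part of \<^const>\<open>triangulation\<close>.\<close>

definition conforming_triangulation :: "(real^2) set \<Rightarrow> (real^2) set set \<Rightarrow> bool" where
  "conforming_triangulation \<Omega> \<T> \<longleftrightarrow>
     triangulation \<T> \<and> (\<forall>K\<in>\<T>. 2 simplex K) \<and> \<Union>\<T> = closure \<Omega>"

definition inball_diameter :: "(real^2) set \<Rightarrow> real" where
  "inball_diameter K = Sup {2 * \<rho> |\<rho>. \<rho> \<ge> 0 \<and> (\<exists>x. cball x \<rho> \<subseteq> K)}"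

text \<open>
  The mesh parameter ranges over an index set \<open>H\<close> of positive reals and bounds the mesh size.
  Demanding equality with the mesh size for every \<open>h > 0\<close> would be contradictory, since no
  triangle has a diameter exceeding that of \<open>\<Omega>\<close>.
\<close>

definition shape_regular_family ::
    "(real^2) set \<Rightarrow> real set \<Rightarrow> (real \<Rightarrow> (real^2) set set) \<Rightarrow> bool" where
  "shape_regular_family \<Omega> H \<T> \<longleftrightarrow>
     H \<subseteq> {0<..} \<and>
     (\<forall>h\<in>H. conforming_triangulation \<Omega> (\<T> h) \<and> (\<forall>K\<in>\<T> h. diameter K \<le> h)) \<and>
     (\<exists>\<sigma>. \<forall>h\<in>H. \<forall>K\<in>\<T> h. diameter K \<le> \<sigma> * inball_diameter K)"

definition bivariate_polynomials :: "nat \<Rightarrow> (real^2 \<Rightarrow> real) set" where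
  "bivariate_polynomials r =
     {p. \<exists>a :: nat \<Rightarrow> nat \<Rightarrow> real. \<forall>x. p x = (\<Sum>(i, j) | i + j \<le> r. a i j * (x$1) ^ i * (x$2) ^ j)}"

definition lagrange_space :: "(real^2) set \<Rightarrow> (real^2) set set \<Rightarrow> nat \<Rightarrow> (real^2 \<Rightarrow> real) set" where
  "lagrange_space \<Omega> \<T> r =
     {v \<in> sobolev \<Omega> 1. continuous_on (closure \<Omega>) v \<and>
        (\<forall>K\<in>\<T>. \<exists>p\<in>bivariate_polynomials r. \<forall>x\<in>K. v x = p x)}"

definition approximation_property ::
    "(real^2) set \<Rightarrow> real set \<Rightarrow> (real \<Rightarrow> (real^2) set set) \<Rightarrow> nat \<Rightarrow> bool" where
  "approximation_property \<Omega> H \<T> r \<longleftrightarrow>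
     (\<exists>C. \<forall>h\<in>H. \<forall>v\<in>sobolev \<Omega> (r + 1).
        (INF w\<in>lagrange_space \<Omega> (\<T> h) r. sobolev_norm \<Omega> 1 (\<lambda>x. v x - w x))
          \<le> C * h ^ r * sobolev_norm \<Omega> (r + 1) v)"

text \<open>
  In the following two definitions \<open>V\<close> is the finite element space. The solution chosen is unique
  up to null sets and values outside \<open>\<Omega>\<close>.
\<close>

definition discrete_inverse_laplacian ::
    "(real^2) set \<Rightarrow> (real^2 \<Rightarrow> real) set \<Rightarrow> (real^2 \<Rightarrow> real) \<Rightarrow> real^2 \<Rightarrow> real" where
  "discrete_inverse_laplacian \<Omega> V g =
     (SOME w. w \<in> V \<inter> L2_zero_mean (lebesgue_on \<Omega>) \<and>
        (\<forall>v\<in>V \<inter> L2_zero_mean (lebesgue_on \<Omega>).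
           grad_inner \<Omega> w v = L2_inner (lebesgue_on \<Omega>) g v))"

definition dual_norm :: "(real^2) set \<Rightarrow> (real^2 \<Rightarrow> real) set \<Rightarrow> (real^2 \<Rightarrow> real) \<Rightarrow> real" where
  "dual_norm \<Omega> V g = grad_norm \<Omega> (discrete_inverse_laplacian \<Omega> V g)"

section \<open>The convex-splitting step\<close>

text \<open>
  \<open>(c, \<mu>)\<close> solves the step started from \<open>p\<close>, with trial and test space \<open>V\<close>: the full space
  \<open>H\<^sup>1(\<Omega>)\<close> for the time-discrete problem, a finite element space for its discretisation.
\<close>

definition convex_splitting_step ::
    "(real^2) set \<Rightarrow> real \<Rightarrow> real \<Rightarrow> real \<Rightarrow> (real \<Rightarrow> real) \<Rightarrow> (real \<Rightarrow> real) \<Rightarrow> (real^2 \<Rightarrow> real) set \<Rightarrow>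
     (real^2 \<Rightarrow> real) \<Rightarrow> (real^2 \<Rightarrow> real) \<Rightarrow> (real^2 \<Rightarrow> real) \<Rightarrow> bool" where
  "convex_splitting_step \<Omega> m \<epsilon> \<tau> f\<^sub>c f\<^sub>e V p c \<mu> \<longleftrightarrow>
     c \<in> V \<and> \<mu> \<in> V \<and>
     (\<forall>v\<in>V. L2_inner (lebesgue_on \<Omega>) (\<lambda>x. (c x - p x) / \<tau>) v + m * grad_inner \<Omega> \<mu> v = 0) \<and>
     (\<forall>w\<in>V. L2_inner (lebesgue_on \<Omega>) \<mu> w - \<epsilon>\<^sup>2 * grad_inner \<Omega> c w
              - L2_inner (lebesgue_on \<Omega>) (\<lambda>x. deriv f\<^sub>c (c x) - deriv f\<^sub>e (p x)) w = 0)"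

end

theory Submission
  imports Defs
begin

text \<open>
  Write \<open>c - c\<^sub>h = \<rho> + \<theta>\<close> and \<open>\<mu> - \<mu>\<^sub>h = \<sigma> + \<xi>\<close> with \<open>\<rho>, \<sigma>\<close> approximation errors and \<open>\<theta>, \<xi>\<close> in the
  finite element space. Galerkin orthogonality tested with \<open>\<xi>\<close> and \<open>\<theta>\<close> gives an energy identity for
  \<open>m \<tau> \<parallel>\<nabla>\<xi>\<parallel>\<^sup>2 + \<epsilon>\<^sup>2 \<parallel>\<nabla>\<theta>\<parallel>\<^sup>2\<close> in which the mixed term \<open>(\<theta>, \<xi>)\<close> cancels; the convexity of \<open>f\<^sub>c\<close> gives the
  implicit nonlinearity a sign, and all remaining terms are absorbed by the inequality of Poincare,
  since \<open>\<theta>\<close> and \<open>\<rho>\<close> can be arranged to have mean zero.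

  The analytic input is proved without mollifying: test functions are dense in \<open>L\<^sup>2\<close>, so weak
  derivatives are unique and \<open>L\<^sup>2\<close> norms can be computed by duality, which bounds
  \<open>\<parallel>u(\<cdot> + h) - u\<parallel>\<close> by \<open>|h| \<parallel>\<nabla>u\<parallel>\<close>; integrating over \<open>h\<close> yields the inequality of Poincare on a bounded
  convex set.
\<close>

section \<open>Semi-inner product spaces of functions\<close>

text \<open>Spaces consist of functions on the whole plane, so the forms are only semidefinite, and
  the weak gradient, chosen by \<open>SOME\<close>, is linear only almost everywhere. The carrier is
  a parameter because L2, H1 and the mean-zero finite element space all occur. The choice in
  \<open>discrete_inverse_laplacian\<close> has content only once existence is known, and the finite
  element space is finite-dimensional only modulo functions vanishing on \<Omega>; hence a Riesz
  theorem for degenerate forms. Integrals of nonintegrable functions are 0, so splitting an inner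
  product needs square integrability. For the nonlinear terms this comes from the Lipschitz bound on
  \<open>I\<close>, where the arguments lie almost everywhere by the essential range condition. The
  dual norm on the left costs two Poincare inequalities: it is bounded by the L2 norm, and this by
  the gradient. The approximation property only gives an infimum, so the energy estimate is proved
  for arbitrary \<open>P\<close>, \<open>Q\<close> and the infima are taken afterwards. All
  constants come from the Poincare constant, the parameters, \<open>L\<close> and the approximation
  constant, before a mesh is fixed.\<close>

locale semi_inner =
  fixes V :: "('a \<Rightarrow> real) set" and B :: "('a \<Rightarrow> real) \<Rightarrow> ('a \<Rightarrow> real) \<Rightarrow> real"
  assumes zero_mem: "(\<lambda>x. 0) \<in> V"
    and add_mem: "\<And>u v. u \<in> V \<Longrightarrow> v \<in> V \<Longrightarrow> (\<lambda>x. u x + v x) \<in> V"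
    and scale_mem: "\<And>a u. u \<in> V \<Longrightarrow> (\<lambda>x. a * u x) \<in> V"
    and add_left: "\<And>u v w. u \<in> V \<Longrightarrow> v \<in> V \<Longrightarrow> w \<in> V \<Longrightarrow> B (\<lambda>x. u x + v x) w = B u w + B v w"
    and scale_left: "\<And>a u w. u \<in> V \<Longrightarrow> w \<in> V \<Longrightarrow> B (\<lambda>x. a * u x) w = a * B u w"
    and sym: "\<And>u v. u \<in> V \<Longrightarrow> v \<in> V \<Longrightarrow> B u v = B v u"
    and nonneg: "\<And>u. u \<in> V \<Longrightarrow> B u u \<ge> 0"
begin

lemma add_right: "u \<in> V \<Longrightarrow> v \<in> V \<Longrightarrow> w \<in> V \<Longrightarrow> B w (\<lambda>x. u x + v x) = B w u + B w v"
  using add_left[of u v w] sym[of w] add_mem[of u v] by simp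

lemma scale_right: "u \<in> V \<Longrightarrow> w \<in> V \<Longrightarrow> B w (\<lambda>x. a * u x) = a * B w u"
  using scale_left[of u w a] sym[of w] scale_mem[of u a] by simp

lemma diff_mem: "u \<in> V \<Longrightarrow> v \<in> V \<Longrightarrow> (\<lambda>x. u x - v x) \<in> V"
  using add_mem[of u "\<lambda>x. -1 * v x"] scale_mem[of v "-1"] by simp

lemma diff_left: "u \<in> V \<Longrightarrow> v \<in> V \<Longrightarrow> w \<in> V \<Longrightarrow> B (\<lambda>x. u x - v x) w = B u w - B v w"
  using add_left[of u "\<lambda>x. -1 * v x" w] scale_mem[of v "-1"] scale_left[of v w "-1"] by simp

lemma diff_right: "u \<in> V \<Longrightarrow> v \<in> V \<Longrightarrow> w \<in> V \<Longrightarrow> B w (\<lambda>x. u x - v x) = B w u - B w v"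
  using diff_left[of u v w] sym[of w] diff_mem[of u v] by simp

lemma Cauchy_Schwarz:
  assumes "u \<in> V" "v \<in> V"
  shows "\<bar>B u v\<bar> \<le> sqrt (B u u) * sqrt (B v v)"
proof -
  have *: "0 \<le> B u u - 2 * t * B u v + t\<^sup>2 * B v v" for t
    using nonneg[of "\<lambda>x. u x - t * v x"] assms
    by (simp add: diff_left diff_right scale_left scale_right diff_mem scale_mem sym[of v u]
        power2_eq_square algebra_simps)
  have "(B u v)\<^sup>2 \<le> B u u * B v v"
  proof (cases "B v v = 0")
    case True
    have "B u v = 0"
    proof (rule ccontr)
      assume "B u v \<noteq> 0"
      \<comment> \<open>With \<open>B v v = 0\<close> the quadratic degenerates to a linear function
        of \<open>t\<close>, and this \<open>t\<close> gives it the value -1.\<close>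
      with *[of "(B u u + 1) / (2 * B u v)"] True show False by simp
    qed
    then show ?thesis using True by simp
  next
    case False
    then have "B v v > 0" using nonneg[OF assms(2)] by simp
    with *[of "B u v / B v v"] show ?thesis
      by (simp add: field_simps power2_eq_square)
  qed
  then have "sqrt ((B u v)\<^sup>2) \<le> sqrt (B u u * B v v)" by (rule real_sqrt_le_mono)
  then show ?thesis by (simp only: real_sqrt_mult real_sqrt_abs)
qed

lemma triangle:
  assumes "u \<in> V" "v \<in> V"
  shows "sqrt (B (\<lambda>x. u x + v x) (\<lambda>x. u x + v x)) \<le> sqrt (B u u) + sqrt (B v v)"
proof (rule real_le_lsqrt)
  have "B (\<lambda>x. u x + v x) (\<lambda>x. u x + v x) = B u u + 2 * B u v + B v v"
    using assms by (simp add: add_left add_right add_mem sym[of v u])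
  also have "\<dots> \<le> B u u + 2 * (sqrt (B u u) * sqrt (B v v)) + B v v"
    using Cauchy_Schwarz[OF assms] by simp
  also have "\<dots> = (sqrt (B u u) + sqrt (B v v))\<^sup>2"
    using nonneg assms by (simp add: power2_sum)
  finally show "B (\<lambda>x. u x + v x) (\<lambda>x. u x + v x) \<le> (sqrt (B u u) + sqrt (B v v))\<^sup>2" .
qed (use nonneg assms add_mem in auto)

lemma norm_scale:
  "u \<in> V \<Longrightarrow> sqrt (B (\<lambda>x. a * u x) (\<lambda>x. a * u x)) = \<bar>a\<bar> * sqrt (B u u)"
  by (simp add: scale_left scale_right scale_mem real_sqrt_mult flip: mult.assoc)

lemma triangle_diff:
  assumes "u \<in> V" "v \<in> V"
  shows "sqrt (B (\<lambda>x. u x - v x) (\<lambda>x. u x - v x)) \<le> sqrt (B u u) + sqrt (B v v)"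
  using triangle[OF assms(1) scale_mem[OF assms(2), of "-1"]] norm_scale[OF assms(2), of "-1"]
  by simp

lemma sum_mem:
  assumes "\<And>i. i \<in> I \<Longrightarrow> e i \<in> V"
  shows "(\<lambda>x. \<Sum>i\<in>I. a i * e i x) \<in> V"
  using assms by (induction I rule: infinite_finite_induct) (auto intro!: zero_mem add_mem scale_mem)

lemma zero_left: "w \<in> V \<Longrightarrow> B (\<lambda>x. 0) w = 0"
  using scale_left[of "\<lambda>x. 0" w 0] zero_mem by simp

lemma sum_left:
  assumes "\<And>i. i \<in> I \<Longrightarrow> e i \<in> V" "w \<in> V"
  shows "B (\<lambda>x. \<Sum>i\<in>I. a i * e i x) w = (\<Sum>i\<in>I. a i * B (e i) w)"
  using assms(1)
  by (induction I rule: infinite_finite_induct)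
    (auto simp: zero_left assms(2) add_left scale_left scale_mem sum_mem)

lemma sum_right:
  assumes "\<And>i. i \<in> I \<Longrightarrow> e i \<in> V" "w \<in> V"
  shows "B w (\<lambda>x. \<Sum>i\<in>I. a i * e i x) = (\<Sum>i\<in>I. a i * B w (e i))"
  using sum_left[of I e w a] sym[of w] assms by (simp add: sum_mem)

definition orthonormal :: "nat \<Rightarrow> (nat \<Rightarrow> 'a \<Rightarrow> real) \<Rightarrow> bool" where
  "orthonormal n e \<longleftrightarrow>
     (\<forall>i<n. e i \<in> V) \<and> (\<forall>i<n. \<forall>j<n. B (e i) (e j) = (if i = j then 1 else 0))"

lemma orthonormal_norm:
  assumes "orthonormal n e"
  shows "B (\<lambda>x. \<Sum>i<n. a i * e i x) (\<lambda>x. \<Sum>i<n. a i * e i x) = (\<Sum>i<n. (a i)\<^sup>2)"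
proof -
  have e: "\<And>i. i \<in> {..<n} \<Longrightarrow> e i \<in> V" using assms by (auto simp: orthonormal_def)
  have "B (\<lambda>x. \<Sum>i<n. a i * e i x) (\<lambda>x. \<Sum>i<n. a i * e i x)
      = (\<Sum>i<n. a i * (\<Sum>j<n. a j * (if i = j then 1 else 0)))"
    using assms
    by (subst sum_left[OF e sum_mem[OF e]], simp, simp)
      (intro sum.cong arg_cong2[where f = times] refl, subst sum_right[OF e e], auto simp: orthonormal_def)
  also have "\<dots> = (\<Sum>i<n. (a i)\<^sup>2)"
    by (intro sum.cong refl) (auto simp: power2_eq_square if_distrib[of "\<lambda>x. _ * x"] cong: if_cong)
  finally show ?thesis .
qed

text \<open>
  A maximal orthonormal system exists because any \<open>N\<close> vectors are dependent modulo the kernel of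
  the seminorm.
\<close>

lemma Riesz_representation:
  assumes dep: "\<And>e :: nat \<Rightarrow> 'a \<Rightarrow> real. (\<And>i. i < N \<Longrightarrow> e i \<in> V) \<Longrightarrow>
      \<exists>l. (\<exists>i<N. l i \<noteq> 0) \<and> B (\<lambda>x. \<Sum>i<N. l i * e i x) (\<lambda>x. \<Sum>i<N. l i * e i x) = 0"
    and f_add: "\<And>u v. u \<in> V \<Longrightarrow> v \<in> V \<Longrightarrow> f (\<lambda>x. u x + v x) = f u + f v"
    and f_scale: "\<And>a u. u \<in> V \<Longrightarrow> f (\<lambda>x. a * u x) = a * f u"
    and f_bound: "\<And>v. v \<in> V \<Longrightarrow> \<bar>f v\<bar> \<le> K * sqrt (B v v)"
  shows "\<exists>w\<in>V. \<forall>v\<in>V. B w v = f v"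
proof -
  have f0: "f (\<lambda>x. 0) = 0" using f_scale[of "\<lambda>x. 0" 0] zero_mem by simp
  have f_sum: "f (\<lambda>x. \<Sum>i\<in>J. a i * e i x) = (\<Sum>i\<in>J. a i * f (e i))"
    if "\<And>i. i \<in> J \<Longrightarrow> e i \<in> V" for J :: "nat set" and a e
    using that
    by (induction J rule: infinite_finite_induct) (auto simp: f0 f_add f_scale scale_mem sum_mem)
  have less: "n < N" if e: "orthonormal n e" for n e
  proof (rule ccontr)
    assume "\<not> n < N"
    then have eN: "orthonormal N e" using e by (auto simp: orthonormal_def)
    then obtain l where l: "\<exists>i<N. l i \<noteq> 0"
      "B (\<lambda>x. \<Sum>i<N. l i * e i x) (\<lambda>x. \<Sum>i<N. l i * e i x) = 0"
      using dep[of e] by (auto simp: orthonormal_def)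
    then have "(\<Sum>i<N. (l i)\<^sup>2) = 0" using orthonormal_norm[OF eN] by simp
    then have "\<forall>i<N. l i = 0" by (subst (asm) sum_nonneg_eq_0_iff) auto
    then show False using l(1) by blast
  qed
  \<comment> \<open>\<open>less\<close> bounds the sizes of orthonormal systems by \<open>N\<close>
    and the empty system exists, so a largest size is attained.\<close>
  define n where "n = (GREATEST n. \<exists>e. orthonormal n e)"
  have "\<exists>e. orthonormal 0 e" by (simp add: orthonormal_def)
  moreover have bound: "\<And>n. \<exists>e. orthonormal n e \<Longrightarrow> n \<le> N" using less by fastforce
  ultimately obtain e where e: "orthonormal n e"
    unfolding n_def using GreatestI_nat[of "\<lambda>n. \<exists>e. orthonormal n e" 0 N] by blast
  have max: "\<not> orthonormal (Suc n) e'" for e'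
    using Greatest_le_nat[of "\<lambda>n. \<exists>e. orthonormal n e" "Suc n" N] bound
    unfolding n_def[symmetric] by fastforce
  have eV: "\<And>i. i \<in> {..<n} \<Longrightarrow> e i \<in> V" and ee: "\<And>i j. i < n \<Longrightarrow> j < n \<Longrightarrow> B (e i) (e j) = (if i = j then 1 else 0)"
    using e by (auto simp: orthonormal_def)
  define w where "w = (\<lambda>x. \<Sum>i<n. f (e i) * e i x)"
  have wV: "w \<in> V" unfolding w_def by (rule sum_mem[OF eV])
  have "B w v = f v" if v: "v \<in> V" for v
  proof -
    define p where "p = (\<lambda>x. \<Sum>i<n. B v (e i) * e i x)"
    define d where "d = (\<lambda>x. v x - p x)"
    have p: "p \<in> V" unfolding p_def by (rule sum_mem[OF eV])
    then have d: "d \<in> V" unfolding d_def using v diff_mem by blast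
    have "B p (e j) = B v (e j)" if "j < n" for j
    proof -
      have "B p (e j) = (\<Sum>i<n. B v (e i) * B (e i) (e j))"
        unfolding p_def by (rule sum_left) (use that eV in auto)
      also have "\<dots> = (\<Sum>i<n. if i = j then B v (e i) else 0)"
        by (intro sum.cong refl) (use that ee in auto)
      finally show ?thesis using that by simp
    qed
    then have de: "B d (e j) = 0" if "j < n" for j
      unfolding d_def using that v p eV by (simp add: diff_left)
    \<comment> \<open>The residual of the orthogonal projection would otherwise, after
      normalisation, enlarge the maximal system.\<close>
    have "B d d = 0"
    proof (rule ccontr)
      assume "B d d \<noteq> 0"
      then have pos: "B d d > 0" using nonneg[OF d] by simp
      define d' where "d' = (\<lambda>x. (1 / sqrt (B d d)) * d x)"
      have d': "d' \<in> V" unfolding d'_def using d by (rule scale_mem)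
      have 1: "B d' d' = 1" unfolding d'_def using d pos scale_mem[OF d]
        by (simp only: scale_left scale_right) (simp add: field_simps)
      have 2: "B d' (e j) = 0" "B (e j) d' = 0" if "j < n" for j
        using scale_left[OF d eV[of j], of "1 / sqrt (B d d)"] de[OF that] that sym[OF d' eV[of j]]
        by (simp_all add: d'_def)
      have "orthonormal (Suc n) (e(n := d'))"
        unfolding orthonormal_def using d' 1 2 eV ee by (auto simp: less_Suc_eq)
      then show False using max by blast
    qed
    \<comment> \<open>Continuity in the seminorm makes \<open>f\<close> vanish on its kernel, so
      \<open>f\<close> sees only the projection \<open>p\<close>.\<close>
    then have "f d = 0" using f_bound[OF d] by simp
    then have "f v = f p" using f_add[OF d p] by (simp add: d_def)
    also have "\<dots> = (\<Sum>i<n. B v (e i) * f (e i))" unfolding p_def by (rule f_sum[OF eV])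
    also have "\<dots> = (\<Sum>i<n. f (e i) * B (e i) v)"
      by (intro sum.cong refl) (use sym[OF v eV] in auto)
    also have "\<dots> = B w v"
      unfolding w_def by (rule sum_left[symmetric]) (use eV v in auto)
    finally show ?thesis by simp
  qed
  with wV show ?thesis by blast
qed

end

text \<open>Gaussian elimination, one coordinate of \<open>D\<close> per induction step. The vectors
  form an indexed family rather than a set, so repetitions count as dependence.\<close>

lemma exists_linear_dependence:
  fixes a :: "'i \<Rightarrow> 'd \<Rightarrow> real"
  assumes "finite D" "finite J" "card D < card J"
  shows "\<exists>l. (\<exists>i\<in>J. l i \<noteq> 0) \<and> (\<forall>d\<in>D. (\<Sum>i\<in>J. l i * a i d) = 0)"
  using assms
proof (induction D arbitrary: J a rule: finite_induct)
  case empty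
  then obtain i where "i \<in> J" by fastforce
  then show ?case by (intro exI[of _ "\<lambda>_. 1"]) auto
next
  case (insert k D)
  show ?case
  proof (cases "\<forall>i\<in>J. a i k = 0")
    case True
    obtain l where "\<exists>i\<in>J. l i \<noteq> 0" "\<forall>d\<in>D. (\<Sum>i\<in>J. l i * a i d) = 0"
      using insert.IH[of J a] insert.prems insert.hyps by auto
    with True show ?thesis by (intro exI[of _ l]) auto
  next
    case False
    then obtain p where p: "p \<in> J" "a p k \<noteq> 0" by blast
    define J' where "J' = J - {p}"
    have J: "J = insert p J'" "p \<notin> J'" "finite J'" using p insert.prems by (auto simp: J'_def)
    \<comment> \<open>The pivot \<open>p\<close> and the coordinate \<open>k\<close> are removed
      together, so the strict inequality of cardinalities survives.\<close>
    have "card D < card J'" using insert.prems insert.hyps J by simp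
    then obtain l where l: "\<exists>i\<in>J'. l i \<noteq> 0"
      "\<And>d. d \<in> D \<Longrightarrow> (\<Sum>i\<in>J'. l i * (a i d - a i k / a p k * a p d)) = 0"
      using insert.IH[of J' "\<lambda>i d. a i d - a i k / a p k * a p d"] J by auto
    \<comment> \<open>The coefficient of the pivot is forced by coordinate \<open>k\<close>; the
      relation between the reduced vectors then takes care of all others.\<close>
    define s where "s = - (\<Sum>i\<in>J'. l i * a i k) / a p k"
    define l' where "l' = l(p := s)"
    have sum: "(\<Sum>i\<in>J. l' i * a i d) = s * a p d + (\<Sum>i\<in>J'. l i * a i d)" for d
    proof -
      have "(\<Sum>i\<in>J'. l' i * a i d) = (\<Sum>i\<in>J'. l i * a i d)"
        by (intro sum.cong refl) (use J in \<open>auto simp: l'_def\<close>)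
      then show ?thesis using J by (simp add: l'_def)
    qed
    have "(\<Sum>i\<in>J. l' i * a i d) = 0" if "d \<in> insert k D" for d
    proof (cases "d = k")
      case True
      then show ?thesis unfolding sum using p by (simp add: s_def)
    next
      case False
      then have "(\<Sum>i\<in>J'. l i * a i d) - (\<Sum>i\<in>J'. l i * a i k) * (a p d / a p k) = 0"
        using l(2)[of d] that by (simp add: algebra_simps sum_subtractf sum_distrib_left sum_distrib_right)
      then show ?thesis unfolding sum s_def by (simp add: field_simps)
    qed
    moreover have "\<exists>i\<in>J. l' i \<noteq> 0" using l(1) J by (auto simp: l'_def)
    ultimately show ?thesis by blast
  qed
qed

section \<open>The space L2 and its semi-inner product\<close>

lemma L2D: "u \<in> L2 M \<Longrightarrow> u \<in> borel_measurable M" "u \<in> L2 M \<Longrightarrow> integrable M (\<lambda>x. (u x)\<^sup>2)"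
  by (auto simp: L2_def)

lemma L2_integrable_mult:
  assumes "u \<in> L2 M" "v \<in> L2 M"
  shows "integrable M (\<lambda>x. u x * v x)"
proof (rule Bochner_Integration.integrable_bound)
  show "integrable M (\<lambda>x. (u x)\<^sup>2 + (v x)\<^sup>2)" using assms by (auto dest: L2D)
  show "(\<lambda>x. u x * v x) \<in> borel_measurable M" using assms[THEN L2D(1)] by measurable
  have "\<bar>a * b\<bar> \<le> \<bar>a\<^sup>2 + b\<^sup>2\<bar>" for a b :: real
  proof -
    have "2 * (\<bar>a\<bar> * \<bar>b\<bar>) \<le> a\<^sup>2 + b\<^sup>2" using sum_squares_bound[of "\<bar>a\<bar>" "\<bar>b\<bar>"] by (simp add: mult.assoc)
    then have "\<bar>a\<bar> * \<bar>b\<bar> \<le> a\<^sup>2 + b\<^sup>2"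
      using mult_nonneg_nonneg[OF abs_ge_zero abs_ge_zero, of a b] by linarith
    then show ?thesis by (simp add: abs_mult)
  qed
  then show "AE x in M. norm (u x * v x) \<le> norm ((u x)\<^sup>2 + (v x)\<^sup>2)" by simp
qed

lemma L2_add:
  assumes "u \<in> L2 M" "v \<in> L2 M"
  shows "(\<lambda>x. u x + v x) \<in> L2 M"
  using assms L2_integrable_mult[OF assms] by (auto simp: L2_def power2_sum mult.assoc)

lemma L2_scale: "u \<in> L2 M \<Longrightarrow> (\<lambda>x. a * u x) \<in> L2 M"
  by (auto simp: L2_def power_mult_distrib)

lemma semi_inner_L2: "semi_inner (L2 M) (L2_inner M)"
proof
  show "(\<lambda>x. 0) \<in> L2 M" by (simp add: L2_def)
qed (auto simp: L2_inner_def L2_integrable_mult algebra_simps intro!: L2_add L2_scale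
    intro: integral_nonneg_AE)

interpretation L2: semi_inner "L2 M" "L2_inner M" for M by (rule semi_inner_L2)

lemma L2_inner_self: "L2_inner M u u = (LINT x|M. (u x)\<^sup>2)"
  by (simp add: L2_inner_def power2_eq_square)

lemma L2_norm_nonneg: "L2_norm M u \<ge> 0"
  by (auto simp: L2_norm_def L2_inner_self)

lemma L2_norm_power2: "(L2_norm M u)\<^sup>2 = (LINT x|M. (u x)\<^sup>2)"
  by (simp add: L2_norm_def L2_inner_self)

lemmas L2_Cauchy_Schwarz = L2.Cauchy_Schwarz[folded L2_norm_def]
lemmas L2_norm_triangle = L2.triangle[folded L2_norm_def]
lemmas L2_norm_triangle_diff = L2.triangle_diff[folded L2_norm_def]
lemmas L2_norm_scale = L2.norm_scale[folded L2_norm_def]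

lemma grad_norm_nonneg: "grad_norm \<Omega> u \<ge> 0"
  by (simp add: grad_norm_def grad_inner_def)

lemma L2_AE_cong:
  assumes "AE x in M. u x = v x" "u \<in> borel_measurable M" "v \<in> borel_measurable M"
  shows "u \<in> L2 M \<longleftrightarrow> v \<in> L2 M"
proof -
  have "integrable M (\<lambda>x. (u x)\<^sup>2) \<longleftrightarrow> integrable M (\<lambda>x. (v x)\<^sup>2)"
    by (rule integrable_cong_AE) (use assms in auto)
  then show ?thesis using assms by (simp add: L2_def)
qed

lemma L2_inner_AE_cong:
  assumes "AE x in M. u x = u' x" "AE x in M. v x = v' x"
    "u \<in> borel_measurable M" "v \<in> borel_measurable M"
    "u' \<in> borel_measurable M" "v' \<in> borel_measurable M"
  shows "L2_inner M u v = L2_inner M u' v'"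
  unfolding L2_inner_def by (rule integral_cong_AE) (use assms in auto)

lemma L2_norm_AE_cong:
  assumes "AE x in M. u x = u' x" "u \<in> borel_measurable M" "u' \<in> borel_measurable M"
  shows "L2_norm M u = L2_norm M u'"
  unfolding L2_norm_def using L2_inner_AE_cong[of u u' M u u'] assms by simp

lemma L2_norm_eq_0:
  assumes "u \<in> L2 M"
  shows "L2_norm M u = 0 \<longleftrightarrow> (AE x in M. u x = 0)"
  using integral_nonneg_eq_0_iff_AE[OF L2D(2)[OF assms]] by (simp add: L2_norm_def L2_inner_self)

lemma L2_bounded:
  assumes "finite_measure M" "u \<in> borel_measurable M" "AE x in M. \<bar>u x\<bar> \<le> K"
  shows "u \<in> L2 M"
proof -
  interpret finite_measure M by fact
  have "integrable M (\<lambda>x. (u x)\<^sup>2)"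
  proof (rule integrable_const_bound[where B = "K\<^sup>2"])
    show "AE x in M. norm ((u x)\<^sup>2) \<le> K\<^sup>2"
      using assms(3) by eventually_elim (metis abs_le_square_iff abs_of_nonneg abs_ge_zero order_trans real_norm_def power2_abs abs_power2)
  qed (use assms in auto)
  then show ?thesis using assms by (simp add: L2_def)
qed

lemma L2_integrable:
  assumes "finite_measure M" "u \<in> L2 M"
  shows "integrable M u"
  using L2_integrable_mult[OF assms(2) L2_bounded[OF assms(1), of "\<lambda>x. 1" 1]] by simp

section \<open>Smooth bumps\<close>

text \<open>\<open>flat 0\<close> is the classical function exp(-1/t), extended by 0. Powers of 1/t
  are included because differentiation then stays inside the linear span of the family.\<close>

definition flat :: "nat \<Rightarrow> real \<Rightarrow> real" where
  "flat n t = (if t > 0 then inverse t ^ n * exp (- inverse t) else 0)"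

lemma flat_tendsto_0: "(flat n \<longlongrightarrow> 0) (at 0)"
proof -
  have "((\<lambda>s. inverse s ^ n / exp (inverse s)) \<longlongrightarrow> (0::real)) (at_right 0)"
    using filterlim_compose[OF tendsto_power_div_exp_0 filterlim_inverse_at_top_right] by simp
  then have "(flat n \<longlongrightarrow> 0) (at_right 0)"
    by (rule Lim_transform_eventually)
      (auto simp: flat_def exp_minus field_simps eventually_at_right_less intro: eventually_at_rightI[of 0 1])
  moreover have "(flat n \<longlongrightarrow> 0) (at_left 0)"
    by (rule tendsto_eventually) (auto simp: flat_def intro: eventually_at_leftI[of "-1"])
  ultimately show ?thesis by (simp add: filterlim_at_split)
qed

lemma flat_has_derivative:
  "(flat n has_real_derivative flat (n + 2) t - real n * flat (n + 1) t) (at t)"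
proof (cases t "0 :: real" rule: linorder_cases)
  case less
  have "((\<lambda>t. 0) has_real_derivative 0) (at t)" by simp
  moreover have "eventually (\<lambda>s. s < 0) (nhds t)"
    using less by (intro eventually_nhds_in_open[of "{..<0}", simplified]) auto
  then have "eventually (\<lambda>s. flat n s = 0) (nhds t)"
    by eventually_elim (simp add: flat_def)
  ultimately show ?thesis using less
    by (subst DERIV_cong_ev[OF refl _ refl, where g = "\<lambda>_. 0"]) (auto simp: flat_def)
next
  case equal
  \<comment> \<open>At 0 the difference quotient of \<open>flat n\<close> is
    \<open>flat (n + 1)\<close>, so differentiability there is the limit already proved.\<close>
  have "((\<lambda>h. flat n h / h) \<longlongrightarrow> 0) (at 0)"
    by (rule Lim_transform_eventually[OF flat_tendsto_0[of "n + 1"]])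
      (auto simp: flat_def field_simps eventually_at_filter)
  then show ?thesis using equal by (simp add: DERIV_def) (simp add: flat_def)
next
  case greater
  have "eventually (\<lambda>s. s > 0) (nhds t)"
    using greater by (intro eventually_nhds_in_open[of "{0<..}", simplified]) auto
  then have ev: "eventually (\<lambda>s. flat n s = inverse s ^ n * exp (- inverse s)) (nhds t)"
    by eventually_elim (simp add: flat_def)
  have "((\<lambda>s. inverse s ^ n * exp (- inverse s)) has_real_derivative
      inverse t ^ n * (inverse t * inverse t * exp (- inverse t))
      + - (real n * inverse t ^ (n - 1) * (inverse t * inverse t)) * exp (- inverse t)) (at t)"
    using greater by (auto intro!: derivative_eq_intros simp: power2_eq_square)
  moreover have "inverse t ^ n * (inverse t * inverse t * exp (- inverse t))
      + - (real n * inverse t ^ (n - 1) * (inverse t * inverse t)) * exp (- inverse t)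
      = flat (n + 2) t - real n * flat (n + 1) t"
    using greater by (cases n) (simp_all add: flat_def algebra_simps)
  ultimately show ?thesis
    by (subst DERIV_cong_ev[OF refl ev refl]) simp
qed

lemma flat_nonneg: "flat n t \<ge> 0"
  by (simp add: flat_def)

lemma flat_0_le_1: "flat 0 t \<le> 1"
  by (simp add: flat_def)

lemma flat_eq_0_iff: "flat n t = 0 \<longleftrightarrow> t \<le> 0"
  by (simp add: flat_def)

lemma flat_0_at_top: "(flat 0 \<longlongrightarrow> 1) at_top"
proof -
  have "((\<lambda>t::real. exp (- inverse t)) \<longlongrightarrow> exp (- 0)) at_top"
    by (intro tendsto_intros tendsto_inverse_0_at_top filterlim_ident)
  then have "((\<lambda>t::real. exp (- inverse t)) \<longlongrightarrow> 1) at_top" by simp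
  then show ?thesis
    by (rule Lim_transform_eventually)
      (use eventually_gt_at_top[of "0::real"] in \<open>eventually_elim, simp add: flat_def\<close>)
qed

inductive_set smooth_alg :: "(real^2 \<Rightarrow> real) set" where
  const: "(\<lambda>x. a) \<in> smooth_alg"
| coord: "(\<lambda>x. x $ i) \<in> smooth_alg"
| add: "f \<in> smooth_alg \<Longrightarrow> g \<in> smooth_alg \<Longrightarrow> (\<lambda>x. f x + g x) \<in> smooth_alg"
| mult: "f \<in> smooth_alg \<Longrightarrow> g \<in> smooth_alg \<Longrightarrow> (\<lambda>x. f x * g x) \<in> smooth_alg"
| flat: "f \<in> smooth_alg \<Longrightarrow> (\<lambda>x. flat n (f x)) \<in> smooth_alg"

lemma partial_derivI:
  fixes f :: "real^2 \<Rightarrow> real"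
  assumes "(f has_derivative (\<lambda>h. h $ 1 * D 1 + h $ 2 * D 2)) (at x)"
  shows "partial_deriv i f x = D i"
proof -
  have "i = 1 \<or> i = 2" by (rule exhaust_2)
  then show ?thesis
    unfolding partial_deriv_def frechet_derivative_at[OF assms, symmetric]
    by (auto simp: axis_def)
qed

lemma partial_deriv_works:
  fixes f :: "real^2 \<Rightarrow> real"
  assumes "f differentiable (at x)"
  shows "(f has_derivative (\<lambda>h. h $ 1 * partial_deriv 1 f x + h $ 2 * partial_deriv 2 f x)) (at x)"
proof -
  have f: "(f has_derivative frechet_derivative f (at x)) (at x)"
    using assms frechet_derivative_works by blast
  then interpret linear "frechet_derivative f (at x)" by (rule has_derivative_linear)
  have "frechet_derivative f (at x) h = h $ 1 * partial_deriv 1 f x + h $ 2 * partial_deriv 2 f x" for h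
  proof -
    have "h = h $ 1 *\<^sub>R axis 1 1 + h $ 2 *\<^sub>R axis 2 1"
      by (simp add: vec_eq_iff forall_2 axis_def)
    then have "frechet_derivative f (at x) h
        = frechet_derivative f (at x) (h $ 1 *\<^sub>R axis 1 1 + h $ 2 *\<^sub>R axis 2 1)" by simp
    then show ?thesis unfolding add scale by (simp add: partial_deriv_def)
  qed
  then have "frechet_derivative f (at x) = (\<lambda>h. h $ 1 * partial_deriv 1 f x + h $ 2 * partial_deriv 2 f x)"
    by (rule ext)
  with f show ?thesis by (rule subst[rotated])
qed

lemma smooth_alg_has_derivative:
  assumes "f \<in> smooth_alg"
  shows "\<exists>D. (\<forall>i. D i \<in> smooth_alg) \<and>
    (\<forall>x. (f has_derivative (\<lambda>h. h $ 1 * D (1::2) x + h $ 2 * D 2 x)) (at x))"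
  using assms
proof induction
  case (const a)
  show ?case by (rule exI[of _ "\<lambda>i x. 0"]) (auto intro: smooth_alg.const)
next
  case (coord i)
  have "((\<lambda>x. x $ i) has_derivative (\<lambda>h. h $ 1 * (if i = 1 then 1 else 0) + h $ 2 * (if i = 2 then 1 else 0))) (at x)"
    for x :: "real^2"
  proof -
    have "(\<lambda>h :: real^2. h $ 1 * (if i = 1 then 1 else 0) + h $ 2 * (if i = 2 then 1 else 0)) = (\<lambda>h. h $ i)"
      using exhaust_2[of i] by auto
    then show ?thesis by (simp add: bounded_linear.has_derivative[OF bounded_linear_vec_nth])
  qed
  then show ?case
    by (intro exI[of _ "\<lambda>j x. if i = j then 1 else 0"]) (auto intro: smooth_alg.const)
next
  case (add f g)
  obtain D where D: "\<And>i. D i \<in> smooth_alg"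
    "\<And>x. (f has_derivative (\<lambda>h. h $ 1 * D (1::2) x + h $ 2 * D 2 x)) (at x)"
    using add.IH(1) by blast
  obtain E where E: "\<And>i. E i \<in> smooth_alg"
    "\<And>x. (g has_derivative (\<lambda>h. h $ 1 * E (1::2) x + h $ 2 * E 2 x)) (at x)"
    using add.IH(2) by blast
  have "((\<lambda>x. f x + g x) has_derivative
      (\<lambda>h. h $ 1 * (D 1 x + E 1 x) + h $ 2 * (D 2 x + E 2 x))) (at x)" for x
    using has_derivative_add[OF D(2) E(2)] by (simp add: algebra_simps)
  then show ?case
    by (intro exI[of _ "\<lambda>i x. D i x + E i x"]) (use D E in \<open>auto intro: smooth_alg.intros\<close>)
next
  case (mult f g)
  obtain D where D: "\<And>i. D i \<in> smooth_alg"
    "\<And>x. (f has_derivative (\<lambda>h. h $ 1 * D (1::2) x + h $ 2 * D 2 x)) (at x)"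
    using mult.IH(1) by blast
  obtain E where E: "\<And>i. E i \<in> smooth_alg"
    "\<And>x. (g has_derivative (\<lambda>h. h $ 1 * E (1::2) x + h $ 2 * E 2 x)) (at x)"
    using mult.IH(2) by blast
  have "((\<lambda>x. f x * g x) has_derivative
      (\<lambda>h. h $ 1 * (f x * E 1 x + D 1 x * g x) + h $ 2 * (f x * E 2 x + D 2 x * g x))) (at x)" for x
    using has_derivative_mult[OF D(2) E(2)] by (simp add: algebra_simps)
  then show ?case
    by (intro exI[of _ "\<lambda>i x. f x * E i x + D i x * g x"] conjI allI smooth_alg.add smooth_alg.mult
        mult.hyps D E)
next
  case (flat f n)
  obtain D where D: "\<And>i. D i \<in> smooth_alg"
    "\<And>x. (f has_derivative (\<lambda>h. h $ 1 * D (1::2) x + h $ 2 * D 2 x)) (at x)"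
    using flat.IH by blast
  define F where "F = (\<lambda>x. flat (n + 2) (f x) + (- real n) * flat (n + 1) (f x))"
  have F: "F \<in> smooth_alg" unfolding F_def using flat.hyps by (intro smooth_alg.intros)
  have "((\<lambda>x. flat n (f x)) has_derivative (\<lambda>h. h $ 1 * (F x * D 1 x) + h $ 2 * (F x * D 2 x))) (at x)" for x
  proof -
    have "((\<lambda>x. flat n (f x)) has_derivative (\<lambda>h. (h $ 1 * D 1 x + h $ 2 * D 2 x) * F x)) (at x)"
      using DERIV_compose_FDERIV[OF flat_has_derivative D(2)[of x], of n] by (simp add: F_def)
    then show ?thesis by (simp add: algebra_simps)
  qed
  then show ?case
    by (intro exI[of _ "\<lambda>i x. F x * D i x"]) (use F D in \<open>auto intro: smooth_alg.intros\<close>)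
qed

lemma smooth_alg_partial_deriv:
  assumes "f \<in> smooth_alg"
  shows "partial_deriv i f \<in> smooth_alg"
proof -
  obtain D where D: "\<And>i. D i \<in> smooth_alg"
    "\<And>x. (f has_derivative (\<lambda>h. h $ 1 * D (1::2) x + h $ 2 * D 2 x)) (at x)"
    using smooth_alg_has_derivative[OF assms] by blast
  have "partial_deriv i f = D i"
    using partial_derivI[of f "\<lambda>j. D j x" x i for x] D(2) by blast
  then show ?thesis using D by simp
qed

lemma smooth_alg_differentiable: "f \<in> smooth_alg \<Longrightarrow> f differentiable (at x)"
  using smooth_alg_has_derivative differentiableI by blast

lemma smooth_alg_imp_smooth:
  assumes "f \<in> smooth_alg"
  shows "smooth f"
proof -
  have "foldr partial_deriv js f \<in> smooth_alg" for js
    by (induction js) (auto intro: assms smooth_alg_partial_deriv)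
  then show ?thesis unfolding smooth_def using smooth_alg_differentiable by blast
qed

lemma smooth_alg_translate:
  assumes "f \<in> smooth_alg"
  shows "(\<lambda>x. f (x + a)) \<in> smooth_alg"
  using assms by induction (auto intro: smooth_alg.intros)

lemma smooth_alg_diff: "f \<in> smooth_alg \<Longrightarrow> g \<in> smooth_alg \<Longrightarrow> (\<lambda>x. f x - g x) \<in> smooth_alg"
  using smooth_alg.add[OF _ smooth_alg.mult[OF smooth_alg.const[of "-1"]], of f g] by simp

lemma smooth_alg_sum: "(\<And>i. i \<in> J \<Longrightarrow> f i \<in> smooth_alg) \<Longrightarrow> (\<lambda>x. \<Sum>i\<in>J. f i x) \<in> smooth_alg"
  by (induction J rule: infinite_finite_induct) (auto intro: smooth_alg.intros)

section \<open>Test functions and cutoffs\<close>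

lemma smooth_differentiable: "smooth f \<Longrightarrow> f differentiable (at x)"
  unfolding smooth_def by (metis foldr.simps(1) id_apply)

lemma smooth_partial_deriv_differentiable: "smooth f \<Longrightarrow> partial_deriv i f differentiable (at x)"
  unfolding smooth_def by (metis foldr_Cons foldr.simps(1) id_apply comp_apply)

lemma differentiable_imp_continuous_UNIV:
  fixes f :: "real^2 \<Rightarrow> real"
  assumes "\<And>x. f differentiable (at x)"
  shows "continuous_on UNIV f"
  using assms by (simp add: continuous_on_eq_continuous_at differentiable_imp_continuous_within)

text \<open>Differences, multiples and translates stay in \<open>smooth_alg\<close> by its rules;
  for arbitrary test functions each would require rules for derivatives of all orders.\<close>

definition bumps :: "(real^2) set \<Rightarrow> (real^2 \<Rightarrow> real) set" where
  "bumps \<Omega> = smooth_alg \<inter> test_functions \<Omega>"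

lemma bumps_test: "\<phi> \<in> bumps \<Omega> \<Longrightarrow> \<phi> \<in> test_functions \<Omega>"
  by (simp add: bumps_def)

lemma bumpsI:
  assumes "\<phi> \<in> smooth_alg" "compact K" "K \<subseteq> \<Omega>" "\<And>x. x \<notin> K \<Longrightarrow> \<phi> x = 0"
  shows "\<phi> \<in> bumps \<Omega>"
proof -
  have sub: "closure {x. \<phi> x \<noteq> 0} \<subseteq> K"
    using assms by (intro closure_minimal compact_imp_closed) auto
  then have "compact (closure {x. \<phi> x \<noteq> 0})"
    using compact_Int_closed[OF assms(2) closed_closure] by (metis inf.absorb2)
  then show ?thesis using sub assms smooth_alg_imp_smooth by (auto simp: bumps_def test_functions_def)
qed

lemma test_function_support:
  assumes "\<phi> \<in> test_functions \<Omega>"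
  shows "\<exists>K. compact K \<and> K \<subseteq> \<Omega> \<and> (\<forall>x. x \<notin> K \<longrightarrow> \<phi> x = 0) \<and> (\<forall>i x. x \<notin> K \<longrightarrow> partial_deriv i \<phi> x = 0)"
proof (intro exI conjI allI impI)
  let ?K = "closure {x. \<phi> x \<noteq> 0}"
  show "compact ?K" "?K \<subseteq> \<Omega>" using assms by (auto simp: test_functions_def)
  show 0: "\<phi> x = 0" if "x \<notin> ?K" for x using that closure_subset[of "{x. \<phi> x \<noteq> 0}"] by auto
  show "partial_deriv i \<phi> x = 0" if "x \<notin> ?K" for i x
  proof -
    have "((\<lambda>x. 0) has_derivative (\<lambda>h. 0)) (at x)" by simp
    then have "(\<phi> has_derivative (\<lambda>h. 0)) (at x)"
    proof (rule has_derivative_transform_within_open[where s = "- ?K"])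
      show "x \<in> - ?K" using that by simp
      show "0 = \<phi> y" if "y \<in> - ?K" for y using 0[of y] that by simp
    qed (rule open_Compl[OF closed_closure])
    then show ?thesis using partial_derivI[of \<phi> "\<lambda>_. 0" x i] by simp
  qed
qed

lemma bumps_diff:
  assumes "f \<in> bumps \<Omega>" "g \<in> bumps \<Omega>"
  shows "(\<lambda>x. f x - g x) \<in> bumps \<Omega>"
proof -
  obtain K where K: "compact K" "K \<subseteq> \<Omega>" "\<And>x. x \<notin> K \<Longrightarrow> f x = 0"
    using test_function_support[OF bumps_test[OF assms(1)]] by blast
  obtain L where L: "compact L" "L \<subseteq> \<Omega>" "\<And>x. x \<notin> L \<Longrightarrow> g x = 0"
    using test_function_support[OF bumps_test[OF assms(2)]] by blast
  show ?thesis
    by (rule bumpsI[of _ "K \<union> L"]) (use assms K L in \<open>auto simp: bumps_def intro: smooth_alg_diff\<close>)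
qed

lemma bumps_scale:
  assumes "f \<in> bumps \<Omega>"
  shows "(\<lambda>x. a * f x) \<in> bumps \<Omega>"
proof -
  obtain K where K: "compact K" "K \<subseteq> \<Omega>" "\<And>x. x \<notin> K \<Longrightarrow> f x = 0"
    using test_function_support[OF bumps_test[OF assms]] by blast
  show ?thesis
    by (rule bumpsI[of _ K]) (use assms K in \<open>auto simp: bumps_def intro: smooth_alg.intros\<close>)
qed

lemma test_function_bounded:
  assumes "\<phi> \<in> test_functions \<Omega>"
  obtains B where "\<And>x. \<bar>\<phi> x\<bar> \<le> B" "\<And>i x. \<bar>partial_deriv i \<phi> x\<bar> \<le> B" "B \<ge> 0"
proof -
  obtain K where K: "compact K" "K \<subseteq> \<Omega>" "\<And>x. x \<notin> K \<Longrightarrow> \<phi> x = 0"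
    "\<And>i x. x \<notin> K \<Longrightarrow> partial_deriv i \<phi> x = 0" using test_function_support[OF assms] by blast
  have s: "smooth \<phi>" using assms by (simp add: test_functions_def)
  have *: "\<exists>B. \<forall>x. \<bar>g x\<bar> \<le> B" if "continuous_on UNIV g" "\<And>x. x \<notin> K \<Longrightarrow> g x = 0" for g :: "real^2 \<Rightarrow> real"
  proof -
    have "bounded (g ` K)"
      using compact_continuous_image[OF continuous_on_subset[OF that(1)] K(1)] by (auto intro: compact_imp_bounded)
    then obtain B where B: "\<And>x. x \<in> K \<Longrightarrow> \<bar>g x\<bar> \<le> B" by (auto simp: bounded_iff)
    have "\<bar>g x\<bar> \<le> \<bar>B\<bar>" for x using B[of x] that(2)[of x] by (cases "x \<in> K") auto
    then show ?thesis by blast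
  qed
  obtain B where B: "\<And>x. \<bar>\<phi> x\<bar> \<le> B"
    using *[of \<phi>] s K differentiable_imp_continuous_UNIV smooth_differentiable by metis
  have "\<exists>B. \<forall>x. \<bar>partial_deriv i \<phi> x\<bar> \<le> B" for i
    using *[of "partial_deriv i \<phi>"] s K differentiable_imp_continuous_UNIV
      smooth_partial_deriv_differentiable by metis
  then obtain B' where B': "\<And>i x. \<bar>partial_deriv i \<phi> x\<bar> \<le> B' i" by metis
  show ?thesis
  proof (rule that[of "\<bar>B\<bar> + \<bar>B' 1\<bar> + \<bar>B' 2\<bar>"])
    show "\<bar>\<phi> x\<bar> \<le> \<bar>B\<bar> + \<bar>B' 1\<bar> + \<bar>B' 2\<bar>" for x using B[of x] by linarith
    show "\<bar>partial_deriv i \<phi> x\<bar> \<le> \<bar>B\<bar> + \<bar>B' 1\<bar> + \<bar>B' 2\<bar>" for i x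
      using B'[of 1 x] B'[of 2 x] exhaust_2[of i] by auto
  qed auto
qed

lemma test_function_borel:
  assumes "\<phi> \<in> test_functions \<Omega>"
  shows "\<phi> \<in> borel_measurable borel" "partial_deriv i \<phi> \<in> borel_measurable borel"
  using assms unfolding test_functions_def
  by (auto intro!: borel_measurable_continuous_onI differentiable_imp_continuous_UNIV
      simp: smooth_differentiable smooth_partial_deriv_differentiable)

text \<open>
  With the boxes exhausting \<open>W\<close> carrying bumps \<open>b\<^sub>i\<close>, the cutoff \<open>flat 0 (k \<cdot> (\<Sum>i<k. b\<^sub>i) - 1)\<close>
  is supported in the compact set where \<open>\<Sum>i<k. b\<^sub>i \<ge> 1/k\<close>.
\<close>

lemma cutoff_functions:
  assumes "open W" "W \<subseteq> \<Omega>" "bounded W"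
  obtains \<phi> :: "nat \<Rightarrow> real^2 \<Rightarrow> real"
  where "\<And>k. \<phi> k \<in> bumps \<Omega>" "\<And>k x. 0 \<le> \<phi> k x \<and> \<phi> k x \<le> 1"
    "\<And>k x. x \<notin> W \<Longrightarrow> \<phi> k x = 0" "\<And>x. (\<lambda>k. \<phi> k x) \<longlonglongrightarrow> indicator W x"
proof -
  obtain \<D> where \<D>: "countable \<D>" "\<And>X. X \<in> \<D> \<Longrightarrow> \<exists>a b. X = box a b" "\<Union>\<D> = W"
    using open_countable_Union_open_box[OF assms(1)] by metis
  \<comment> \<open>The empty box keeps the family nonempty even if \<open>W\<close> is empty, so
    that it can be enumerated by \<open>from_nat_into\<close>.\<close>
  have ne: "insert {} \<D> \<noteq> {}" and ct: "countable (insert {} \<D>)" using \<D> by auto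
  define X where "X = from_nat_into (insert {} \<D>)"
  have ran: "range X = insert {} \<D>" unfolding X_def using range_from_nat_into[OF ne ct] .
  have "\<exists>a b. X n = box a b" for n
  proof (cases "X n = {}")
    case True
    then show ?thesis by (intro exI[of _ 0]) simp
  next
    case False
    then show ?thesis using \<D>(2) ran by (metis insert_iff rangeI)
  qed
  then obtain a b where ab: "\<And>n. X n = box (a n) (b n)" by metis
  \<comment> \<open>One factor per side of the box: the product is positive exactly in the open
    box.\<close>
  define \<beta> :: "nat \<Rightarrow> real^2 \<Rightarrow> real" where "\<beta> n x = flat 0 (x $ 1 + - a n $ 1) * flat 0 (b n $ 1 + -1 * x $ 1) *
    (flat 0 (x $ 2 + - a n $ 2) * flat 0 (b n $ 2 + -1 * x $ 2))" for n x
  have \<beta>_alg: "\<beta> n \<in> smooth_alg" for n unfolding \<beta>_def by (intro smooth_alg.intros)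
  have \<beta>_nonneg: "\<beta> n x \<ge> 0" for n x by (simp add: \<beta>_def flat_nonneg)
  have \<beta>_pos: "\<beta> n x > 0 \<longleftrightarrow> x \<in> X n" for n x
  proof -
    have "\<beta> n x \<noteq> 0 \<longleftrightarrow> x \<in> X n"
      unfolding ab \<beta>_def mem_box_cart forall_2 by (auto simp: flat_eq_0_iff)
    then show ?thesis using \<beta>_nonneg[of n x] by linarith
  qed
  define s where "s k x = (\<Sum>i<k. \<beta> i x)" for k x
  define \<phi> where "\<phi> k x = flat 0 (real k * s k x + - 1)" for k x
  have s_alg: "s k \<in> smooth_alg" for k unfolding s_def by (intro smooth_alg_sum \<beta>_alg)
  then have \<phi>_alg: "\<phi> k \<in> smooth_alg" for k unfolding \<phi>_def by (intro smooth_alg.intros)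
  have s_out: "s k x = 0" if "x \<notin> W" for k x
  proof -
    have "x \<notin> X n" for n using that \<D>(3) ran by (metis UnionI insert_iff empty_iff rangeI)
    then show ?thesis using \<beta>_pos \<beta>_nonneg unfolding s_def by (metis antisym_conv2 sum.neutral)
  qed
  show thesis
  proof
    show "0 \<le> \<phi> k x \<and> \<phi> k x \<le> 1" for k x by (simp add: \<phi>_def flat_nonneg flat_0_le_1)
    show "\<phi> k x = 0" if "x \<notin> W" for k x using s_out[OF that] by (simp add: \<phi>_def flat_def)
    show "\<phi> k \<in> bumps \<Omega>" for k
    proof (rule bumpsI[OF \<phi>_alg, of "{x. real k * s k x \<ge> 1}"])
      have sub: "{x. real k * s k x \<ge> 1} \<subseteq> W" using s_out by force
      then show "{x. real k * s k x \<ge> 1} \<subseteq> \<Omega>" using assms by blast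
      have "closed {x. real k * s k x \<ge> 1}"
        using differentiable_imp_continuous_UNIV[OF smooth_alg_differentiable[OF s_alg]]
        by (intro closed_Collect_le continuous_intros) auto
      then show "compact {x. real k * s k x \<ge> 1}"
        using bounded_subset[OF assms(3) sub] by (simp add: compact_eq_bounded_closed)
    qed (auto simp: \<phi>_def flat_def)
    show "(\<lambda>k. \<phi> k x) \<longlonglongrightarrow> indicator W x" for x
    proof (cases "x \<in> W")
      case False
      then show ?thesis using s_out[OF False] by (simp add: \<phi>_def flat_def)
    next
      case True
      then obtain n where n: "x \<in> X n" using \<D>(3) ran by (metis UnionE insertI2 rangeE)
      \<comment> \<open>A single box containing \<open>x\<close> already drives the argument of
        \<open>flat 0\<close> to infinity.\<close>
      have "filterlim (\<lambda>k. - 1 + real k * \<beta> n x) at_top sequentially"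
        using \<beta>_pos[of n x] n
        by (intro filterlim_tendsto_add_at_top[OF tendsto_const]
            filterlim_at_top_mult_tendsto_pos[OF tendsto_const] filterlim_real_sequentially) auto
      moreover have "eventually (\<lambda>k. - 1 + real k * \<beta> n x \<le> real k * s k x + - 1) sequentially"
        using eventually_gt_at_top[of n]
      proof eventually_elim
        case (elim k)
        have "\<beta> n x \<le> s k x" unfolding s_def
          by (rule member_le_sum) (use elim \<beta>_nonneg in auto)
        then show ?case by (simp add: mult_left_mono)
      qed
      ultimately have "filterlim (\<lambda>k. real k * s k x + - 1) at_top sequentially"
        by (rule filterlim_at_top_mono)
      from filterlim_compose[OF flat_0_at_top this] show ?thesis using True by (simp add: \<phi>_def)
    qed
  qed
qed

section \<open>Density of test functions\<close>

lemma L2_norm_dominated_tendsto_0: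
  assumes [measurable]: "\<And>k. U k \<in> borel_measurable M" "u \<in> borel_measurable M"
    and "w \<in> L2 M" "\<And>k x. x \<in> space M \<Longrightarrow> \<bar>u x - U k x\<bar> \<le> \<bar>w x\<bar>"
    and "\<And>x. x \<in> space M \<Longrightarrow> (\<lambda>k. U k x) \<longlonglongrightarrow> u x"
  shows "(\<lambda>k. L2_norm M (\<lambda>x. u x - U k x)) \<longlonglongrightarrow> 0"
proof -
  have "(\<lambda>k. LINT x|M. (u x - U k x)\<^sup>2) \<longlonglongrightarrow> (LINT x|M. 0)"
  proof (rule integral_dominated_convergence)
    show "integrable M (\<lambda>x. (w x)\<^sup>2)" using assms(3) by (rule L2D)
    show "AE x in M. (\<lambda>k. (u x - U k x)\<^sup>2) \<longlonglongrightarrow> 0"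
    proof (rule AE_I2)
      fix x assume "x \<in> space M"
      then have "(\<lambda>k. (u x - U k x)\<^sup>2) \<longlonglongrightarrow> (u x - u x)\<^sup>2"
        by (intro tendsto_intros assms(5))
      then show "(\<lambda>k. (u x - U k x)\<^sup>2) \<longlonglongrightarrow> 0" by simp
    qed
    show "AE x in M. norm ((u x - U k x)\<^sup>2) \<le> (w x)\<^sup>2" for k
      using assms(4)[of _ k] by (auto simp: abs_le_square_iff)
  qed auto
  then have "(\<lambda>k. sqrt (LINT x|M. (u x - U k x)\<^sup>2)) \<longlonglongrightarrow> sqrt 0"
    by (intro tendsto_real_sqrt) simp
  then show ?thesis by (simp add: L2_norm_def L2_inner_self)
qed

lemma borel_measurable_lebesgue_onI:
  "f \<in> borel_measurable borel \<Longrightarrow> f \<in> borel_measurable (lebesgue_on S)"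
  by (intro measurable_restrict_space1 measurable_completion) simp

text \<open>Nonemptiness is left to \<open>bounded_convex_set\<close>, because these results are
  also applied to \<open>overlap h\<close>, which can be empty.\<close>

locale bounded_open_set =
  fixes \<Omega> :: "(real^2) set"
  assumes open_set: "open \<Omega>" and bounded_set: "bounded \<Omega>"
begin

abbreviation "M \<equiv> lebesgue_on \<Omega>"

lemma lmeasurable: "\<Omega> \<in> lmeasurable"
  using bounded_set open_set by (rule lmeasurable_open)

lemma sets_lebesgue: "\<Omega> \<in> sets lebesgue"
  using lmeasurable by (rule fmeasurableD)

lemma finite_M: "finite_measure M"
  using lmeasurable by (simp add: finite_measure_lebesgue_on)

lemma const_L2: "(\<lambda>x. a) \<in> L2 M"
  by (rule L2_bounded[OF finite_M, of _ "\<bar>a\<bar>"]) auto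

lemma test_function_L2:
  assumes "\<phi> \<in> test_functions U"
  shows "\<phi> \<in> L2 M" "partial_deriv i \<phi> \<in> L2 M"
proof -
  obtain B where B: "\<And>x. \<bar>\<phi> x\<bar> \<le> B" "\<And>i x. \<bar>partial_deriv i \<phi> x\<bar> \<le> B"
    using test_function_bounded[OF assms] by metis
  note meas = test_function_borel[OF assms, THEN borel_measurable_lebesgue_onI]
  show "\<phi> \<in> L2 M" by (rule L2_bounded[OF finite_M meas(1), where K = B]) (simp add: B)
  show "partial_deriv i \<phi> \<in> L2 M" by (rule L2_bounded[OF finite_M meas(2), where K = B]) (simp add: B)
qed

lemma bumps_L2: "\<phi> \<in> bumps \<Omega> \<Longrightarrow> \<phi> \<in> L2 M"
  by (intro test_function_L2 bumps_test)

text \<open>Named to serve as an induction predicate: density passes from indicators of open sets to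
  measurable sets, then by monotone limits to nonnegative functions, then to differences of
  these.\<close>

definition approximable :: "(real^2 \<Rightarrow> real) set" where
  "approximable = {u \<in> L2 M. \<forall>e>0. \<exists>\<phi>\<in>bumps \<Omega>. L2_norm M (\<lambda>x. u x - \<phi> x) < e}"

lemma approximable_closed:
  assumes "u \<in> L2 M" "\<And>e. e > 0 \<Longrightarrow> \<exists>v\<in>approximable. L2_norm M (\<lambda>x. u x - v x) < e"
  shows "u \<in> approximable"
proof -
  have "\<exists>\<phi>\<in>bumps \<Omega>. L2_norm M (\<lambda>x. u x - \<phi> x) < e" if e: "e > 0" for e
  proof -
    obtain v where v: "v \<in> approximable" "L2_norm M (\<lambda>x. u x - v x) < e / 2"
      using assms(2)[OF half_gt_zero[OF e]] by blast
    then obtain \<phi> where \<phi>: "\<phi> \<in> bumps \<Omega>" "L2_norm M (\<lambda>x. v x - \<phi> x) < e / 2"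
      using e by (auto simp: approximable_def dest!: spec[of _ "e / 2"])
    have "v \<in> L2 M" using v by (simp add: approximable_def)
    with L2_norm_triangle[of "\<lambda>x. u x - v x" M "\<lambda>x. v x - \<phi> x"] assms(1) bumps_L2[OF \<phi>(1)]
    have "L2_norm M (\<lambda>x. u x - \<phi> x) \<le> L2_norm M (\<lambda>x. u x - v x) + L2_norm M (\<lambda>x. v x - \<phi> x)"
      by (simp add: L2.diff_mem)
    with v \<phi> have "L2_norm M (\<lambda>x. u x - \<phi> x) < e" by linarith
    with \<phi> show ?thesis by blast
  qed
  with assms(1) show ?thesis by (auto simp: approximable_def)
qed

lemma bumps_approximable: "\<phi> \<in> bumps \<Omega> \<Longrightarrow> \<phi> \<in> approximable"
  by (auto simp: approximable_def bumps_L2 L2_norm_def L2_inner_def intro!: bexI[of _ \<phi>])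

lemma approximable_diff:
  assumes "u \<in> approximable" "v \<in> approximable"
  shows "(\<lambda>x. u x - v x) \<in> approximable"
proof (rule approximable_closed)
  have uv: "u \<in> L2 M" "v \<in> L2 M" using assms by (auto simp: approximable_def)
  then show "(\<lambda>x. u x - v x) \<in> L2 M" by (rule L2.diff_mem)
  fix e :: real assume "e > 0"
  then obtain \<phi> \<psi> where p: "\<phi> \<in> bumps \<Omega>" "L2_norm M (\<lambda>x. u x - \<phi> x) < e / 2"
    "\<psi> \<in> bumps \<Omega>" "L2_norm M (\<lambda>x. v x - \<psi> x) < e / 2"
    using assms by (auto simp: approximable_def dest!: spec[of _ "e / 2"])
  have "L2_norm M (\<lambda>x. (u x - v x) - (\<phi> x - \<psi> x)) = L2_norm M (\<lambda>x. (u x - \<phi> x) - (v x - \<psi> x))"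
    by (simp add: algebra_simps)
  also have "\<dots> \<le> L2_norm M (\<lambda>x. u x - \<phi> x) + L2_norm M (\<lambda>x. v x - \<psi> x)"
    by (intro L2_norm_triangle_diff L2.diff_mem uv bumps_L2 p)
  also have "\<dots> < e" using p by linarith
  finally show "\<exists>w\<in>approximable. L2_norm M (\<lambda>x. (u x - v x) - w x) < e"
    using bumps_approximable[OF bumps_diff[OF p(1,3)]] by (intro bexI)
qed

lemma approximable_scale:
  assumes "u \<in> approximable"
  shows "(\<lambda>x. a * u x) \<in> approximable"
proof (rule approximable_closed)
  have u: "u \<in> L2 M" using assms by (auto simp: approximable_def)
  then show "(\<lambda>x. a * u x) \<in> L2 M" by (rule L2_scale)
  fix e :: real assume "e > 0"
  then have "e / (\<bar>a\<bar> + 1) > 0" by simp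
  then obtain \<phi> where p: "\<phi> \<in> bumps \<Omega>" "L2_norm M (\<lambda>x. u x - \<phi> x) < e / (\<bar>a\<bar> + 1)"
    using assms by (auto simp: approximable_def)
  have "L2_norm M (\<lambda>x. a * u x - a * \<phi> x) = \<bar>a\<bar> * L2_norm M (\<lambda>x. u x - \<phi> x)"
    using L2_norm_scale[OF L2.diff_mem[OF u bumps_L2[OF p(1)]], of a] by (simp add: algebra_simps)
  also have "\<dots> \<le> (\<bar>a\<bar> + 1) * L2_norm M (\<lambda>x. u x - \<phi> x)"
    by (intro mult_right_mono L2_norm_nonneg) auto
  also have "\<dots> < e" using p(2) by (simp add: field_simps pos_less_divide_eq)
  finally show "\<exists>w\<in>approximable. L2_norm M (\<lambda>x. a * u x - w x) < e"
    using bumps_approximable[OF bumps_scale[OF p(1)]] by (intro bexI)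
qed

lemma approximable_indicator_open:
  assumes "open W" "W \<subseteq> \<Omega>"
  shows "indicator W \<in> approximable"
proof (rule approximable_closed)
  obtain \<phi> :: "nat \<Rightarrow> real^2 \<Rightarrow> real" where \<phi>: "\<And>k. \<phi> k \<in> bumps \<Omega>"
    "\<And>k x. 0 \<le> \<phi> k x \<and> \<phi> k x \<le> 1" "\<And>x. (\<lambda>k. \<phi> k x) \<longlonglongrightarrow> indicator W x"
    using cutoff_functions[OF assms bounded_subset[OF bounded_set assms(2)]] by metis
  have meas: "indicator W \<in> borel_measurable M"
    using assms by (intro borel_measurable_lebesgue_onI) (simp add: borel_open)
  show "indicator W \<in> L2 M"
    by (rule L2_bounded[OF finite_M meas, of 1]) (auto simp: indicator_def)
  fix e :: real assume "e > 0"
  have "(\<lambda>k. L2_norm M (\<lambda>x. indicator W x - \<phi> k x)) \<longlonglongrightarrow> 0"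
  proof (rule L2_norm_dominated_tendsto_0[where w = "\<lambda>x. 1"])
    show "\<bar>indicator W x - \<phi> k x\<bar> \<le> \<bar>1\<bar>" for k x
      using \<phi>(2)[of k x] by (auto simp: indicator_def)
  qed (use \<phi> meas const_L2 L2D(1)[OF bumps_L2] in auto)
  then have "eventually (\<lambda>k. L2_norm M (\<lambda>x. indicator W x - \<phi> k x) < e) sequentially"
    using \<open>e > 0\<close> by (rule order_tendstoD)
  then show "\<exists>v\<in>approximable. L2_norm M (\<lambda>x. indicator W x - v x) < e"
    using bumps_approximable[OF \<phi>(1)] by (auto simp: eventually_sequentially)
qed

lemma approximable_indicator:
  assumes A: "A \<in> sets M"
  shows "indicator A \<in> approximable"
proof (rule approximable_closed)
  have A': "A \<in> sets lebesgue" "A \<subseteq> \<Omega>"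
    using A sets_lebesgue by (auto simp: sets_restrict_space_iff)
  have meas: "indicator A \<in> borel_measurable M" using A by simp
  show "indicator A \<in> L2 M"
    by (rule L2_bounded[OF finite_M meas, of 1]) (auto simp: indicator_def)
  fix e :: real assume "e > 0"
  then have "e\<^sup>2 > 0" by simp
  \<comment> \<open>The squared L2 distance between nested indicators is the measure of the
    difference set, hence the tolerance \<open>e\<^sup>2\<close>.\<close>
  from sets_lebesgue_outer_open[OF A'(1) this] obtain T where T: "open T" "A \<subseteq> T"
    "T - A \<in> lmeasurable" "emeasure lebesgue (T - A) < ennreal (e\<^sup>2)" by blast
  define W where "W = T \<inter> \<Omega>"
  have W: "open W" "W \<subseteq> \<Omega>" "A \<subseteq> W" "W - A \<subseteq> T - A"
    using T A' open_set by (auto simp: W_def)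
  have WA: "W - A \<in> sets lebesgue"
    using W(1) A'(1) by (intro sets.Diff) auto
  have WAM: "W - A \<in> sets M" using WA W sets_lebesgue by (auto simp: sets_restrict_space_iff)
  have "(L2_norm M (\<lambda>x. indicator A x - indicator W x))\<^sup>2 = (LINT x|M. indicator (W - A) x)"
    unfolding L2_norm_power2
    by (rule Bochner_Integration.integral_cong) (use W in \<open>auto simp: indicator_def\<close>)
  also have "\<dots> = measure M (W - A)"
    using WAM sets.sets_into_space[OF WAM] by (simp add: Int_absorb2)
  also have "\<dots> = measure lebesgue (W - A)"
    using W sets_lebesgue by (subst measure_restrict_space) auto
  also have "\<dots> \<le> measure lebesgue (T - A)"
    using W WA T by (intro measure_mono_fmeasurable)
  also have "\<dots> < e\<^sup>2"
    using T \<open>e > 0\<close> by (simp add: emeasure_eq_measure2 ennreal_less_iff)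
  finally have "L2_norm M (\<lambda>x. indicator A x - indicator W x) < e"
    using \<open>e > 0\<close> by (simp add: power2_less_imp_less)
  then show "\<exists>v\<in>approximable. L2_norm M (\<lambda>x. indicator A x - v x) < e"
    using approximable_indicator_open[OF W(1,2)] by blast
qed

lemma approximable_nonneg:
  assumes "u \<in> L2 M" "\<And>x. u x \<ge> 0"
  shows "u \<in> approximable"
proof -
  \<comment> \<open>The induction runs through all nonnegative measurable functions, so membership
    in \<open>L2 M\<close> has to be part of the induction statement; the constituents inherit it by
    domination or scaling.\<close>
  have "u \<in> L2 M \<longrightarrow> u \<in> approximable"
    using L2D(1)[OF assms(1)] assms(2)
  proof (induction rule: borel_measurable_induct_real)
    case (set A)
    then show ?case using approximable_indicator by blast
  next
    case (mult u c)
    show ?case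
    proof (cases "c = 0")
      case True
      have "(\<lambda>x. 0) \<in> approximable"
      proof -
        have "(\<lambda>x. 0) = (indicator {} :: real^2 \<Rightarrow> real)" by (simp add: fun_eq_iff)
        then show ?thesis using approximable_indicator[of "{}"] by simp
      qed
      then show ?thesis using True by simp
    next
      case False
      have "u \<in> L2 M" if "(\<lambda>x. c * u x) \<in> L2 M"
        using L2_scale[OF that, of "1 / c"] False by simp
      then show ?thesis using mult approximable_scale by blast
    qed
  next
    case (add u v)
    have *: "f \<in> L2 M" if "(\<lambda>x. v x + u x) \<in> L2 M" "f \<in> borel_measurable M"
      "\<And>x. 0 \<le> f x" "\<And>x. f x \<le> v x + u x" for f
    proof -
      have "integrable M (\<lambda>x. (f x)\<^sup>2)"
        by (rule Bochner_Integration.integrable_bound[OF L2D(2)[OF that(1)]])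
          (use that(2-4) in \<open>auto intro!: power_mono\<close>)
      with that show ?thesis by (simp add: L2_def)
    qed
    have "(\<lambda>x. v x + u x) \<in> approximable" if vu: "(\<lambda>x. v x + u x) \<in> L2 M"
    proof -
      have "u \<in> approximable" "v \<in> approximable"
        using *[OF vu, of u] *[OF vu, of v] add by auto
      then show ?thesis
        using approximable_diff[of v "\<lambda>x. -1 * u x"] approximable_scale[of u "-1"] by simp
    qed
    then show ?case by blast
  next
    case (seq U)
    show ?case
    proof
      assume u: "u \<in> L2 M"
      have le: "U k x \<le> u x" if "x \<in> space M" for k x
        using incseq_le[OF _ seq.hyps(4)[OF that]] seq.hyps(3) by (auto simp: incseq_def le_fun_def)
      have UL2: "U k \<in> L2 M" for k
      proof -
        have "integrable M (\<lambda>x. (U k x)\<^sup>2)"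
          by (rule Bochner_Integration.integrable_bound[OF L2D(2)[OF u]])
            (use seq.hyps le in \<open>auto intro!: power_mono AE_I2\<close>)
        then show ?thesis using seq.hyps by (simp add: L2_def)
      qed
      show "u \<in> approximable"
      proof (rule approximable_closed[OF u])
        fix e :: real assume "e > 0"
        have "(\<lambda>k. L2_norm M (\<lambda>x. u x - U k x)) \<longlonglongrightarrow> 0"
        proof (rule L2_norm_dominated_tendsto_0[where w = u])
          show "\<bar>u x - U k x\<bar> \<le> \<bar>u x\<bar>" if "x \<in> space M" for k x
            using le[OF that, of k] seq.hyps(2)[of k x] by linarith
        qed (use u L2D(1)[OF u] seq.hyps in auto)
        then have "eventually (\<lambda>k. L2_norm M (\<lambda>x. u x - U k x) < e) sequentially"
          using \<open>e > 0\<close> by (rule order_tendstoD)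
        then show "\<exists>v\<in>approximable. L2_norm M (\<lambda>x. u x - v x) < e"
          using seq.IH UL2 by (auto simp: eventually_sequentially)
      qed
    qed
  qed
  then show ?thesis using assms by blast
qed

lemma bumps_dense:
  assumes u: "u \<in> L2 M" and "e > 0"
  obtains \<phi> where "\<phi> \<in> bumps \<Omega>" "L2_norm M (\<lambda>x. u x - \<phi> x) < e"
proof -
  have part: "(\<lambda>x. max (s * u x) 0) \<in> L2 M" if "\<bar>s\<bar> = 1" for s
  proof -
    have "integrable M (\<lambda>x. (max (s * u x) 0)\<^sup>2)"
    proof (rule Bochner_Integration.integrable_bound[OF L2D(2)[OF u]])
      show "AE x in M. norm ((max (s * u x) 0)\<^sup>2) \<le> norm ((u x)\<^sup>2)"
      proof (rule AE_I2)
        fix x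
        have "\<bar>max (s * u x) 0\<bar> \<le> \<bar>u x\<bar>" using that by (auto simp: abs_if max_def split: if_splits)
        then have "(max (s * u x) 0)\<^sup>2 \<le> (u x)\<^sup>2" by (rule abs_le_square_iff[THEN iffD1])
        then show "norm ((max (s * u x) 0)\<^sup>2) \<le> norm ((u x)\<^sup>2)" by simp
      qed
    qed (use L2D(1)[OF u] in measurable)
    then show ?thesis using L2D(1)[OF u] by (simp add: L2_def)
  qed
  have "(\<lambda>x. max (1 * u x) 0 - max (-1 * u x) 0) \<in> approximable"
    by (intro approximable_diff approximable_nonneg part) auto
  moreover have "(\<lambda>x. max (1 * u x) 0 - max (-1 * u x) 0) = u" by (auto simp: max_def)
  ultimately have "u \<in> approximable" by simp
  with assms(2) show ?thesis using that by (auto simp: approximable_def)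
qed

text \<open>Testing with \<open>w\<close> itself would give the claim at once; density of the bumps
  makes this possible up to an error.\<close>

lemma L2_norm_le_dual:
  assumes w: "w \<in> L2 M" and K: "K \<ge> 0"
    and bound: "\<And>\<phi>. \<phi> \<in> bumps \<Omega> \<Longrightarrow> \<bar>L2_inner M w \<phi>\<bar> \<le> K * L2_norm M \<phi>"
  shows "L2_norm M w \<le> K"
proof (rule field_le_epsilon)
  fix e :: real assume e: "e > 0"
  show "L2_norm M w \<le> K + e"
  proof (rule ccontr)
    assume *: "\<not> L2_norm M w \<le> K + e"
    let ?N = "L2_norm M w"
    have N: "?N > K + e" "?N > 0" using * e K by auto
    \<comment> \<open>Chosen so that the total error \<open>(?N + K) * d\<close> stays below
      \<open>e * ?N\<close>; the extra 1 makes this strict.\<close>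
    define d where "d = e * ?N / (K + ?N + 1)"
    have d: "d > 0" using e N K by (simp add: d_def)
    obtain \<phi> where \<phi>: "\<phi> \<in> bumps \<Omega>" "L2_norm M (\<lambda>x. w x - \<phi> x) < d"
      using bumps_dense[OF w d] by blast
    have \<phi>2: "\<phi> \<in> L2 M" using bumps_L2[OF \<phi>(1)] .
    have "?N\<^sup>2 = L2_inner M w w" by (simp add: L2_norm_power2 L2_inner_self)
    also have "\<dots> = L2_inner M w (\<lambda>x. w x - \<phi> x) + L2_inner M w \<phi>"
      using w \<phi>2 by (simp add: L2.diff_right)
    also have "\<dots> \<le> ?N * L2_norm M (\<lambda>x. w x - \<phi> x) + K * L2_norm M \<phi>"
      using L2_Cauchy_Schwarz[OF w L2.diff_mem[OF w \<phi>2]] bound[OF \<phi>(1)] by linarith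
    also have "\<dots> \<le> ?N * d + K * (?N + d)"
    proof -
      have "L2_norm M \<phi> \<le> ?N + L2_norm M (\<lambda>x. w x - \<phi> x)"
        using L2_norm_triangle_diff[OF w L2.diff_mem[OF w \<phi>2]] by simp
      then show ?thesis using \<phi>(2) N K by (intro add_mono mult_left_mono) auto
    qed
    also have "\<dots> < K * ?N + e * ?N"
    proof -
      have "(?N + K) * d < (K + ?N + 1) * d" using d by simp
      also have "\<dots> = e * ?N" using N K by (simp add: d_def)
      finally show ?thesis by (simp add: algebra_simps)
    qed
    also have "\<dots> = (K + e) * ?N" by (simp add: algebra_simps)
    also have "\<dots> < ?N\<^sup>2" using N by (simp add: power2_eq_square)
    finally show False .
  qed
qed

text \<open>Fundamental lemma of the calculus of variations, as the case \<open>K = 0\<close> of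
  \<open>L2_norm_le_dual\<close>.\<close>

lemma L2_eq_0_if_orthogonal_test:
  assumes "w \<in> L2 M" "\<And>\<phi>. \<phi> \<in> test_functions \<Omega> \<Longrightarrow> L2_inner M w \<phi> = 0"
  shows "AE x in M. w x = 0"
proof -
  have "L2_norm M w \<le> 0" by (rule L2_norm_le_dual) (use assms bumps_test in auto)
  then show ?thesis using L2_norm_eq_0[OF assms(1)] L2_norm_nonneg[of M w] by simp
qed

end

section \<open>Sobolev functions\<close>

definition dir_deriv :: "real^2 \<Rightarrow> (real^2 \<Rightarrow> real) \<Rightarrow> real^2 \<Rightarrow> real" where
  "dir_deriv h \<phi> x = h $ 1 * partial_deriv 1 \<phi> x + h $ 2 * partial_deriv 2 \<phi> x"

lemma line_derivative:
  assumes "smooth \<phi>"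
  shows "((\<lambda>s. \<phi> (x - s *\<^sub>R h)) has_real_derivative - dir_deriv h \<phi> (x - s *\<^sub>R h)) (at s)"
proof -
  have "((\<lambda>s. x - s *\<^sub>R h) has_derivative (\<lambda>r. - (r *\<^sub>R h))) (at s)"
    by (auto intro!: derivative_eq_intros)
  from has_derivative_compose[OF this partial_deriv_works[OF smooth_differentiable[OF assms]]]
  have "((\<lambda>s. \<phi> (x - s *\<^sub>R h)) has_derivative
    (\<lambda>r. (- (r *\<^sub>R h)) $ 1 * partial_deriv 1 \<phi> (x - s *\<^sub>R h)
       + (- (r *\<^sub>R h)) $ 2 * partial_deriv 2 \<phi> (x - s *\<^sub>R h))) (at s)" .
  then show ?thesis
    unfolding has_field_derivative_def
    by (rule has_derivative_eq_rhs) (auto simp: dir_deriv_def algebra_simps)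
qed

lemma partial_deriv_translate:
  assumes "smooth \<phi>"
  shows "partial_deriv i (\<lambda>x. \<phi> (x + a)) x = partial_deriv i \<phi> (x + a)"
proof -
  have "((\<lambda>x. x + a) has_derivative (\<lambda>h. h)) (at x)" by (auto intro!: derivative_eq_intros)
  from has_derivative_compose[OF this partial_deriv_works[OF smooth_differentiable[OF assms]]]
  have "((\<lambda>x. \<phi> (x + a)) has_derivative
    (\<lambda>h. h $ 1 * partial_deriv 1 \<phi> (x + a) + h $ 2 * partial_deriv 2 \<phi> (x + a))) (at x)" .
  then show ?thesis
    using partial_derivI[of "\<lambda>x. \<phi> (x + a)" "\<lambda>i. partial_deriv i \<phi> (x + a)" x i] by simp
qed

lemma order_le_1_cases:
  "fst \<alpha> + snd \<alpha> \<le> 1 \<longleftrightarrow> \<alpha> = (0, 0) \<or> \<alpha> = (1, 0) \<or> \<alpha> = (0, 1 :: nat)"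
  by (cases \<alpha>) auto

lemma borel_measurable_translate:
  fixes f :: "real^2 \<Rightarrow> real"
  assumes [measurable]: "f \<in> borel_measurable borel"
  shows "(\<lambda>x. f (x + a)) \<in> borel_measurable borel"
  by measurable

context bounded_open_set
begin

text \<open>Translation acts on the smooth factor, so \<open>u\<close> need only be square
  integrable. The Lipschitz bound of \<open>\<phi>\<close> along \<open>h\<close> gives the
  dominating function \<open>\<bar>u x\<bar> * K\<close>.\<close>

lemma inner_translate_derivative:
  assumes u: "u \<in> L2 M" and \<phi>: "\<phi> \<in> test_functions U"
  shows "((\<lambda>t. L2_inner M u (\<lambda>x. \<phi> (x - t *\<^sub>R h))) has_real_derivative
    - L2_inner M u (\<lambda>x. dir_deriv h \<phi> (x - t *\<^sub>R h))) (at t)"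
proof -
  have sm: "smooth \<phi>" using \<phi> by (simp add: test_functions_def)
  obtain B where B: "\<And>x. \<bar>\<phi> x\<bar> \<le> B" "\<And>i x. \<bar>partial_deriv i \<phi> x\<bar> \<le> B" "B \<ge> 0"
    using test_function_bounded[OF \<phi>] by blast
  define K where "K = \<bar>h $ 1\<bar> * B + \<bar>h $ 2\<bar> * B"
  have dB: "\<bar>dir_deriv h \<phi> x\<bar> \<le> K" for x
    unfolding dir_deriv_def K_def
    by (intro order_trans[OF abs_triangle_ineq] add_mono) (auto simp: abs_mult intro!: mult_left_mono B)
  have lip: "\<bar>\<phi> (x - a *\<^sub>R h) - \<phi> (x - b *\<^sub>R h)\<bar> \<le> K * \<bar>a - b\<bar>" for x a b
    using field_differentiable_bound[of UNIV "\<lambda>s. \<phi> (x - s *\<^sub>R h)" "\<lambda>s. - dir_deriv h \<phi> (x - s *\<^sub>R h)" K a b]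
      line_derivative[OF sm] dB by simp
  note bor = test_function_borel[OF \<phi>]
  have [measurable]: "u \<in> borel_measurable M" using L2D(1)[OF u] .
  have [measurable]: "(\<lambda>x. \<phi> (x - a)) \<in> borel_measurable M" for a
    using borel_measurable_translate[OF bor(1), of "- a"] by (intro borel_measurable_lebesgue_onI) simp
  have [measurable]: "(\<lambda>x. dir_deriv h \<phi> (x - a)) \<in> borel_measurable M" for a
    unfolding dir_deriv_def
    using borel_measurable_translate[OF bor(2), where a = "- a"]
    by (intro borel_measurable_lebesgue_onI borel_measurable_add borel_measurable_times) auto
  have int: "integrable M (\<lambda>x. u x * \<phi> (x - a))" for a
    by (intro L2_integrable_mult u L2_bounded[OF finite_M, of _ B]) (auto intro: B)
  show ?thesis
    \<comment> \<open>The limit is taken along sequences, the form in which dominated convergence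
      applies.\<close>
    unfolding DERIV_def tendsto_at_iff_sequentially
  proof (intro allI impI)
    fix X :: "nat \<Rightarrow> real" assume X: "\<forall>i. X i \<in> UNIV - {0}" "X \<longlonglongrightarrow> 0"
    have lim: "(\<lambda>n. LINT x|M. u x * ((\<phi> (x - (t + X n) *\<^sub>R h) - \<phi> (x - t *\<^sub>R h)) / X n))
      \<longlonglongrightarrow> (LINT x|M. u x * - dir_deriv h \<phi> (x - t *\<^sub>R h))"
    proof (rule integral_dominated_convergence)
      show "integrable M (\<lambda>x. \<bar>u x\<bar> * K)" using L2_integrable[OF finite_M u] by simp
      show "AE x in M. norm (u x * ((\<phi> (x - (t + X n) *\<^sub>R h) - \<phi> (x - t *\<^sub>R h)) / X n)) \<le> \<bar>u x\<bar> * K" for n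
      proof (rule AE_I2)
        fix x
        have "\<bar>\<phi> (x - (t + X n) *\<^sub>R h) - \<phi> (x - t *\<^sub>R h)\<bar> \<le> K * \<bar>X n\<bar>"
          using lip[of x "t + X n" t] by simp
        moreover have "\<bar>X n\<bar> > 0" using X(1) by simp
        ultimately have "\<bar>(\<phi> (x - (t + X n) *\<^sub>R h) - \<phi> (x - t *\<^sub>R h)) / X n\<bar> \<le> K"
          by (simp add: abs_divide pos_divide_le_eq)
        then show "norm (u x * ((\<phi> (x - (t + X n) *\<^sub>R h) - \<phi> (x - t *\<^sub>R h)) / X n)) \<le> \<bar>u x\<bar> * K"
          unfolding real_norm_def abs_mult by (rule mult_left_mono) simp
      qed
      show "AE x in M. (\<lambda>n. u x * ((\<phi> (x - (t + X n) *\<^sub>R h) - \<phi> (x - t *\<^sub>R h)) / X n))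
        \<longlonglongrightarrow> u x * - dir_deriv h \<phi> (x - t *\<^sub>R h)"
      proof (rule AE_I2)
        fix x
        have "(\<lambda>n. (\<phi> (x - (t + X n) *\<^sub>R h) - \<phi> (x - t *\<^sub>R h)) / X n) \<longlonglongrightarrow> - dir_deriv h \<phi> (x - t *\<^sub>R h)"
          using line_derivative[OF sm, of x h t] X
          unfolding DERIV_def tendsto_at_iff_sequentially comp_def by blast
        then show "(\<lambda>n. u x * ((\<phi> (x - (t + X n) *\<^sub>R h) - \<phi> (x - t *\<^sub>R h)) / X n))
          \<longlonglongrightarrow> u x * - dir_deriv h \<phi> (x - t *\<^sub>R h)" by (rule tendsto_mult_left)
      qed
    qed measurable
    have quot: "(LINT x|M. u x * ((\<phi> (x - (t + X n) *\<^sub>R h) - \<phi> (x - t *\<^sub>R h)) / X n))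
      = (L2_inner M u (\<lambda>x. \<phi> (x - (t + X n) *\<^sub>R h)) - L2_inner M u (\<lambda>x. \<phi> (x - t *\<^sub>R h))) / X n" for n
      unfolding L2_inner_def
      by (simp add: Bochner_Integration.integral_diff[OF int int, symmetric] algebra_simps diff_divide_distrib
          flip: Bochner_Integration.integral_divide_zero)
    have deriv: "(LINT x|M. u x * - dir_deriv h \<phi> (x - t *\<^sub>R h))
      = - L2_inner M u (\<lambda>x. dir_deriv h \<phi> (x - t *\<^sub>R h))"
      unfolding L2_inner_def by simp
    show "((\<lambda>s. (L2_inner M u (\<lambda>x. \<phi> (x - (t + s) *\<^sub>R h)) - L2_inner M u (\<lambda>x. \<phi> (x - t *\<^sub>R h))) / s) \<circ> X)
      \<longlonglongrightarrow> - L2_inner M u (\<lambda>x. dir_deriv h \<phi> (x - t *\<^sub>R h))"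
      using lim unfolding comp_def quot deriv .
  qed
qed

lemma integral_eq_lborel:
  fixes f :: "real^2 \<Rightarrow> real"
  assumes "f \<in> borel_measurable borel" "\<And>x. x \<notin> \<Omega> \<Longrightarrow> f x = 0"
  shows "(LINT x|M. f x) = (LINT x|lborel. f x)"
proof -
  have "(LINT x|M. f x) = (LINT x|lebesgue. indicator \<Omega> x *\<^sub>R f x)"
    using sets_lebesgue by (subst integral_restrict_space) auto
  also have "\<dots> = (LINT x|lebesgue. f x)"
    by (rule Bochner_Integration.integral_cong) (use assms(2) in \<open>auto simp: indicator_def\<close>)
  also have "\<dots> = (LINT x|lborel. f x)"
    by (rule integral_completion) (use assms in simp)
  finally show ?thesis .
qed

lemma integral_translate_lborel:
  fixes f :: "real^2 \<Rightarrow> real"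
  assumes [measurable]: "f \<in> borel_measurable borel"
  shows "(LINT x|lborel. f (x + a)) = (LINT x|lborel. f x)"
proof -
  have "(LINT x|lborel. f x) = (LINT x|distr lborel borel ((+) a). f x)"
    by (simp add: lborel_distr_plus)
  also have "\<dots> = (LINT x|lborel. f (a + x))"
    by (rule integral_distr) auto
  finally show ?thesis by (simp add: add.commute)
qed

text \<open>The integral of \<open>\<phi>\<close> is invariant under shifts so small that the
  support stays in \<Omega>; its derivative in the shift is, up to sign, the integral in
  question.\<close>

lemma integral_partial_deriv_test:
  assumes \<phi>: "\<phi> \<in> test_functions \<Omega>"
  shows "(LINT x|M. partial_deriv i \<phi> x) = 0"
proof -
  obtain K where K: "compact K" "K \<subseteq> \<Omega>" "\<And>x. x \<notin> K \<Longrightarrow> \<phi> x = 0"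
    using test_function_support[OF \<phi>] by blast
  \<comment> \<open>A uniform margin between support and boundary; since \<open>h\<close> is a unit
    vector, shifts \<open>s\<close> with \<open>\<bar>s\<bar> < e\<close> are harmless.\<close>
  obtain e where e: "e > 0" "(\<Union>x\<in>K. ball x e) \<subseteq> \<Omega>"
    using compact_subset_open_imp_ball_epsilon_subset[OF K(1) open_set K(2)] by blast
  have sm: "smooth \<phi>" using \<phi> by (simp add: test_functions_def)
  define h :: "real^2" where "h = axis i 1"
  have dir: "dir_deriv h \<phi> x = partial_deriv i \<phi> x" for x
    using exhaust_2[of i] by (auto simp: dir_deriv_def h_def axis_def)
  define G where "G s = L2_inner M (\<lambda>x. 1) (\<lambda>x. \<phi> (x - s *\<^sub>R h))" for s
  have G: "(G has_real_derivative - (LINT x|M. partial_deriv i \<phi> x)) (at 0)"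
    using inner_translate_derivative[OF const_L2[of 1] \<phi>, of h 0]
    unfolding G_def by (simp add: dir L2_inner_def)
  have const: "G s = (LINT x|lborel. \<phi> x)" if s: "s \<in> {-e<..<e}" for s
  proof -
    have out: "\<phi> (x - s *\<^sub>R h) = 0" if "x \<notin> \<Omega>" for x
    proof -
      have "norm h = 1" by (simp add: h_def)
      then have "dist (x - s *\<^sub>R h) x < e" using s by (auto simp: dist_norm)
      then have "x \<in> (\<Union>x\<in>K. ball x e)" if "x - s *\<^sub>R h \<in> K"
        using that by (intro UN_I) (simp_all only: mem_ball)
      then have "x \<in> \<Omega>" if "x - s *\<^sub>R h \<in> K" using that e(2) by blast
      then have "x - s *\<^sub>R h \<notin> K" using \<open>x \<notin> \<Omega>\<close> by blast
      then show ?thesis using K(3) by blast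
    qed
    have bor: "(\<lambda>x. \<phi> (x - s *\<^sub>R h)) \<in> borel_measurable borel"
      using borel_measurable_translate[OF test_function_borel(1)[OF \<phi>], of "- (s *\<^sub>R h)"] by simp
    have "G s = (LINT x|M. \<phi> (x - s *\<^sub>R h))" by (simp add: G_def L2_inner_def)
    also have "\<dots> = (LINT x|lborel. \<phi> (x - s *\<^sub>R h))"
      by (rule integral_eq_lborel[OF bor out])
    also have "\<dots> = (LINT x|lborel. \<phi> x)"
      using integral_translate_lborel[OF test_function_borel(1)[OF \<phi>], of "- (s *\<^sub>R h)"] by simp
    finally show ?thesis .
  qed
  have "((\<lambda>s. LINT x|lborel. \<phi> x) has_real_derivative 0) (at 0)" by simp
  then have "(G has_real_derivative 0) (at 0)"
    by (rule has_field_derivative_transform_within_open[where S = "{-e<..<e}"])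
      (use const e(1) in auto)
  from DERIV_unique[OF G this] show ?thesis by simp
qed

section \<open>Calculus of weak derivatives and the gradient form\<close>

lemma weak_deriv_unique:
  assumes "v \<in> L2 M" "w \<in> L2 M" "has_weak_deriv \<Omega> \<alpha> u v" "has_weak_deriv \<Omega> \<alpha> u w"
  shows "AE x in M. v x = w x"
proof -
  have "AE x in M. v x - w x = 0"
  proof (rule L2_eq_0_if_orthogonal_test)
    show "(\<lambda>x. v x - w x) \<in> L2 M" using assms by (simp add: L2.diff_mem)
    fix \<phi> assume \<phi>: "\<phi> \<in> test_functions \<Omega>"
    have "L2_inner M v \<phi> = L2_inner M w \<phi>"
      using assms(3,4) \<phi> unfolding has_weak_deriv_def by auto
    then show "L2_inner M (\<lambda>x. v x - w x) \<phi> = 0"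
      using assms(1,2) test_function_L2(1)[OF \<phi>] by (simp add: L2.diff_left)
  qed
  then show ?thesis by simp
qed

lemma weak_deriv_exists:
  assumes "v \<in> L2 M" "has_weak_deriv \<Omega> \<alpha> u v"
  shows "weak_deriv \<Omega> \<alpha> u \<in> L2 M" "has_weak_deriv \<Omega> \<alpha> u (weak_deriv \<Omega> \<alpha> u)"
  using someI[of "\<lambda>v. v \<in> L2 M \<and> has_weak_deriv \<Omega> \<alpha> u v" v] assms
  unfolding weak_deriv_def by auto

lemma weak_deriv_AE:
  assumes "v \<in> L2 M" "has_weak_deriv \<Omega> \<alpha> u v"
  shows "AE x in M. weak_deriv \<Omega> \<alpha> u x = v x"
  using weak_deriv_unique[OF weak_deriv_exists(1)[OF assms] assms(1) weak_deriv_exists(2)[OF assms] assms(2)] .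

lemma sobolevD:
  assumes "u \<in> sobolev \<Omega> k"
  shows "u \<in> L2 M"
    and "fst \<alpha> + snd \<alpha> \<le> k \<Longrightarrow> weak_deriv \<Omega> \<alpha> u \<in> L2 M"
    and "fst \<alpha> + snd \<alpha> \<le> k \<Longrightarrow> has_weak_deriv \<Omega> \<alpha> u (weak_deriv \<Omega> \<alpha> u)"
  using assms weak_deriv_exists unfolding sobolev_def by blast+

lemma has_weak_deriv_0: "has_weak_deriv \<Omega> (0, 0) u u"
  by (simp add: has_weak_deriv_def)

text \<open>Provides the integrability behind the linearity of weak derivatives: without it the
  integral of a sum need not split.\<close>

lemma multi_deriv_L2:
  assumes "\<phi> \<in> test_functions \<Omega>" "fst \<alpha> + snd \<alpha> \<le> 1"
  shows "multi_deriv \<alpha> \<phi> \<in> L2 M"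
  using assms(2) test_function_L2[OF assms(1)] unfolding order_le_1_cases by auto

lemma has_weak_deriv_add:
  assumes "u \<in> L2 M" "u' \<in> L2 M" "v \<in> L2 M" "v' \<in> L2 M" "fst \<alpha> + snd \<alpha> \<le> 1"
    "has_weak_deriv \<Omega> \<alpha> u v" "has_weak_deriv \<Omega> \<alpha> u' v'"
  shows "has_weak_deriv \<Omega> \<alpha> (\<lambda>x. u x + u' x) (\<lambda>x. v x + v' x)"
  using assms(6,7) unfolding has_weak_deriv_def
  by (auto simp: L2.add_left assms(1-4) multi_deriv_L2[OF _ assms(5)] test_function_L2(1) distrib_left)

lemma has_weak_deriv_scale:
  assumes "u \<in> L2 M" "v \<in> L2 M" "fst \<alpha> + snd \<alpha> \<le> 1" "has_weak_deriv \<Omega> \<alpha> u v"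
  shows "has_weak_deriv \<Omega> \<alpha> (\<lambda>x. a * u x) (\<lambda>x. a * v x)"
  using assms(4) unfolding has_weak_deriv_def
  by (auto simp: L2.scale_left assms(1,2) multi_deriv_L2[OF _ assms(3)] test_function_L2(1))

lemma sobolev_1I:
  assumes "u \<in> L2 M" "\<And>\<alpha>. fst \<alpha> + snd \<alpha> \<le> 1 \<Longrightarrow> v \<alpha> \<in> L2 M"
    "\<And>\<alpha>. fst \<alpha> + snd \<alpha> \<le> 1 \<Longrightarrow> has_weak_deriv \<Omega> \<alpha> u (v \<alpha>)"
  shows "u \<in> sobolev \<Omega> 1"
  using assms unfolding sobolev_def by blast

lemma sobolev_add:
  assumes "u \<in> sobolev \<Omega> 1" "v \<in> sobolev \<Omega> 1"
  shows "(\<lambda>x. u x + v x) \<in> sobolev \<Omega> 1"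
    and "fst \<alpha> + snd \<alpha> \<le> 1 \<Longrightarrow>
      AE x in M. weak_deriv \<Omega> \<alpha> (\<lambda>x. u x + v x) x = weak_deriv \<Omega> \<alpha> u x + weak_deriv \<Omega> \<alpha> v x"
proof -
  note u = sobolevD[OF assms(1)] and v = sobolevD[OF assms(2)]
  have L: "(\<lambda>x. weak_deriv \<Omega> \<alpha> u x + weak_deriv \<Omega> \<alpha> v x) \<in> L2 M"
    if "fst \<alpha> + snd \<alpha> \<le> 1" for \<alpha> by (rule L2_add[OF u(2)[OF that] v(2)[OF that]])
  have D: "has_weak_deriv \<Omega> \<alpha> (\<lambda>x. u x + v x) (\<lambda>x. weak_deriv \<Omega> \<alpha> u x + weak_deriv \<Omega> \<alpha> v x)"
    if "fst \<alpha> + snd \<alpha> \<le> 1" for \<alpha>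
    by (rule has_weak_deriv_add[OF u(1) v(1) u(2)[OF that] v(2)[OF that] that u(3)[OF that] v(3)[OF that]])
  show "(\<lambda>x. u x + v x) \<in> sobolev \<Omega> 1"
    by (rule sobolev_1I[OF L2_add[OF u(1) v(1)] L D])
  show "AE x in M. weak_deriv \<Omega> \<alpha> (\<lambda>x. u x + v x) x = weak_deriv \<Omega> \<alpha> u x + weak_deriv \<Omega> \<alpha> v x"
    if "fst \<alpha> + snd \<alpha> \<le> 1"
    by (rule weak_deriv_AE[OF L[OF that] D[OF that]])
qed

lemma sobolev_scale:
  assumes "u \<in> sobolev \<Omega> 1"
  shows "(\<lambda>x. a * u x) \<in> sobolev \<Omega> 1"
    and "fst \<alpha> + snd \<alpha> \<le> 1 \<Longrightarrow>
      AE x in M. weak_deriv \<Omega> \<alpha> (\<lambda>x. a * u x) x = a * weak_deriv \<Omega> \<alpha> u x"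
proof -
  note u = sobolevD[OF assms]
  have L: "(\<lambda>x. a * weak_deriv \<Omega> \<alpha> u x) \<in> L2 M"
    if "fst \<alpha> + snd \<alpha> \<le> 1" for \<alpha> by (rule L2_scale[OF u(2)[OF that]])
  have D: "has_weak_deriv \<Omega> \<alpha> (\<lambda>x. a * u x) (\<lambda>x. a * weak_deriv \<Omega> \<alpha> u x)"
    if "fst \<alpha> + snd \<alpha> \<le> 1" for \<alpha>
    by (rule has_weak_deriv_scale[OF u(1) u(2)[OF that] that u(3)[OF that]])
  show "(\<lambda>x. a * u x) \<in> sobolev \<Omega> 1"
    by (rule sobolev_1I[OF L2_scale[OF u(1)] L D])
  show "AE x in M. weak_deriv \<Omega> \<alpha> (\<lambda>x. a * u x) x = a * weak_deriv \<Omega> \<alpha> u x"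
    if "fst \<alpha> + snd \<alpha> \<le> 1"
    by (rule weak_deriv_AE[OF L[OF that] D[OF that]])
qed

text \<open>For the zero derivative of a constant the defining identity is
  \<open>integral_partial_deriv_test\<close>. This is what allows mean values to be
  subtracted.\<close>

lemma sobolev_const:
  shows "(\<lambda>x. a) \<in> sobolev \<Omega> 1"
    and "\<alpha> = (1, 0) \<or> \<alpha> = (0, 1) \<Longrightarrow> AE x in M. weak_deriv \<Omega> \<alpha> (\<lambda>x. a) x = 0"
proof -
  have *: "has_weak_deriv \<Omega> \<alpha> (\<lambda>x. a) (\<lambda>x. 0)" if "\<alpha> = (1, 0) \<or> \<alpha> = (0, 1)" for \<alpha>
    using that integral_partial_deriv_test unfolding has_weak_deriv_def L2_inner_def by auto
  show "(\<lambda>x. a) \<in> sobolev \<Omega> 1"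
  proof (rule sobolev_1I[where v = "\<lambda>\<alpha>. if \<alpha> = (0, 0) then (\<lambda>x. a) else (\<lambda>x. 0)"])
    show "has_weak_deriv \<Omega> \<alpha> (\<lambda>x. a) (if \<alpha> = (0, 0) then (\<lambda>x. a) else (\<lambda>x. 0))"
      if "fst \<alpha> + snd \<alpha> \<le> 1" for \<alpha>
      using that * has_weak_deriv_0 unfolding order_le_1_cases by auto
  qed (auto simp: const_L2)
  show "AE x in M. weak_deriv \<Omega> \<alpha> (\<lambda>x. a) x = 0" if "\<alpha> = (1, 0) \<or> \<alpha> = (0, 1)"
    by (rule weak_deriv_AE[OF const_L2 *[OF that]])
qed

text \<open>Turns a pointwise linear relation on \<Omega> into an element of the kernel of the
  gradient seminorm, the form in which the Riesz theorem asks for finite dimension.\<close>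

lemma sobolev_eq_0:
  assumes "u \<in> sobolev \<Omega> 1" "\<And>x. x \<in> \<Omega> \<Longrightarrow> u x = 0"
  shows "AE x in M. weak_deriv \<Omega> \<alpha> u x = 0"
proof (rule weak_deriv_AE[OF const_L2])
  have "L2_inner M u \<psi> = 0" for \<psi>
    unfolding L2_inner_def
    using assms(2) by (intro integral_eq_zero_AE AE_I2) (simp add: space_restrict_space)
  then show "has_weak_deriv \<Omega> \<alpha> u (\<lambda>x. 0)"
    by (simp add: has_weak_deriv_def) (simp add: L2_inner_def)
qed

abbreviation "D1 \<equiv> weak_deriv \<Omega> (1, 0)"
abbreviation "D2 \<equiv> weak_deriv \<Omega> (0, 1)"

lemma D_L2:
  assumes "u \<in> sobolev \<Omega> 1"
  shows "D1 u \<in> L2 M" "D2 u \<in> L2 M"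
  using sobolevD(2)[OF assms] by auto

lemma grad_inner_eq:
  assumes "u \<in> sobolev \<Omega> 1" "v \<in> sobolev \<Omega> 1"
  shows "grad_inner \<Omega> u v = L2_inner M (D1 u) (D1 v) + L2_inner M (D2 u) (D2 v)"
proof -
  have "weak_grad \<Omega> u x \<bullet> weak_grad \<Omega> v x = D1 u x * D1 v x + D2 u x * D2 v x" for x
    by (simp add: weak_grad_def inner_vec_def sum_2)
  then show ?thesis
    using D_L2[OF assms(1)] D_L2[OF assms(2)]
    by (simp add: grad_inner_def L2_inner_def L2_integrable_mult)
qed

text \<open>\<open>weak_deriv\<close> is a choice, so its linearity holds only almost everywhere and
  has to be carried through the integrals.\<close>

lemma semi_inner_grad: "semi_inner (sobolev \<Omega> 1) (grad_inner \<Omega>)"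
proof
  show "(\<lambda>x. 0) \<in> sobolev \<Omega> 1" by (rule sobolev_const)
  fix u v w a
  assume u: "u \<in> sobolev \<Omega> 1"
  show "(\<lambda>x. a * u x) \<in> sobolev \<Omega> 1" by (rule sobolev_scale[OF u])
  show "grad_inner \<Omega> u u \<ge> 0"
    using L2.nonneg[OF D_L2(1)[OF u]] L2.nonneg[OF D_L2(2)[OF u]] by (simp add: grad_inner_eq[OF u u])
  assume v: "v \<in> sobolev \<Omega> 1"
  show "(\<lambda>x. u x + v x) \<in> sobolev \<Omega> 1" by (rule sobolev_add[OF u v])
  show "grad_inner \<Omega> u v = grad_inner \<Omega> v u"
    unfolding grad_inner_eq[OF u v] grad_inner_eq[OF v u]
    using L2.sym[OF D_L2(1)[OF u] D_L2(1)[OF v]] L2.sym[OF D_L2(2)[OF u] D_L2(2)[OF v]] by simp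
next
  fix u v w
  assume u: "u \<in> sobolev \<Omega> 1" and v: "v \<in> sobolev \<Omega> 1" and w: "w \<in> sobolev \<Omega> 1"
  note uv = sobolev_add(1)[OF u v]
  have "L2_inner M (weak_deriv \<Omega> \<alpha> (\<lambda>x. u x + v x)) (weak_deriv \<Omega> \<alpha> w)
    = L2_inner M (weak_deriv \<Omega> \<alpha> u) (weak_deriv \<Omega> \<alpha> w) + L2_inner M (weak_deriv \<Omega> \<alpha> v) (weak_deriv \<Omega> \<alpha> w)"
    if "fst \<alpha> + snd \<alpha> \<le> 1" for \<alpha>
  proof -
    note L = sobolevD(2)[OF u that] sobolevD(2)[OF v that] sobolevD(2)[OF w that] sobolevD(2)[OF uv that]
    have "L2_inner M (weak_deriv \<Omega> \<alpha> (\<lambda>x. u x + v x)) (weak_deriv \<Omega> \<alpha> w)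
      = L2_inner M (\<lambda>x. weak_deriv \<Omega> \<alpha> u x + weak_deriv \<Omega> \<alpha> v x) (weak_deriv \<Omega> \<alpha> w)"
      by (rule L2_inner_AE_cong) (use sobolev_add(2)[OF u v that] L[THEN L2D(1)] in auto)
    then show ?thesis using L by (simp add: L2.add_left)
  qed
  then show "grad_inner \<Omega> (\<lambda>x. u x + v x) w = grad_inner \<Omega> u w + grad_inner \<Omega> v w"
    by (simp add: grad_inner_eq u v w uv del: One_nat_def)
next
  fix a u w
  assume u: "u \<in> sobolev \<Omega> 1" and w: "w \<in> sobolev \<Omega> 1"
  note au = sobolev_scale(1)[OF u, of a]
  have "L2_inner M (weak_deriv \<Omega> \<alpha> (\<lambda>x. a * u x)) (weak_deriv \<Omega> \<alpha> w)
    = a * L2_inner M (weak_deriv \<Omega> \<alpha> u) (weak_deriv \<Omega> \<alpha> w)"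
    if "fst \<alpha> + snd \<alpha> \<le> 1" for \<alpha>
  proof -
    note L = sobolevD(2)[OF u that] sobolevD(2)[OF w that] sobolevD(2)[OF au that]
    have "L2_inner M (weak_deriv \<Omega> \<alpha> (\<lambda>x. a * u x)) (weak_deriv \<Omega> \<alpha> w)
      = L2_inner M (\<lambda>x. a * weak_deriv \<Omega> \<alpha> u x) (weak_deriv \<Omega> \<alpha> w)"
      by (rule L2_inner_AE_cong) (use sobolev_scale(2)[OF u that, of a] L[THEN L2D(1)] in auto)
    then show ?thesis using L by (simp add: L2.scale_left)
  qed
  then show "grad_inner \<Omega> (\<lambda>x. a * u x) w = a * grad_inner \<Omega> u w"
    by (simp add: grad_inner_eq u w au distrib_left del: One_nat_def)
qed

lemma grad_inner_AE_0:
  assumes "u \<in> sobolev \<Omega> 1" "v \<in> sobolev \<Omega> 1"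
    "AE x in M. D1 u x = 0" "AE x in M. D2 u x = 0"
  shows "grad_inner \<Omega> u v = 0"
proof -
  have "L2_inner M w z = 0" if "AE x in M. w x = 0" for w z
    unfolding L2_inner_def by (rule integral_eq_zero_AE) (use that in \<open>eventually_elim, simp\<close>)
  then show ?thesis using assms(3,4) by (simp add: grad_inner_eq[OF assms(1,2)] del: One_nat_def)
qed

lemma grad_inner_const:
  assumes "v \<in> sobolev \<Omega> 1"
  shows "grad_inner \<Omega> (\<lambda>x. a) v = 0"
  by (rule grad_inner_AE_0[OF sobolev_const(1) assms]) (auto intro: sobolev_const(2))

lemma sobolev_norm_1_eq:
  assumes u: "u \<in> sobolev \<Omega> 1"
  shows "sobolev_norm \<Omega> 1 u = sqrt ((L2_norm M u)\<^sup>2 + (grad_norm \<Omega> u)\<^sup>2)"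
proof -
  have set: "{\<alpha> :: nat \<times> nat. fst \<alpha> + snd \<alpha> \<le> 1} = {(0, 0), (1, 0), (0, 1)}"
    using order_le_1_cases by auto
  note L = sobolevD(1)[OF u] sobolevD(2)[OF u, of "(0, 0)"]
  have "L2_norm M (weak_deriv \<Omega> (0, 0) u) = L2_norm M u"
    by (rule L2_norm_AE_cong[OF weak_deriv_AE[OF L(1) has_weak_deriv_0]]) (use L L2D in auto)
  moreover have "(grad_norm \<Omega> u)\<^sup>2 = (L2_norm M (D1 u))\<^sup>2 + (L2_norm M (D2 u))\<^sup>2"
    using L2.nonneg[OF D_L2(1)[OF u]] L2.nonneg[OF D_L2(2)[OF u]]
    by (simp add: grad_norm_def grad_inner_eq[OF u u] L2_norm_def)
  ultimately show ?thesis by (simp add: sobolev_norm_def set del: One_nat_def)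
qed

end

section \<open>The Poincare inequality\<close>

lemma L2_lebesgue_onI:
  fixes f :: "real^2 \<Rightarrow> real"
  assumes f: "f \<in> L2 lborel" and S: "S \<in> sets lebesgue"
  shows "f \<in> L2 (lebesgue_on S)"
proof -
  have bor: "f \<in> borel_measurable borel" using L2D(1)[OF f] by simp
  have "integrable lebesgue (\<lambda>x. (f x)\<^sup>2)"
    using L2D(2)[OF f] bor by (subst integrable_completion) auto
  then have "integrable lebesgue (\<lambda>x. indicator S x *\<^sub>R (f x)\<^sup>2)"
    using S by (rule integrable_mult_indicator[rotated])
  then have "integrable (lebesgue_on S) (\<lambda>x. (f x)\<^sup>2)"
    using S by (subst integrable_restrict_space) auto
  then show ?thesis using borel_measurable_lebesgue_onI[OF bor] by (simp add: L2_def)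
qed

lemma L2_lborel_translate:
  fixes f :: "real^2 \<Rightarrow> real"
  assumes f: "f \<in> L2 lborel"
  shows "(\<lambda>x. f (x + a)) \<in> L2 lborel"
proof -
  have [measurable]: "f \<in> borel_measurable borel" using L2D(1)[OF f] by simp
  have "integrable (distr lborel borel ((+) a)) (\<lambda>x. (f x)\<^sup>2)"
    using L2D(2)[OF f] by (simp add: lborel_distr_plus)
  then have "integrable lborel (\<lambda>x. (f (a + x))\<^sup>2)"
    by (subst (asm) integrable_distr_eq) auto
  then show ?thesis by (simp add: L2_def add.commute)
qed

lemma nn_integral_translate_lborel:
  fixes f :: "real^2 \<Rightarrow> ennreal"
  assumes [measurable]: "f \<in> borel_measurable borel"
  shows "(\<integral>\<^sup>+h. f (x + h) \<partial>lborel) = (\<integral>\<^sup>+y. f y \<partial>lborel)"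
proof -
  have "(\<integral>\<^sup>+y. f y \<partial>lborel) = (\<integral>\<^sup>+y. f y \<partial>distr lborel borel ((+) x))"
    by (simp add: lborel_distr_plus)
  also have "\<dots> = (\<integral>\<^sup>+h. f (x + h) \<partial>lborel)"
    by (rule nn_integral_distr) auto
  finally show ?thesis by simp
qed

context bounded_open_set
begin

lemma L2_lborelI:
  assumes f: "f \<in> L2 M" and bor: "f \<in> borel_measurable borel" and 0: "\<And>x. x \<notin> \<Omega> \<Longrightarrow> f x = 0"
  shows "f \<in> L2 lborel"
proof -
  have "integrable lebesgue (\<lambda>x. indicator \<Omega> x *\<^sub>R (f x)\<^sup>2)"
    using L2D(2)[OF f] sets_lebesgue by (subst (asm) integrable_restrict_space) auto
  also have "(\<lambda>x. indicator \<Omega> x *\<^sub>R (f x)\<^sup>2) = (\<lambda>x. (f x)\<^sup>2)"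
    using 0 by (auto simp: fun_eq_iff indicator_def)
  finally have "integrable lborel (\<lambda>x. (f x)\<^sup>2)"
    using bor by (subst (asm) integrable_completion) auto
  then show ?thesis using bor by (simp add: L2_def)
qed

lemma nn_integral_eq_lborel:
  assumes f: "f \<in> borel_measurable borel" "f \<in> L2 M"
  shows "(\<integral>\<^sup>+x. ennreal (indicator \<Omega> x * (f x)\<^sup>2) \<partial>lborel) = ennreal ((L2_norm M f)\<^sup>2)"
proof -
  define F where "F = (\<lambda>x. indicator \<Omega> x * (f x)\<^sup>2)"
  have F_bor [measurable]: "F \<in> borel_measurable borel" unfolding F_def using f(1) open_set by simp
  have "integrable lebesgue F"
    using L2D(2)[OF f(2)] sets_lebesgue unfolding F_def
    by (subst (asm) integrable_restrict_space) auto
  then have "integrable lborel F" by (subst (asm) integrable_completion) auto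
  then have "(\<integral>\<^sup>+x. ennreal (F x) \<partial>lborel) = ennreal (LINT x|lborel. F x)"
    by (rule nn_integral_eq_integral) (auto simp: F_def)
  also have "(LINT x|lborel. F x) = (LINT x|M. F x)"
    by (rule integral_eq_lborel[symmetric]) (use F_bor in \<open>auto simp: F_def\<close>)
  also have "\<dots> = (LINT x|M. (f x)\<^sup>2)"
    by (rule Bochner_Integration.integral_cong) (auto simp: F_def space_restrict_space)
  finally show ?thesis by (simp add: F_def L2_norm_power2)
qed

lemma zero_mean_add: "u \<in> L2_zero_mean M \<Longrightarrow> v \<in> L2_zero_mean M \<Longrightarrow> (\<lambda>x. u x + v x) \<in> L2_zero_mean M"
  by (simp add: L2_zero_mean_def L2_add L2_integrable[OF finite_M])

lemma zero_mean_scale: "u \<in> L2_zero_mean M \<Longrightarrow> (\<lambda>x. a * u x) \<in> L2_zero_mean M"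
  by (simp add: L2_zero_mean_def L2_scale)

end

locale bounded_convex_set = bounded_open_set +
  assumes convex_set: "convex \<Omega>" and nonempty: "\<Omega> \<noteq> {}"
begin

text \<open>The points at which the difference of a function and its shift by \<open>h\<close> uses
  only values in \<Omega>.\<close>

definition overlap :: "real^2 \<Rightarrow> (real^2) set" where
  "overlap h = {x \<in> \<Omega>. x + h \<in> \<Omega>}"

lemma overlap_bounded_open: "bounded_open_set (overlap h)"
proof
  have "overlap h = \<Omega> \<inter> (\<lambda>x. x + h) -` \<Omega>" by (auto simp: overlap_def)
  moreover have "open ((\<lambda>x. x + h) -` \<Omega>)"
    by (intro open_vimage open_set continuous_intros)
  ultimately show "open (overlap h)" using open_set by auto
  show "bounded (overlap h)" by (rule bounded_subset[OF bounded_set]) (auto simp: overlap_def)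
qed

text \<open>Convexity of \<Omega> enters here: with \<open>x\<close> and \<open>x + h\<close> the
  point \<open>x + t *\<^sub>R h\<close> lies in \<Omega> as well.\<close>

lemma bumps_overlap_translate:
  assumes \<phi>: "\<phi> \<in> bumps (overlap h)" and t: "t \<in> {0..1}"
  shows "(\<lambda>x. \<phi> (x - t *\<^sub>R h)) \<in> bumps \<Omega>"
proof -
  obtain K where K: "compact K" "K \<subseteq> overlap h" "\<And>x. x \<notin> K \<Longrightarrow> \<phi> x = 0"
    using test_function_support[OF bumps_test[OF \<phi>]] by blast
  show ?thesis
  proof (rule bumpsI)
    show "(\<lambda>x. \<phi> (x - t *\<^sub>R h)) \<in> smooth_alg"
      using smooth_alg_translate[of \<phi> "- (t *\<^sub>R h)"] \<phi> by (simp add: bumps_def)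
    show "compact ((\<lambda>x. x + t *\<^sub>R h) ` K)"
      by (intro compact_continuous_image continuous_intros K)
    show "(\<lambda>x. x + t *\<^sub>R h) ` K \<subseteq> \<Omega>"
    proof (rule image_subsetI)
      fix x assume "x \<in> K"
      then have "x \<in> \<Omega>" "x + h \<in> \<Omega>" using K(2) by (auto simp: overlap_def)
      then have "(1 - t) *\<^sub>R x + t *\<^sub>R (x + h) \<in> \<Omega>"
        using t by (intro convexD[OF convex_set]) auto
      then show "x + t *\<^sub>R h \<in> \<Omega>" by (simp add: algebra_simps)
    qed
    show "\<phi> (x - t *\<^sub>R h) = 0" if "x \<notin> (\<lambda>x. x + t *\<^sub>R h) ` K" for x
      using K(3)[of "x - t *\<^sub>R h"] that by (force simp: image_iff)
  qed
qed

text \<open>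
  By duality it suffices to test against bumps \<open>\<phi>\<close>, and \<open>t \<mapsto> \<integral> u(x) \<phi>(x - t h) dx\<close> has
  derivative \<open>\<integral> (h \<cdot> \<nabla>u)(x) \<phi>(x - t h) dx\<close>: no smoothing of \<open>u\<close> is needed.
\<close>

lemma translation_estimate:
  assumes u: "u \<in> sobolev \<Omega> 1"
    and U: "U \<in> borel_measurable borel" "\<And>x. x \<notin> \<Omega> \<Longrightarrow> U x = 0" "AE x in M. u x = U x"
  shows "(\<lambda>x. U (x + h) - U x) \<in> L2 (lebesgue_on (overlap h))"
    and "L2_norm (lebesgue_on (overlap h)) (\<lambda>x. U (x + h) - U x) \<le> 2 * norm h * grad_norm \<Omega> u"
proof -
  interpret O: bounded_open_set "overlap h" by (rule overlap_bounded_open)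
  have uL: "u \<in> L2 M" using sobolevD(1)[OF u] .
  \<comment> \<open>The Borel representative \<open>U\<close>, extended by 0, replaces
    \<open>u\<close> because translation acts on the whole plane, where it preserves Borel
    measurability and Lebesgue measure.\<close>
  have UM: "U \<in> L2 M"
    using L2_AE_cong[OF U(3) L2D(1)[OF uL] borel_measurable_lebesgue_onI[OF U(1)]] uL by blast
  have UL: "U \<in> L2 lborel" by (rule L2_lborelI[OF UM U(1,2)])
  have UhL: "(\<lambda>x. U (x + h)) \<in> L2 lborel" by (rule L2_lborel_translate[OF UL])
  show w: "(\<lambda>x. U (x + h) - U x) \<in> L2 (lebesgue_on (overlap h))"
    by (rule L2_lebesgue_onI[OF L2.diff_mem[OF UhL UL] O.sets_lebesgue])
  show "L2_norm (lebesgue_on (overlap h)) (\<lambda>x. U (x + h) - U x) \<le> 2 * norm h * grad_norm \<Omega> u"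
  proof (rule O.L2_norm_le_dual[OF w])
    have gn: "grad_norm \<Omega> u \<ge> 0"
      using grad_norm_nonneg .
    then show "0 \<le> 2 * norm h * grad_norm \<Omega> u" by simp
    fix \<phi> assume \<phi>: "\<phi> \<in> bumps (overlap h)"
    note \<phi>t = bumps_test[OF \<phi>]
    have \<phi>_bor [measurable]: "\<phi> \<in> borel_measurable borel" by (rule test_function_borel(1)[OF \<phi>t])
    have [measurable]: "U \<in> borel_measurable borel" by (rule U)
    have sm: "smooth \<phi>" using \<phi>t by (simp add: test_functions_def)
    have \<phi>_out: "\<phi> x = 0" if "x \<notin> overlap h" for x
      using test_function_support[OF \<phi>t] that by blast
    let ?N = "L2_norm (lebesgue_on (overlap h)) \<phi>"
    \<comment> \<open>\<open>g\<close> joins the two terms of the claim: \<open>g 0\<close> pairs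
      \<open>\<phi>\<close> with \<open>U\<close>, and \<open>g 1\<close>, after a change of
      variables, pairs it with \<open>U\<close> shifted by \<open>h\<close>.\<close>
    define g where "g t = L2_inner M U (\<lambda>x. \<phi> (x - t *\<^sub>R h))" for t
    have g_deriv: "(g has_real_derivative - L2_inner M U (\<lambda>x. dir_deriv h \<phi> (x - t *\<^sub>R h))) (at t)" for t
      unfolding g_def by (rule inner_translate_derivative[OF UM \<phi>t])
    have g_bound: "\<bar>- L2_inner M U (\<lambda>x. dir_deriv h \<phi> (x - t *\<^sub>R h))\<bar> \<le> 2 * norm h * grad_norm \<Omega> u * ?N"
      if t: "t \<in> {0..1}" for t
    proof -
      define \<psi> where "\<psi> = (\<lambda>x. \<phi> (x - t *\<^sub>R h))"
      have \<psi>: "\<psi> \<in> bumps \<Omega>" unfolding \<psi>_def by (rule bumps_overlap_translate[OF \<phi> t])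
      note \<psi>t = bumps_test[OF \<psi>]
      have \<psi>_bor: "\<psi> \<in> borel_measurable borel" by (rule test_function_borel(1)[OF \<psi>t])
      have \<psi>_out: "\<psi> x = 0" if "x \<notin> \<Omega>" for x
        using test_function_support[OF \<psi>t] that by blast
      have \<psi>L: "\<psi> \<in> L2 M" by (rule bumps_L2[OF \<psi>])
      have pd: "partial_deriv i \<psi> x = partial_deriv i \<phi> (x - t *\<^sub>R h)" for i x
        unfolding \<psi>_def using partial_deriv_translate[OF sm, of i "- (t *\<^sub>R h)" x] by simp
      have norm\<psi>: "L2_norm M \<psi> = ?N"
      proof -
        have "(LINT x|M. \<psi> x * \<psi> x) = (LINT x|lborel. \<psi> x * \<psi> x)"
          by (rule integral_eq_lborel) (use \<psi>_bor \<psi>_out in auto)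
        also have "\<dots> = (LINT x|lborel. \<phi> x * \<phi> x)"
          using integral_translate_lborel[of "\<lambda>x. \<phi> x * \<phi> x" "- (t *\<^sub>R h)"] by (simp add: \<psi>_def)
        also have "\<dots> = (LINT x|lebesgue_on (overlap h). \<phi> x * \<phi> x)"
          by (rule O.integral_eq_lborel[symmetric]) (use \<phi>_out in auto)
        finally show ?thesis by (simp add: L2_norm_def L2_inner_def)
      qed
      \<comment> \<open>The shifted bump \<open>\<psi>\<close> is a test function on \<Omega>, so
        the derivative may be moved from it to \<open>u\<close>.\<close>
      have part: "L2_inner M U (partial_deriv i \<psi>) = - L2_inner M (weak_deriv \<Omega> \<alpha> u) \<psi>"
        if i: "\<alpha> = (if i = 1 then (1, 0) else (0, 1))" for i \<alpha>
      proof -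
        have \<alpha>: "fst \<alpha> + snd \<alpha> \<le> 1" using i by auto
        have "multi_deriv \<alpha> \<psi> = partial_deriv i \<psi>" using i exhaust_2[of i] by auto
        moreover have "L2_inner M u (multi_deriv \<alpha> \<psi>) = - L2_inner M (weak_deriv \<Omega> \<alpha> u) \<psi>"
          using sobolevD(3)[OF u \<alpha>] \<psi>t i unfolding has_weak_deriv_def by auto
        moreover have "L2_inner M u (partial_deriv i \<psi>) = L2_inner M U (partial_deriv i \<psi>)"
          by (rule L2_inner_AE_cong)
            (use U(3) L2D(1)[OF uL] L2D(1)[OF UM] L2D(1)[OF test_function_L2(2)[OF \<psi>t]] in auto)
        ultimately show ?thesis by simp
      qed
      have "L2_inner M U (\<lambda>x. dir_deriv h \<phi> (x - t *\<^sub>R h))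
        = L2_inner M U (\<lambda>x. h $ 1 * partial_deriv 1 \<psi> x + h $ 2 * partial_deriv 2 \<psi> x)"
        by (simp add: dir_deriv_def pd)
      also have "\<dots> = h $ 1 * L2_inner M U (partial_deriv 1 \<psi>) + h $ 2 * L2_inner M U (partial_deriv 2 \<psi>)"
        using UM test_function_L2(2)[OF \<psi>t] by (simp add: L2.add_right L2.scale_right L2_scale)
      also have "\<dots> = - (h $ 1 * L2_inner M (D1 u) \<psi> + h $ 2 * L2_inner M (D2 u) \<psi>)"
        using part[of "(1, 0)" 1] part[of "(0, 1)" 2] by simp
      finally have eq: "- L2_inner M U (\<lambda>x. dir_deriv h \<phi> (x - t *\<^sub>R h))
        = h $ 1 * L2_inner M (D1 u) \<psi> + h $ 2 * L2_inner M (D2 u) \<psi>" by simp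
      have le: "\<bar>L2_inner M (weak_deriv \<Omega> \<alpha> u) \<psi>\<bar> \<le> grad_norm \<Omega> u * ?N"
        if \<alpha>: "\<alpha> = (1, 0) \<or> \<alpha> = (0, 1)" for \<alpha>
      proof -
        have L: "weak_deriv \<Omega> \<alpha> u \<in> L2 M" using sobolevD(2)[OF u, of \<alpha>] \<alpha> by auto
        have "L2_norm M (weak_deriv \<Omega> \<alpha> u) \<le> grad_norm \<Omega> u"
          unfolding grad_norm_def L2_norm_def grad_inner_eq[OF u u]
          using \<alpha> L2.nonneg[OF D_L2(1)[OF u]] L2.nonneg[OF D_L2(2)[OF u]] by auto
        then show ?thesis
          using L2_Cauchy_Schwarz[OF L \<psi>L] mult_right_mono[OF _ L2_norm_nonneg[of M \<psi>]]
          unfolding norm\<psi> by (meson order_trans)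
      qed
      \<comment> \<open>Each of the two components is bounded crudely by the full norms, which is
        the origin of the factor 2.\<close>
      have "\<bar>h $ 1 * L2_inner M (D1 u) \<psi> + h $ 2 * L2_inner M (D2 u) \<psi>\<bar>
        \<le> \<bar>h $ 1\<bar> * \<bar>L2_inner M (D1 u) \<psi>\<bar> + \<bar>h $ 2\<bar> * \<bar>L2_inner M (D2 u) \<psi>\<bar>"
        by (intro order_trans[OF abs_triangle_ineq]) (simp add: abs_mult)
      also have "\<dots> \<le> norm h * (grad_norm \<Omega> u * ?N) + norm h * (grad_norm \<Omega> u * ?N)"
        by (intro add_mono mult_mono le component_le_norm_cart) auto
      finally show ?thesis unfolding eq by simp
    qed
    have "\<bar>g 1 - g 0\<bar> \<le> 2 * norm h * grad_norm \<Omega> u * ?N * norm (1 - 0 :: real)"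
      unfolding real_norm_def[of "g 1 - g 0", symmetric]
      by (rule field_differentiable_bound[of "{0..1}" g "\<lambda>t. - L2_inner M U (\<lambda>x. dir_deriv h \<phi> (x - t *\<^sub>R h))"])
        (use g_deriv g_bound in \<open>auto intro: has_field_derivative_at_within\<close>)
    moreover have "L2_inner (lebesgue_on (overlap h)) (\<lambda>x. U (x + h) - U x) \<phi> = g 1 - g 0"
    proof -
      have \<phi>L: "\<phi> \<in> L2 lborel"
        by (rule L2_lborelI[OF test_function_L2(1)[OF \<phi>t] \<phi>_bor])
          (use \<phi>_out in \<open>auto simp: overlap_def\<close>)
      have "L2_inner (lebesgue_on (overlap h)) (\<lambda>x. U (x + h) - U x) \<phi>
        = (LINT x|lborel. (U (x + h) - U x) * \<phi> x)"
        unfolding L2_inner_def by (rule O.integral_eq_lborel) (use \<phi>_out in auto)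
      also have "\<dots> = (LINT x|lborel. U (x + h) * \<phi> x) - (LINT x|lborel. U x * \<phi> x)"
        using L2_integrable_mult[OF UL \<phi>L] L2_integrable_mult[OF UhL \<phi>L]
        by (simp add: left_diff_distrib)
      also have "(LINT x|lborel. U x * \<phi> x) = g 0"
        unfolding g_def L2_inner_def by (subst integral_eq_lborel) (use U in auto)
      also have "(LINT x|lborel. U (x + h) * \<phi> x) = (LINT x|lborel. U x * \<phi> (x - h))"
        using integral_translate_lborel[of "\<lambda>x. U x * \<phi> (x - h)" h] by simp
      also have "\<dots> = g 1"
        unfolding g_def L2_inner_def by (subst integral_eq_lborel) (use U in auto)
      finally show ?thesis .
    qed
    ultimately show "\<bar>L2_inner (lebesgue_on (overlap h)) (\<lambda>x. U (x + h) - U x) \<phi>\<bar>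
      \<le> 2 * norm h * grad_norm \<Omega> u * ?N" by simp
  qed
qed

text \<open>
  \<open>\<integral>\<integral> (u(x) - u(y))\<^sup>2 dx dy\<close> over \<open>\<Omega> \<times> \<Omega>\<close> dominates \<open>|\<Omega>| \<parallel>u\<parallel>\<^sup>2\<close> when \<open>u\<close> has mean zero;
  substituting \<open>y = x + h\<close>, it is an integral over \<open>h\<close> of squared translation differences.
\<close>

lemma Poincare_inequality:
  obtains C where "C > 0"
    "\<And>u. u \<in> sobolev \<Omega> 1 \<Longrightarrow> (LINT x|M. u x) = 0 \<Longrightarrow> L2_norm M u \<le> C * grad_norm \<Omega> u"
proof -
  obtain R where R: "\<And>x. x \<in> \<Omega> \<Longrightarrow> norm x < R" "R > 0"
    using bounded_set bounded_pos_less by metis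
  define V where "V = measure lebesgue \<Omega>"
  \<comment> \<open>Area of a ball containing all relevant shifts: two points of \<Omega> differ by
    less than \<open>2 * R\<close>.\<close>
  define A where "A = measure lborel (ball (0::real^2) (2 * R))"
  have V: "V > 0"
    using open_not_negligible[OF open_set nonempty] negligible_iff_measure0[OF lmeasurable]
    unfolding V_def by (simp add: order_less_le)
  have V_em: "emeasure lborel \<Omega> = ennreal V"
  proof -
    have "emeasure lborel \<Omega> = emeasure lebesgue \<Omega>" using open_set by simp
    then show ?thesis using lmeasurable by (simp add: V_def emeasure_eq_measure2)
  qed
  have A_em: "emeasure lborel (ball (0::real^2) (2 * R)) = ennreal A"
    unfolding A_def using emeasure_bounded_finite[OF bounded_ball, of "0::real^2" "2 * R"]
    by (intro emeasure_eq_ennreal_measure) (simp add: top.not_eq_extremum)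
  \<comment> \<open>Read off from
    \<open>(L2_norm M u)\<^sup>2 * V \<le> (4 * R * ?G)\<^sup>2 * A\<close> with the gradient norm
    \<open>?G\<close>, where \<open>4 * R\<close> bounds \<open>2 * norm h\<close> in the
    translation estimate; the 1 makes \<open>C\<close> positive.\<close>
  define C where "C = sqrt ((4 * R)\<^sup>2 * A / V) + 1"
  have A0: "A \<ge> 0" by (simp add: A_def)
  have "L2_norm M u \<le> C * grad_norm \<Omega> u"
    if u: "u \<in> sobolev \<Omega> 1" and mean: "(LINT x|M. u x) = 0" for u
  proof -
    let ?G = "grad_norm \<Omega> u"
    have G: "?G \<ge> 0"
      using grad_norm_nonneg .
    have uL: "u \<in> L2 M" using sobolevD(1)[OF u] .
    \<comment> \<open>Fubini and the substitution require a Borel function on the plane, so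
      \<open>u\<close> is replaced by a representative that vanishes outside \<Omega>.\<close>
    have "(\<lambda>x. indicator \<Omega> x *\<^sub>R u x) \<in> borel_measurable lebesgue"
      using L2D(1)[OF uL] sets_lebesgue by (subst (asm) borel_measurable_restrict_space_iff) auto
    then obtain u' where u': "u' \<in> borel_measurable lborel" "AE x in lborel. indicator \<Omega> x *\<^sub>R u x = u' x"
      using completion_ex_borel_measurable_real[of "\<lambda>x. indicator \<Omega> x *\<^sub>R u x" lborel] by auto
    define U where "U x = indicator \<Omega> x * u' x" for x
    have \<Omega>_bor [measurable]: "\<Omega> \<in> sets borel" using open_set by simp
    have [measurable]: "u' \<in> borel_measurable borel" using u'(1) by simp
    have U_bor [measurable]: "U \<in> borel_measurable borel" unfolding U_def by measurable
    have U_out: "U x = 0" if "x \<notin> \<Omega>" for x using that by (simp add: U_def)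
    have "AE x in lebesgue. indicator \<Omega> x *\<^sub>R u x = u' x" using u'(2) by (rule AE_completion)
    then have U_AE: "AE x in M. u x = U x"
      using sets_lebesgue by (subst AE_restrict_space_iff) (auto elim!: eventually_mono simp: U_def)
    have UM: "U \<in> L2 M"
      using L2_AE_cong[OF U_AE L2D(1)[OF uL] borel_measurable_lebesgue_onI[OF U_bor]] uL by blast
    have norm_U: "L2_norm M U = L2_norm M u"
      using L2_norm_AE_cong[OF U_AE L2D(1)[OF uL] L2D(1)[OF UM]] by simp
    have "(LINT x|M. u x) = (LINT x|M. U x)"
      by (rule integral_cong_AE) (use L2D(1)[OF uL] L2D(1)[OF UM] U_AE in auto)
    with mean have mean_U: "(LINT x|M. U x) = 0" by simp

    define F :: "real^2 \<Rightarrow> real^2 \<Rightarrow> ennreal" where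
      "F x y = ennreal (indicator \<Omega> x * indicator \<Omega> y * (U y - U x)\<^sup>2)" for x y
    \<comment> \<open>Mean zero removes the cross term when the square is expanded, leaving the
      squared norm of \<open>U\<close> plus the nonnegative contribution of the constant
      \<open>U x\<close>.\<close>
    have low: "ennreal ((L2_norm M u)\<^sup>2) * indicator \<Omega> x \<le> (\<integral>\<^sup>+y. F x y \<partial>lborel)" for x
    proof (cases "x \<in> \<Omega>")
      case True
      have d: "(\<lambda>y. U y - U x) \<in> L2 M" by (intro L2.diff_mem UM const_L2)
      have "(L2_norm M (\<lambda>y. U y - U x))\<^sup>2 = L2_inner M U U - 2 * L2_inner M U (\<lambda>y. U x)
          + L2_inner M (\<lambda>y. U x) (\<lambda>y. U x)"
        unfolding L2_norm_def real_sqrt_pow2[OF L2.nonneg[OF d]]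
        using L2.sym[OF UM const_L2]
        by (simp add: L2.diff_left L2.diff_right L2.diff_mem UM const_L2)
      also have "L2_inner M U (\<lambda>y. U x) = 0" using mean_U by (simp add: L2_inner_def)
      finally have "(L2_norm M U)\<^sup>2 \<le> (L2_norm M (\<lambda>y. U y - U x))\<^sup>2"
        using L2.nonneg[OF const_L2[of "U x"]] L2.nonneg[OF UM] by (simp add: L2_norm_def)
      then have "ennreal ((L2_norm M u)\<^sup>2) \<le> ennreal ((L2_norm M (\<lambda>y. U y - U x))\<^sup>2)"
        unfolding norm_U by (rule ennreal_leI)
      also have "\<dots> = (\<integral>\<^sup>+y. ennreal (indicator \<Omega> y * (U y - U x)\<^sup>2) \<partial>lborel)"
        by (rule nn_integral_eq_lborel[symmetric]) (use d in auto)
      finally show ?thesis using True by (simp add: F_def)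
    qed simp
    have up: "(\<integral>\<^sup>+x. F x (x + h) \<partial>lborel) \<le> ennreal ((4 * R * ?G)\<^sup>2) * indicator (ball 0 (2 * R)) h" for h
    proof (cases "overlap h = {}")
      case True
      then have "F x (x + h) = 0" for x by (auto simp: F_def overlap_def indicator_def)
      then show ?thesis by simp
    next
      case False
      then obtain x where "x \<in> \<Omega>" "x + h \<in> \<Omega>" by (auto simp: overlap_def)
      then have "norm h < 2 * R"
        using R(1)[of x] R(1)[of "x + h"] norm_triangle_ineq4[of "x + h" x] by simp
      then have h: "h \<in> ball 0 (2 * R)" "2 * norm h \<le> 4 * R" by auto
      note est = translation_estimate[OF u U_bor U_out U_AE, of h]
      have "(\<integral>\<^sup>+x. F x (x + h) \<partial>lborel)
        = (\<integral>\<^sup>+x. ennreal (indicator (overlap h) x * (U (x + h) - U x)\<^sup>2) \<partial>lborel)"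
        by (rule nn_integral_cong) (auto simp: F_def overlap_def indicator_def)
      also have "\<dots> = ennreal ((L2_norm (lebesgue_on (overlap h)) (\<lambda>x. U (x + h) - U x))\<^sup>2)"
        by (rule bounded_open_set.nn_integral_eq_lborel[OF overlap_bounded_open _ est(1)]) auto
      also have "\<dots> \<le> ennreal ((4 * R * ?G)\<^sup>2)"
        using order_trans[OF est(2) mult_right_mono[OF h(2) G]]
        by (intro ennreal_leI power_mono L2_norm_nonneg)
      finally show ?thesis using h by simp
    qed
    have "ennreal ((L2_norm M u)\<^sup>2) * ennreal V = (\<integral>\<^sup>+x. ennreal ((L2_norm M u)\<^sup>2) * indicator \<Omega> x \<partial>lborel)"
      by (simp add: nn_integral_cmult_indicator V_em)
    also have "\<dots> \<le> (\<integral>\<^sup>+x. (\<integral>\<^sup>+y. F x y \<partial>lborel) \<partial>lborel)"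
      by (intro nn_integral_mono low)
    also have "\<dots> = (\<integral>\<^sup>+x. (\<integral>\<^sup>+h. F x (x + h) \<partial>lborel) \<partial>lborel)"
      by (intro nn_integral_cong nn_integral_translate_lborel[symmetric]) (simp add: F_def)
    also have "\<dots> = (\<integral>\<^sup>+h. (\<integral>\<^sup>+x. F x (x + h) \<partial>lborel) \<partial>lborel)"
      by (rule lborel_pair.Fubini') (simp add: F_def)
    also have "\<dots> \<le> (\<integral>\<^sup>+h. ennreal ((4 * R * ?G)\<^sup>2) * indicator (ball (0::real^2) (2 * R)) h \<partial>lborel)"
      by (intro nn_integral_mono up)
    also have "\<dots> = ennreal ((4 * R * ?G)\<^sup>2) * ennreal A"
      by (simp add: nn_integral_cmult_indicator A_em)
    finally have "(L2_norm M u)\<^sup>2 * V \<le> (4 * R * ?G)\<^sup>2 * A"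
      using V A0 by (simp add: ennreal_mult[symmetric] ennreal_le_iff)
    then have "(L2_norm M u)\<^sup>2 \<le> (4 * R)\<^sup>2 * A / V * ?G\<^sup>2"
      using V by (simp add: field_simps power_mult_distrib)
    then have "L2_norm M u \<le> sqrt ((4 * R)\<^sup>2 * A / V * ?G\<^sup>2)"
      by (rule real_le_rsqrt)
    also have "\<dots> = sqrt ((4 * R)\<^sup>2 * A / V) * ?G"
      using G by (simp only: real_sqrt_mult real_sqrt_abs abs_of_nonneg)
    also have "\<dots> \<le> C * ?G" using G by (simp add: C_def distrib_right)
    finally show ?thesis .
  qed
  moreover have "C > 0" using A0 V unfolding C_def by (intro add_nonneg_pos) auto
  ultimately show thesis using that by blast
qed

end

section \<open>Galerkin spaces\<close>

lemma L2_norm_mono_AE: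
  assumes u: "u \<in> L2 M" and v: "v \<in> L2 M" and le: "AE x in M. \<bar>u x\<bar> \<le> \<bar>v x\<bar>"
  shows "L2_norm M u \<le> L2_norm M v"
proof -
  have "(LINT x|M. (u x)\<^sup>2) \<le> (LINT x|M. (v x)\<^sup>2)"
    using le by (intro integral_mono_AE L2D(2) u v) (auto elim!: eventually_mono simp: abs_le_square_iff)
  then show ?thesis by (simp add: L2_norm_def L2_inner_self)
qed

lemma L2_norm_Lipschitz_AE:
  assumes u: "u \<in> L2 M" and v: "v \<in> L2 M" and "L \<ge> 0"
    and le: "AE x in M. \<bar>u x\<bar> \<le> L * \<bar>v x\<bar>"
  shows "L2_norm M u \<le> L * L2_norm M v"
proof -
  have "L2_norm M u \<le> L2_norm M (\<lambda>x. L * v x)"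
    by (rule L2_norm_mono_AE[OF u L2_scale[OF v]]) (use le assms(3) in \<open>auto simp: abs_mult\<close>)
  then show ?thesis using L2_norm_scale[OF v, of L] assms(3) by simp
qed

text \<open>On \<open>I\<close> the composition differs from a constant \<open>g y\<close> by at
  most a multiple of \<open>\<bar>u x - y\<bar>\<close>, and constants are square integrable for a
  finite measure.\<close>

lemma L2_comp_Lipschitz:
  assumes M: "finite_measure M" and u: "u \<in> L2 M" and g: "continuous_on UNIV (g :: real \<Rightarrow> real)"
    and I: "AE x in M. u x \<in> I"
    and lip: "\<And>x y. x \<in> I \<Longrightarrow> y \<in> I \<Longrightarrow> \<bar>g x - g y\<bar> \<le> L * \<bar>x - y\<bar>"
  shows "(\<lambda>x. g (u x)) \<in> L2 M"
proof -
  have meas: "(\<lambda>x. g (u x)) \<in> borel_measurable M"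
    using measurable_compose[OF L2D(1)[OF u] borel_measurable_continuous_onI[OF g]] .
  have c: "(\<lambda>x. a) \<in> L2 M" for a :: real
    by (rule L2_bounded[OF M, where K = "\<bar>a\<bar>"]) auto
  show ?thesis
  proof (cases "I = {}")
    \<comment> \<open>If \<open>u\<close> takes values in the empty set almost everywhere, the
      measure is null and every function is 0 almost everywhere.\<close>
    case True
    then have "AE x in M. g (u x) = 0" using I by auto
    then show ?thesis using L2_AE_cong[of "\<lambda>x. g (u x)" "\<lambda>x. 0" M] meas c by auto
  next
    case False
    then obtain y where y: "y \<in> I" by blast
    have d: "(\<lambda>x. \<bar>L\<bar> * (u x - y)) \<in> L2 M" by (intro L2_scale L2.diff_mem u c)
    have "integrable M (\<lambda>x. (g (u x) - g y)\<^sup>2)"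
    proof (rule Bochner_Integration.integrable_bound[OF L2D(2)[OF d]])
      show "AE x in M. norm ((g (u x) - g y)\<^sup>2) \<le> norm ((\<bar>L\<bar> * (u x - y))\<^sup>2)"
        using I
      proof eventually_elim
        case (elim x)
        have "\<bar>g (u x) - g y\<bar> \<le> \<bar>\<bar>L\<bar> * (u x - y)\<bar>"
          using lip[OF elim y] mult_right_mono[OF abs_ge_self[of L] abs_ge_zero[of "u x - y"]]
          by (simp add: abs_mult)
        then have "(g (u x) - g y)\<^sup>2 \<le> (\<bar>L\<bar> * (u x - y))\<^sup>2" by (rule abs_le_square_iff[THEN iffD1])
        then show ?case by simp
      qed
    qed (use meas in measurable)
    then have "(\<lambda>x. g (u x) - g y) \<in> L2 M" using meas by (simp add: L2_def)
    from L2_add[OF this c[of "g y"]] show ?thesis by simp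
  qed
qed

text \<open>Each value outside the essential range has an interval around it with null preimage; by
  Lindelof countably many of these intervals cover all such values.\<close>

lemma AE_essential_range:
  assumes S: "S \<in> sets lebesgue" and u: "u \<in> borel_measurable (lebesgue_on S)"
  shows "AE x in lebesgue_on S. u x \<in> essential_range S u"
proof -
  define B where "B y e = {x \<in> S. \<bar>u x - y\<bar> < e}" for y e :: real
  have B_sets: "B y e \<in> sets lebesgue" for y e
  proof -
    have "{x \<in> space (lebesgue_on S). \<bar>u x - y\<bar> < e} \<in> sets (lebesgue_on S)"
      using u by measurable
    then show ?thesis using S by (simp add: B_def sets_restrict_space_iff space_restrict_space)
  qed
  have "\<exists>e>0. B y e \<in> null_sets lebesgue" if "y \<notin> essential_range S u" for y
    using that B_sets by (auto simp: essential_range_def B_def not_gr_zero null_sets_def)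
  then obtain e where e: "\<And>y. y \<notin> essential_range S u \<Longrightarrow> e y > 0 \<and> B y (e y) \<in> null_sets lebesgue"
    by metis
  define \<F> where "\<F> = (\<lambda>y. ball y (e y)) ` (- essential_range S u)"
  obtain \<F>' where F': "\<F>' \<subseteq> \<F>" "countable \<F>'" "\<Union>\<F>' = \<Union>\<F>"
    using Lindelof[of \<F>] unfolding \<F>_def by blast
  have null: "(\<Union>T\<in>\<F>'. {x \<in> S. u x \<in> T}) \<in> null_sets lebesgue"
  proof (rule null_sets_UN')
    fix T assume "T \<in> \<F>'"
    then obtain y where y: "y \<notin> essential_range S u" "T = ball y (e y)"
      using F'(1) by (auto simp: \<F>_def)
    then have "{x \<in> S. u x \<in> T} = B y (e y)" by (auto simp: B_def dist_real_def)
    then show "{x \<in> S. u x \<in> T} \<in> null_sets lebesgue" using e[OF y(1)] by simp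
  qed (rule F')
  have "AE x in lebesgue. x \<in> S \<longrightarrow> u x \<in> essential_range S u"
  proof (rule AE_I'[OF null])
    show "{x \<in> space lebesgue. \<not> (x \<in> S \<longrightarrow> u x \<in> essential_range S u)} \<subseteq> (\<Union>T\<in>\<F>'. {x \<in> S. u x \<in> T})"
    proof
      fix x assume "x \<in> {x \<in> space lebesgue. \<not> (x \<in> S \<longrightarrow> u x \<in> essential_range S u)}"
      then have x: "x \<in> S" "u x \<notin> essential_range S u" by auto
      then have "u x \<in> ball (u x) (e (u x))" using e by simp
      then have "u x \<in> \<Union>\<F>" unfolding \<F>_def using x by (intro UnionI imageI) auto
      then show "x \<in> (\<Union>T\<in>\<F>'. {x \<in> S. u x \<in> T})" using x F'(3) by auto
    qed
  qed
  then show ?thesis using S by (simp add: AE_restrict_space_iff)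
qed

lemma C1_deriv:
  fixes f :: "real \<Rightarrow> real"
  assumes "f C1_differentiable_on UNIV"
  shows "(f has_real_derivative deriv f x) (at x)" and "continuous_on UNIV (deriv f)"
proof -
  obtain D where D: "\<And>x. (f has_vector_derivative D x) (at x)" "continuous_on UNIV D"
    using assms unfolding C1_differentiable_on_def by blast
  then have *: "(f has_real_derivative D x) (at x)" for x
    by (simp add: has_real_derivative_iff_has_vector_derivative)
  then have "deriv f = D" using DERIV_imp_deriv by blast
  then show "(f has_real_derivative deriv f x) (at x)" "continuous_on UNIV (deriv f)"
    using * D(2) by simp_all
qed

text \<open>Sum of the tangent inequalities at \<open>x\<close> and at \<open>y\<close>.\<close>

lemma convex_deriv_mono:
  fixes f :: "real \<Rightarrow> real"
  assumes "convex_on UNIV f" "\<And>x. (f has_real_derivative f' x) (at x)"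
  shows "0 \<le> (f' x - f' y) * (x - y)"
proof -
  have "f y - f x \<ge> f' x * (y - x)" "f x - f y \<ge> f' y * (x - y)"
    using assms by (auto intro!: convex_on_imp_above_tangent[of UNIV f])
  then show ?thesis by (simp add: algebra_simps)
qed

section \<open>Mean values and the Poincare constant\<close>

context bounded_convex_set
begin

interpretation grad: semi_inner "sobolev \<Omega> 1" "grad_inner \<Omega>" by (rule semi_inner_grad)

lemma grad_norm_power2: "u \<in> sobolev \<Omega> 1 \<Longrightarrow> (grad_norm \<Omega> u)\<^sup>2 = grad_inner \<Omega> u u"
  using grad.nonneg by (simp add: grad_norm_def)

lemmas grad_Cauchy_Schwarz = grad.Cauchy_Schwarz[folded grad_norm_def]
lemmas grad_norm_triangle = grad.triangle[folded grad_norm_def]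

lemma grad_inner_shift:
  assumes u: "u \<in> sobolev \<Omega> 1" and v: "v \<in> sobolev \<Omega> 1"
  shows "grad_inner \<Omega> (\<lambda>x. u x + a) v = grad_inner \<Omega> u v"
  using grad.add_left[OF u sobolev_const(1) v, of a] grad_inner_const[OF v] by simp

lemma grad_norm_shift:
  assumes u: "u \<in> sobolev \<Omega> 1"
  shows "grad_norm \<Omega> (\<lambda>x. u x + a) = grad_norm \<Omega> u"
proof -
  let ?v = "\<lambda>x. u x + a"
  have v: "?v \<in> sobolev \<Omega> 1" by (rule sobolev_add(1)[OF u sobolev_const(1)])
  have "grad_inner \<Omega> ?v ?v = grad_inner \<Omega> u u"
    using grad_inner_shift[OF u v] grad.sym[OF u v] grad_inner_shift[OF u u] by (rule trans[OF _ trans])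
  then show ?thesis by (simp only: grad_norm_def)
qed

lemma sobolev_norm_1_bounds:
  assumes u: "u \<in> sobolev \<Omega> 1"
  shows "L2_norm M u \<le> sobolev_norm \<Omega> 1 u" "grad_norm \<Omega> u \<le> sobolev_norm \<Omega> 1 u"
    "sobolev_norm \<Omega> 1 u \<le> L2_norm M u + grad_norm \<Omega> u"
  unfolding sobolev_norm_1_eq[OF u]
  using L2_norm_nonneg[of M u] grad_norm_nonneg[of \<Omega> u]
  by (auto intro!: real_le_rsqrt sqrt_sum_squares_le_sum)

text \<open>Fixed once by choice, so that it visibly depends on \<Omega> alone and not on the
  mesh.\<close>

definition poincare_const :: real where
  "poincare_const = (SOME C. C > 0 \<and>
     (\<forall>u\<in>sobolev \<Omega> 1. (LINT x|M. u x) = 0 \<longrightarrow> L2_norm M u \<le> C * grad_norm \<Omega> u))"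

lemma poincare_const_pos: "poincare_const > 0"
  and Poincare: "\<And>u. u \<in> sobolev \<Omega> 1 \<Longrightarrow> (LINT x|M. u x) = 0 \<Longrightarrow> L2_norm M u \<le> poincare_const * grad_norm \<Omega> u"
proof -
  have "\<exists>C>0. \<forall>u\<in>sobolev \<Omega> 1. (LINT x|M. u x) = 0 \<longrightarrow> L2_norm M u \<le> C * grad_norm \<Omega> u"
    using Poincare_inequality by metis
  from someI_ex[OF this]
  show "poincare_const > 0" "\<And>u. u \<in> sobolev \<Omega> 1 \<Longrightarrow> (LINT x|M. u x) = 0 \<Longrightarrow> L2_norm M u \<le> poincare_const * grad_norm \<Omega> u"
    unfolding poincare_const_def by auto
qed

lemma measure_space_pos: "measure M (space M) > 0"
proof -
  have "measure lebesgue \<Omega> > 0"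
    using open_not_negligible[OF open_set nonempty] negligible_iff_measure0[OF lmeasurable]
    by (simp add: order_less_le)
  then show ?thesis using sets_lebesgue by (simp add: measure_restrict_space space_restrict_space)
qed

definition mean :: "(real^2 \<Rightarrow> real) \<Rightarrow> real" where
  "mean u = (LINT x|M. u x) / measure M (space M)"

lemma integral_shift_mean:
  assumes "u \<in> L2 M"
  shows "(LINT x|M. u x - mean u) = 0"
proof -
  interpret finite_measure M by (rule finite_M)
  have "(LINT x|M. u x - mean u) = (LINT x|M. u x) - (LINT x|M. mean u)"
    by (rule Bochner_Integration.integral_diff[OF L2_integrable[OF finite_M assms]]) simp
  then show ?thesis using measure_space_pos by (simp add: mean_def)
qed

text \<open>A mean-zero \<open>g\<close> does not see constants, so the mean of \<open>v\<close> can
  be subtracted before Poincare is applied. This serves for arguments \<open>v\<close> that are not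
  normalised themselves.\<close>

lemma zero_mean_inner_bound:
  assumes g: "g \<in> L2 M" "(LINT x|M. g x) = 0" and v: "v \<in> sobolev \<Omega> 1"
  shows "\<bar>L2_inner M g v\<bar> \<le> L2_norm M g * (poincare_const * grad_norm \<Omega> v)"
proof -
  define w where "w = (\<lambda>x. v x + - mean v)"
  have vL: "v \<in> L2 M" using sobolevD(1)[OF v] .
  have w: "w \<in> sobolev \<Omega> 1" unfolding w_def by (rule sobolev_add(1)[OF v sobolev_const(1)])
  have "L2_inner M g w = L2_inner M g v + L2_inner M g (\<lambda>x. - mean v)"
    unfolding w_def by (rule L2.add_right[OF vL const_L2 g(1)])
  also have "L2_inner M g (\<lambda>x. - mean v) = 0" using g(2) by (simp add: L2_inner_def)
  finally have "\<bar>L2_inner M g v\<bar> \<le> L2_norm M g * L2_norm M w"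
    using L2_Cauchy_Schwarz[OF g(1) sobolevD(1)[OF w]] by simp
  also have "\<dots> \<le> L2_norm M g * (poincare_const * grad_norm \<Omega> w)"
    using integral_shift_mean[OF vL]
    by (intro mult_left_mono Poincare w L2_norm_nonneg) (simp add: w_def)
  also have "grad_norm \<Omega> w = grad_norm \<Omega> v" unfolding w_def by (rule grad_norm_shift[OF v])
  finally show ?thesis .
qed

end

text \<open>\<open>V_dependent\<close> is finite dimension modulo functions vanishing on \<Omega>:
  off the closure of \<Omega> the values of a finite element function are arbitrary, so dependence
  on the whole plane would be false. \<open>N\<close> enters no constant, which keeps the estimates
  uniform in the mesh.\<close>

locale galerkin_space = bounded_convex_set +
  fixes V :: "(real^2 \<Rightarrow> real) set" and N :: nat
  assumes V_sobolev: "V \<subseteq> sobolev \<Omega> 1"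
    and V_add: "\<And>u v. u \<in> V \<Longrightarrow> v \<in> V \<Longrightarrow> (\<lambda>x. u x + v x) \<in> V"
    and V_scale: "\<And>a u. u \<in> V \<Longrightarrow> (\<lambda>x. a * u x) \<in> V"
    and V_const: "\<And>a. (\<lambda>x. a) \<in> V"
    and V_dependent: "\<And>e :: nat \<Rightarrow> real^2 \<Rightarrow> real. (\<And>i. i < N \<Longrightarrow> e i \<in> V) \<Longrightarrow>
      \<exists>l. (\<exists>i<N. l i \<noteq> 0) \<and> (\<forall>x\<in>\<Omega>. (\<Sum>i<N. l i * e i x) = 0)"
begin

interpretation grad: semi_inner "sobolev \<Omega> 1" "grad_inner \<Omega>" by (rule semi_inner_grad)

lemma V_diff: "u \<in> V \<Longrightarrow> v \<in> V \<Longrightarrow> (\<lambda>x. u x - v x) \<in> V"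
  using V_add[of u "\<lambda>x. -1 * v x"] V_scale[of v "-1"] by simp

abbreviation "V0 \<equiv> V \<inter> L2_zero_mean M"

lemma semi_inner_V0: "semi_inner V0 (grad_inner \<Omega>)"
proof
  show "(\<lambda>x. 0) \<in> V0" using V_const const_L2 by (simp add: L2_zero_mean_def)
qed (use V_sobolev in \<open>auto simp: subset_iff V_add V_scale zero_mean_add zero_mean_scale grad.add_left
    grad.scale_left grad.sym grad.nonneg simp del: One_nat_def\<close>)

text \<open>Gives meaning to the choice in \<open>discrete_inverse_laplacian\<close>. The functional
  is bounded by the Poincare inequality, and long families have a combination with zero gradient by
  \<open>sobolev_eq_0\<close>.\<close>

lemma discrete_inverse_laplacian_exists:
  assumes g: "g \<in> L2_zero_mean M"
  shows "\<exists>w\<in>V0. \<forall>v\<in>V0. grad_inner \<Omega> w v = L2_inner M g v"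
proof (rule semi_inner.Riesz_representation[OF semi_inner_V0])
  have gL: "g \<in> L2 M" "(LINT x|M. g x) = 0" using g by (auto simp: L2_zero_mean_def)
  have VL: "u \<in> V0 \<Longrightarrow> u \<in> L2 M" for u by (simp add: L2_zero_mean_def)
  show "\<bar>L2_inner M g v\<bar> \<le> L2_norm M g * poincare_const * sqrt (grad_inner \<Omega> v v)" if "v \<in> V0" for v
    using zero_mean_inner_bound[OF gL, of v] that V_sobolev by (auto simp: grad_norm_def mult.assoc)
  show "L2_inner M g (\<lambda>x. u x + v x) = L2_inner M g u + L2_inner M g v" if "u \<in> V0" "v \<in> V0" for u v
    using L2.add_right[OF VL VL gL(1)] that by blast
  show "L2_inner M g (\<lambda>x. a * u x) = a * L2_inner M g u" if "u \<in> V0" for u a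
    using L2.scale_right[OF VL gL(1)] that by blast
  show "\<exists>l. (\<exists>i<N. l i \<noteq> 0) \<and>
      grad_inner \<Omega> (\<lambda>x. \<Sum>i<N. l i * e i x) (\<lambda>x. \<Sum>i<N. l i * e i x) = 0"
    if e: "\<And>i. i < N \<Longrightarrow> e i \<in> V0" for e :: "nat \<Rightarrow> real^2 \<Rightarrow> real"
  proof -
    obtain l where l: "\<exists>i<N. l i \<noteq> 0" "\<forall>x\<in>\<Omega>. (\<Sum>i<N. l i * e i x) = 0"
      using V_dependent[of e] e by blast
    have S: "(\<lambda>x. \<Sum>i<N. l i * e i x) \<in> sobolev \<Omega> 1"
      by (rule grad.sum_mem) (use e V_sobolev in auto)
    have "grad_inner \<Omega> (\<lambda>x. \<Sum>i<N. l i * e i x) (\<lambda>x. \<Sum>i<N. l i * e i x) = 0"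
      by (rule grad_inner_AE_0[OF S S]) (rule sobolev_eq_0[OF S], use l in blast)+
    with l(1) show ?thesis by blast
  qed
qed

text \<open>Test the defining equation of the discrete inverse Laplacian with its own solution and
  cancel one factor.\<close>

lemma dual_norm_le:
  assumes g: "g \<in> L2_zero_mean M"
  shows "dual_norm \<Omega> V g \<le> poincare_const * L2_norm M g"
proof -
  define w where "w = discrete_inverse_laplacian \<Omega> V g"
  have "\<exists>w. w \<in> V0 \<and> (\<forall>v\<in>V0. grad_inner \<Omega> w v = L2_inner M g v)"
    using discrete_inverse_laplacian_exists[OF g] by blast
  from someI_ex[OF this] have w: "w \<in> V0" "\<And>v. v \<in> V0 \<Longrightarrow> grad_inner \<Omega> w v = L2_inner M g v"
    unfolding w_def discrete_inverse_laplacian_def by auto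
  have ws: "w \<in> sobolev \<Omega> 1" using w(1) V_sobolev by auto
  have "(grad_norm \<Omega> w)\<^sup>2 = L2_inner M g w" using w(2)[OF w(1)] by (simp add: grad_norm_power2[OF ws])
  also have "\<dots> \<le> L2_norm M g * (poincare_const * grad_norm \<Omega> w)"
    using zero_mean_inner_bound[of g w] g ws by (simp add: L2_zero_mean_def)
  finally have "grad_norm \<Omega> w * grad_norm \<Omega> w \<le> (poincare_const * L2_norm M g) * grad_norm \<Omega> w"
    by (simp add: power2_eq_square algebra_simps)
  then have "grad_norm \<Omega> w \<le> poincare_const * L2_norm M g"
    using grad_norm_nonneg[of \<Omega> w] poincare_const_pos L2_norm_nonneg[of M g]
    by (cases "grad_norm \<Omega> w = 0") auto
  then show ?thesis by (simp add: dual_norm_def w_def)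
qed

end

text \<open>For Z = X + Y one has Z^2 \<le> 2 (X^2 + Y^2). If Z > S, then S^2 is at most S Z and
  \<alpha> Z \<le> 4 B S follows; the summand 1 in the bound covers the case Z \<le> S.\<close>

lemma quadratic_absorb:
  fixes \<alpha> B S X Y :: real
  assumes "\<alpha> > 0" "B \<ge> 0" "S \<ge> 0" "X \<ge> 0" "Y \<ge> 0"
    and le: "\<alpha> * (X\<^sup>2 + Y\<^sup>2) \<le> B * S * (X + Y) + B * S\<^sup>2"
  shows "X + Y \<le> (4 * B / \<alpha> + 1) * S"
proof (rule ccontr)
  let ?Z = "X + Y"
  assume "\<not> ?Z \<le> (4 * B / \<alpha> + 1) * S"
  then have Z: "?Z > 4 * B / \<alpha> * S + S" by (simp add: algebra_simps)
  have "4 * B / \<alpha> * S \<ge> 0" using assms by simp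
  then have ZS: "?Z > S" "?Z > 4 * B / \<alpha> * S" "?Z > 0" using Z \<open>S \<ge> 0\<close> by linarith+
  have "?Z\<^sup>2 \<le> 2 * (X\<^sup>2 + Y\<^sup>2)"
    using zero_le_power2[of "X - Y"] by (simp add: power2_eq_square algebra_simps)
  then have "\<alpha> * ?Z\<^sup>2 \<le> 2 * (\<alpha> * (X\<^sup>2 + Y\<^sup>2))" using \<open>\<alpha> > 0\<close> by (simp add: mult.left_commute)
  also have "\<dots> \<le> 2 * (B * S * ?Z + B * S * ?Z)"
  proof -
    have "B * S * S \<le> B * S * ?Z" using assms ZS by (intro mult_left_mono) auto
    then show ?thesis using le by (simp add: power2_eq_square mult.assoc)
  qed
  finally have "\<alpha> * ?Z * ?Z \<le> (4 * B * S) * ?Z" by (simp add: power2_eq_square algebra_simps)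
  then have "\<alpha> * ?Z \<le> 4 * B * S" using ZS by simp
  then show False using ZS(2) \<open>\<alpha> > 0\<close> by (simp add: field_simps)
qed

section \<open>The energy estimate\<close>

context galerkin_space
begin

interpretation grad: semi_inner "sobolev \<Omega> 1" "grad_inner \<Omega>" by (rule semi_inner_grad)

text \<open>The bracket sums the coefficients in the bounds for the terms of the energy identity;
  the minimum is the coercivity constant of its left-hand side. \<open>quadratic_absorb\<close>
  contributes 4 times the quotient plus 1; the other 1 comes from adding the approximation errors to
  the discrete ones.\<close>

definition stability_const :: "real \<Rightarrow> real \<Rightarrow> real \<Rightarrow> real \<Rightarrow> real" where
  "stability_const m \<epsilon> \<tau> L =
     4 * (m * \<tau> + \<epsilon>\<^sup>2 + (poincare_const + 1) * poincare_const + poincare_const + L * poincare_const\<^sup>2 + L * poincare_const) / min (m * \<tau>) (\<epsilon>\<^sup>2) + 2"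

text \<open>
  Testing the difference of the first equations with \<open>\<xi>\<close> and of the second ones with \<open>\<theta>\<close> makes
  the cross term \<open>(\<theta>, \<xi>)\<close> cancel. Shifting \<open>P\<close> by a constant gives \<open>\<theta>\<close> and \<open>\<rho>\<close> mean zero, so that the
  inequality of Poincare applies to both.
\<close>

lemma galerkin_estimate:
  assumes pos: "m > 0" "\<epsilon> > 0" "\<tau> > 0" "L > 0"
    and c: "c \<in> sobolev \<Omega> 1" and \<mu>: "\<mu> \<in> sobolev \<Omega> 1" and ch: "ch \<in> V" and \<mu>h: "\<mu>h \<in> V"
    and p: "p \<in> L2 M" and ph: "ph \<in> L2 M" and mean_eq: "(LINT x|M. ph x) = (LINT x|M. p x)"
    and L2s: "a \<in> L2 M" "ah \<in> L2 M" "b \<in> L2 M" "bh \<in> L2 M"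
    and exact1: "\<And>v. v \<in> V \<Longrightarrow> L2_inner M (\<lambda>x. (c x - p x) / \<tau>) v + m * grad_inner \<Omega> \<mu> v = 0"
    and exact2: "\<And>w. w \<in> V \<Longrightarrow> L2_inner M \<mu> w - \<epsilon>\<^sup>2 * grad_inner \<Omega> c w - L2_inner M (\<lambda>x. a x - b x) w = 0"
    and disc1: "\<And>v. v \<in> V \<Longrightarrow> L2_inner M (\<lambda>x. (ch x - ph x) / \<tau>) v + m * grad_inner \<Omega> \<mu>h v = 0"
    and disc2: "\<And>w. w \<in> V \<Longrightarrow> L2_inner M \<mu>h w - \<epsilon>\<^sup>2 * grad_inner \<Omega> ch w - L2_inner M (\<lambda>x. ah x - bh x) w = 0"
    and mono: "AE x in M. 0 \<le> (a x - ah x) * (c x - ch x)"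
    and lip_a: "AE x in M. \<bar>a x - ah x\<bar> \<le> L * \<bar>c x - ch x\<bar>"
    and lip_b: "AE x in M. \<bar>b x - bh x\<bar> \<le> L * \<bar>p x - ph x\<bar>"
  shows "(\<lambda>x. c x - ch x) \<in> L2_zero_mean M"
    and "P \<in> V \<Longrightarrow> Q \<in> V \<Longrightarrow>
      grad_norm \<Omega> (\<lambda>x. c x - ch x) + grad_norm \<Omega> (\<lambda>x. \<mu> x - \<mu>h x) \<le> stability_const m \<epsilon> \<tau> L *
        (sobolev_norm \<Omega> 1 (\<lambda>x. c x - P x) + sobolev_norm \<Omega> 1 (\<lambda>x. \<mu> x - Q x) + L2_norm M (\<lambda>x. p x - ph x))"
proof -
  have VS: "v \<in> sobolev \<Omega> 1" if "v \<in> V" for v using that V_sobolev by blast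
  have SL: "v \<in> L2 M" if "v \<in> sobolev \<Omega> 1" for v using sobolevD(1)[OF that] .
  define e where "e = (\<lambda>x. c x - ch x)"
  define d where "d = (\<lambda>x. p x - ph x)"
  define \<eta> where "\<eta> = (\<lambda>x. \<mu> x - \<mu>h x)"
  \<comment> \<open>Differences of the implicit and, next, of the explicit nonlinear terms; besides
    square integrability only \<open>mono\<close>, \<open>lip_a\<close> and \<open>lip_b\<close> are
    known about them.\<close>
  define \<alpha> where "\<alpha> = (\<lambda>x. a x - ah x)"
  define \<beta> where "\<beta> = (\<lambda>x. b x - bh x)"
  have eS: "e \<in> sobolev \<Omega> 1" and \<eta>S: "\<eta> \<in> sobolev \<Omega> 1"
    unfolding e_def \<eta>_def by (intro grad.diff_mem c \<mu> VS ch \<mu>h)+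
  note eL = SL[OF eS] and \<eta>L = SL[OF \<eta>S]
  have dL: "d \<in> L2 M" and \<alpha>L: "\<alpha> \<in> L2 M" and \<beta>L: "\<beta> \<in> L2 M"
    unfolding d_def \<alpha>_def \<beta>_def by (intro L2.diff_mem p ph L2s)+
  \<comment> \<open>Galerkin orthogonality of the first equation, multiplied by \<tau> so that its
    mixed term matches the one in \<open>A2\<close>.\<close>
  have A1: "L2_inner M e v - L2_inner M d v + m * \<tau> * grad_inner \<Omega> \<eta> v = 0" if v: "v \<in> V" for v
  proof -
    note vL = SL[OF VS[OF v]]
    have *: "L2_inner M (\<lambda>x. (f x - g x) / \<tau>) v = (L2_inner M f v - L2_inner M g v) / \<tau>"
      if "f \<in> L2 M" "g \<in> L2 M" for f g
      using L2.scale_left[OF L2.diff_mem[OF that] vL, of "1 / \<tau>"] L2.diff_left[OF that vL] by simp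
    have split: "L2_inner M e v = L2_inner M c v - L2_inner M ch v" "L2_inner M d v = L2_inner M p v - L2_inner M ph v"
      unfolding e_def d_def using L2.diff_left SL c VS ch p ph vL by blast+
    have split_grad: "grad_inner \<Omega> \<eta> v = grad_inner \<Omega> \<mu> v - grad_inner \<Omega> \<mu>h v"
      unfolding \<eta>_def by (rule grad.diff_left[OF \<mu> VS[OF \<mu>h] VS[OF v]])
    have "L2_inner M c v - L2_inner M p v + m * \<tau> * grad_inner \<Omega> \<mu> v = 0"
      using exact1[OF v] \<open>\<tau> > 0\<close> unfolding *[OF SL[OF c] p] by (simp add: field_simps)
    moreover have "L2_inner M ch v - L2_inner M ph v + m * \<tau> * grad_inner \<Omega> \<mu>h v = 0"
      using disc1[OF v] \<open>\<tau> > 0\<close> unfolding *[OF SL[OF VS[OF ch]] ph] by (simp add: field_simps)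
    ultimately show ?thesis unfolding split split_grad by (simp add: algebra_simps)
  qed
  have A2: "L2_inner M \<eta> w - \<epsilon>\<^sup>2 * grad_inner \<Omega> e w - L2_inner M \<alpha> w + L2_inner M \<beta> w = 0" if w: "w \<in> V" for w
  proof -
    note wL = SL[OF VS[OF w]]
    have split1: "L2_inner M \<eta> w = L2_inner M \<mu> w - L2_inner M \<mu>h w"
      unfolding \<eta>_def using L2.diff_left SL \<mu> VS \<mu>h wL by blast
    have split2: "grad_inner \<Omega> e w = grad_inner \<Omega> c w - grad_inner \<Omega> ch w"
      unfolding e_def by (rule grad.diff_left[OF c VS[OF ch] VS[OF w]])
    have split3: "L2_inner M \<alpha> w = L2_inner M a w - L2_inner M ah w" "L2_inner M \<beta> w = L2_inner M b w - L2_inner M bh w"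
      unfolding \<alpha>_def \<beta>_def using L2.diff_left L2s wL by blast+
    show ?thesis
      using exact2[OF w] disc2[OF w] unfolding split1 split2 split3 L2.diff_left[OF L2s(1,3) wL] L2.diff_left[OF L2s(2,4) wL]
      by (simp add: algebra_simps)
  qed
  have mean_d: "(LINT x|M. d x) = 0"
    unfolding d_def using mean_eq L2_integrable[OF finite_M p] L2_integrable[OF finite_M ph] by simp
  \<comment> \<open>Mass conservation: test with the constant 1, whose gradient vanishes.\<close>
  have mean_e: "(LINT x|M. e x) = 0"
    using A1[OF V_const[of 1]] mean_d grad.sym[OF \<eta>S sobolev_const(1)[of 1]] grad_inner_const[OF \<eta>S, of 1]
    by (simp add: L2_inner_def)
  then show "(\<lambda>x. c x - ch x) \<in> L2_zero_mean M" using eL by (simp add: L2_zero_mean_def e_def)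

  assume P: "P \<in> V" and Q: "Q \<in> V"
  \<comment> \<open>The shift gives \<theta> mean zero; as the full error has mean zero, so does
    \<rho>. No shift is made in \<open>Q\<close>, so \<xi> is not normalised.\<close>
  define P' where "P' = (\<lambda>x. P x + - mean (\<lambda>x. P x - ch x))"
  define \<rho> where "\<rho> = (\<lambda>x. c x - P' x)"
  define \<theta> where "\<theta> = (\<lambda>x. P' x - ch x)"
  define \<sigma> where "\<sigma> = (\<lambda>x. \<mu> x - Q x)"
  define \<xi> where "\<xi> = (\<lambda>x. Q x - \<mu>h x)"
  have P'V: "P' \<in> V" unfolding P'_def by (intro V_add P V_const)
  have \<theta>V: "\<theta> \<in> V" and \<xi>V: "\<xi> \<in> V" unfolding \<theta>_def \<xi>_def by (intro V_diff P'V Q ch \<mu>h)+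
  note \<theta>S = VS[OF \<theta>V] and \<xi>S = VS[OF \<xi>V]
  have \<rho>S: "\<rho> \<in> sobolev \<Omega> 1" and \<sigma>S: "\<sigma> \<in> sobolev \<Omega> 1"
    unfolding \<rho>_def \<sigma>_def by (intro grad.diff_mem c \<mu> VS P'V Q)+
  note \<theta>L = SL[OF \<theta>S] and \<xi>L = SL[OF \<xi>S] and \<rho>L = SL[OF \<rho>S] and \<sigma>L = SL[OF \<sigma>S]
  have mean_\<theta>: "(LINT x|M. \<theta> x) = 0"
    using integral_shift_mean[OF SL[OF VS[OF V_diff[OF P ch]]]] by (simp add: \<theta>_def P'_def algebra_simps)
  have e_eq: "e = (\<lambda>x. \<rho> x + \<theta> x)" and \<eta>_eq: "\<eta> = (\<lambda>x. \<sigma> x + \<xi> x)"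
    by (auto simp: e_def \<rho>_def \<theta>_def \<eta>_def \<sigma>_def \<xi>_def)
  have mean_\<rho>: "(LINT x|M. \<rho> x) = 0"
    using mean_e mean_\<theta> L2_integrable[OF finite_M \<rho>L] L2_integrable[OF finite_M \<theta>L] by (simp add: e_eq)

  let ?X = "grad_norm \<Omega> \<xi>" and ?Y = "grad_norm \<Omega> \<theta>"
  let ?r = "grad_norm \<Omega> \<rho>" and ?s = "sobolev_norm \<Omega> 1 \<sigma>" and ?n = "L2_norm M d"
  let ?K = poincare_const
  define S where "S = ?r + ?s + ?n"
  have X0: "?X \<ge> 0" and Y0: "?Y \<ge> 0" and r0: "?r \<ge> 0" and n0: "?n \<ge> 0" and s0: "?s \<ge> 0"
    using grad_norm_nonneg[of \<Omega> \<xi>] grad_norm_nonneg[of \<Omega> \<theta>] grad_norm_nonneg[of \<Omega> \<rho>]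
      L2_norm_nonneg[of M d] sobolev_norm_1_bounds(2)[OF \<sigma>S] grad_norm_nonneg[of \<Omega> \<sigma>] by auto
  have S: "?r \<le> S" "?s \<le> S" "?n \<le> S" "S \<ge> 0" using r0 n0 s0 by (auto simp: S_def)
  have K0: "?K \<ge> 0" using poincare_const_pos by simp
  have \<theta>n: "L2_norm M \<theta> \<le> ?K * ?Y" and \<rho>n: "L2_norm M \<rho> \<le> ?K * ?r"
    using Poincare[OF \<theta>S mean_\<theta>] Poincare[OF \<rho>S mean_\<rho>] .
  have en: "L2_norm M e \<le> ?K * ?r + ?K * ?Y"
    using L2_norm_triangle[OF \<rho>L \<theta>L] \<theta>n \<rho>n by (simp add: e_eq)
  have \<alpha>n: "L2_norm M \<alpha> \<le> L * L2_norm M e"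
    by (rule L2_norm_Lipschitz_AE[OF \<alpha>L eL]) (use lip_a pos in \<open>auto simp: \<alpha>_def e_def\<close>)
  have \<beta>n: "L2_norm M \<beta> \<le> L * ?n"
    by (rule L2_norm_Lipschitz_AE[OF \<beta>L dL]) (use lip_b pos in \<open>auto simp: \<beta>_def d_def\<close>)

  \<comment> \<open>\<open>A1\<close> at \<xi> minus \<open>A2\<close> at \<theta>. The pairing of
    the implicit term with \<theta> is rewritten as the pairing with the full error
    \<open>e\<close>, which has a sign, minus the one with \<rho>.\<close>
  have id: "m * \<tau> * ?X\<^sup>2 + \<epsilon>\<^sup>2 * ?Y\<^sup>2 = L2_inner M (\<lambda>x. d x - \<rho> x) \<xi> - m * \<tau> * grad_inner \<Omega> \<sigma> \<xi>
    + L2_inner M \<sigma> \<theta> - \<epsilon>\<^sup>2 * grad_inner \<Omega> \<rho> \<theta> - L2_inner M \<alpha> e + L2_inner M \<alpha> \<rho> + L2_inner M \<beta> \<theta>"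
  proof -
    have "L2_inner M \<rho> \<xi> + L2_inner M \<theta> \<xi> - L2_inner M d \<xi> + m * \<tau> * (grad_inner \<Omega> \<sigma> \<xi> + ?X\<^sup>2) = 0"
      using A1[OF \<xi>V] unfolding e_eq \<eta>_eq L2.add_left[OF \<rho>L \<theta>L \<xi>L] grad.add_left[OF \<sigma>S \<xi>S \<xi>S]
      by (simp add: grad_norm_power2[OF \<xi>S])
    moreover have "L2_inner M \<sigma> \<theta> + L2_inner M \<theta> \<xi> - \<epsilon>\<^sup>2 * (grad_inner \<Omega> \<rho> \<theta> + ?Y\<^sup>2)
        - L2_inner M \<alpha> \<theta> + L2_inner M \<beta> \<theta> = 0"
      using A2[OF \<theta>V] unfolding e_eq \<eta>_eq L2.add_left[OF \<sigma>L \<xi>L \<theta>L] grad.add_left[OF \<rho>S \<theta>S \<theta>S]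
      by (simp add: grad_norm_power2[OF \<theta>S] L2.sym[OF \<xi>L \<theta>L])
    moreover have "L2_inner M \<alpha> e = L2_inner M \<alpha> \<rho> + L2_inner M \<alpha> \<theta>"
      unfolding e_eq by (rule L2.add_right[OF \<rho>L \<theta>L \<alpha>L])
    moreover have "L2_inner M (\<lambda>x. d x - \<rho> x) \<xi> = L2_inner M d \<xi> - L2_inner M \<rho> \<xi>"
      by (rule L2.diff_left[OF dL \<rho>L \<xi>L])
    ultimately show ?thesis by (simp add: algebra_simps)
  qed
  \<comment> \<open>Since \<open>d\<close> and \<rho> have mean zero, the gradient of \<xi> suffices
    although \<xi> itself may have a nonzero mean.\<close>
  have b1: "L2_inner M (\<lambda>x. d x - \<rho> x) \<xi> \<le> (?K + 1) * ?K * S * ?X"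
  proof -
    have dr: "(\<lambda>x. d x - \<rho> x) \<in> L2 M" by (rule L2.diff_mem[OF dL \<rho>L])
    have "(LINT x|M. d x - \<rho> x) = 0"
      using mean_d mean_\<rho> L2_integrable[OF finite_M \<rho>L] L2_integrable[OF finite_M dL] by simp
    from zero_mean_inner_bound[OF dr this \<xi>S]
    have "L2_inner M (\<lambda>x. d x - \<rho> x) \<xi> \<le> L2_norm M (\<lambda>x. d x - \<rho> x) * (?K * ?X)" by linarith
    also have "\<dots> \<le> ((?K + 1) * S) * (?K * ?X)"
    proof (rule mult_right_mono)
      have "L2_norm M (\<lambda>x. d x - \<rho> x) \<le> ?n + ?K * ?r" using L2_norm_triangle_diff[OF dL \<rho>L] \<rho>n by linarith
      also have "\<dots> \<le> S + ?K * S" by (intro add_mono mult_left_mono S K0)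
      finally show "L2_norm M (\<lambda>x. d x - \<rho> x) \<le> (?K + 1) * S" by (simp add: algebra_simps)
    qed (use K0 X0 in simp)
    finally show ?thesis by (simp add: algebra_simps)
  qed
  have b2: "- (m * \<tau> * grad_inner \<Omega> \<sigma> \<xi>) \<le> m * \<tau> * S * ?X"
  proof -
    have "- grad_inner \<Omega> \<sigma> \<xi> \<le> grad_norm \<Omega> \<sigma> * ?X" using grad_Cauchy_Schwarz[OF \<sigma>S \<xi>S] by linarith
    also have "\<dots> \<le> S * ?X"
      using order_trans[OF sobolev_norm_1_bounds(2)[OF \<sigma>S] S(2)] X0 by (rule mult_right_mono)
    finally have "m * \<tau> * (- grad_inner \<Omega> \<sigma> \<xi>) \<le> m * \<tau> * (S * ?X)"
      using pos by (intro mult_left_mono) auto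
    then show ?thesis by (simp add: algebra_simps)
  qed
  have b3: "L2_inner M \<sigma> \<theta> \<le> ?K * S * ?Y"
  proof -
    have "L2_inner M \<sigma> \<theta> \<le> L2_norm M \<sigma> * L2_norm M \<theta>" using L2_Cauchy_Schwarz[OF \<sigma>L \<theta>L] by linarith
    also have "\<dots> \<le> S * (?K * ?Y)"
      by (intro mult_mono \<theta>n order_trans[OF sobolev_norm_1_bounds(1)[OF \<sigma>S] S(2)] S L2_norm_nonneg)
    finally show ?thesis by (simp add: algebra_simps)
  qed
  have b4: "- (\<epsilon>\<^sup>2 * grad_inner \<Omega> \<rho> \<theta>) \<le> \<epsilon>\<^sup>2 * S * ?Y"
  proof -
    have "- grad_inner \<Omega> \<rho> \<theta> \<le> ?r * ?Y" using grad_Cauchy_Schwarz[OF \<rho>S \<theta>S] by linarith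
    also have "\<dots> \<le> S * ?Y" using S(1) Y0 by (rule mult_right_mono)
    finally have "\<epsilon>\<^sup>2 * (- grad_inner \<Omega> \<rho> \<theta>) \<le> \<epsilon>\<^sup>2 * (S * ?Y)" by (intro mult_left_mono) auto
    then show ?thesis by (simp add: algebra_simps)
  qed
  have b5: "L2_inner M \<alpha> e \<ge> 0"
    unfolding L2_inner_def \<alpha>_def e_def by (rule integral_nonneg_AE[OF mono])
  \<comment> \<open>The Lipschitz bound brings back the full error and with it \<theta>, but only
    linearly, since \<rho> supplies the other factor. This is the source of the
    \<open>S\<^sup>2\<close> term.\<close>
  have b6: "L2_inner M \<alpha> \<rho> \<le> L * ?K\<^sup>2 * S * ?Y + L * ?K\<^sup>2 * S\<^sup>2"
  proof -
    have "L2_inner M \<alpha> \<rho> \<le> L2_norm M \<alpha> * L2_norm M \<rho>" using L2_Cauchy_Schwarz[OF \<alpha>L \<rho>L] by linarith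
    also have "\<dots> \<le> (L * (?K * S + ?K * ?Y)) * (?K * S)"
    proof (intro mult_mono L2_norm_nonneg)
      have "L2_norm M e \<le> ?K * S + ?K * ?Y" using en mult_left_mono[OF S(1) K0] by linarith
      then show "L2_norm M \<alpha> \<le> L * (?K * S + ?K * ?Y)" using \<alpha>n pos
        by (meson mult_left_mono order_less_imp_le order_trans)
      show "L2_norm M \<rho> \<le> ?K * S" using \<rho>n mult_left_mono[OF S(1) K0] by linarith
      show "0 \<le> L * (?K * S + ?K * ?Y)" using pos K0 S Y0 by simp
    qed
    finally show ?thesis by (simp add: algebra_simps power2_eq_square)
  qed
  have b7: "L2_inner M \<beta> \<theta> \<le> L * ?K * S * ?Y"
  proof -
    have "L2_inner M \<beta> \<theta> \<le> L2_norm M \<beta> * L2_norm M \<theta>" using L2_Cauchy_Schwarz[OF \<beta>L \<theta>L] by linarith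
    also have "\<dots> \<le> (L * S) * (?K * ?Y)"
    proof (intro mult_mono \<theta>n L2_norm_nonneg)
      show "L2_norm M \<beta> \<le> L * S" using \<beta>n mult_left_mono[OF S(3), of L] pos by linarith
    qed (use pos S in simp)
    finally show ?thesis by (simp add: algebra_simps)
  qed
  define B where "B = m * \<tau> + \<epsilon>\<^sup>2 + (?K + 1) * ?K + ?K + L * ?K\<^sup>2 + L * ?K"
  define \<gamma> where "\<gamma> = min (m * \<tau>) (\<epsilon>\<^sup>2)"
  have stab: "stability_const m \<epsilon> \<tau> L = 4 * B / \<gamma> + 2"
    by (simp only: stability_const_def B_def \<gamma>_def)
  have \<gamma>: "\<gamma> > 0" using pos by (simp add: \<gamma>_def)
  have terms: "0 \<le> m * \<tau>" "0 \<le> \<epsilon>\<^sup>2" "0 \<le> (?K + 1) * ?K" "0 \<le> L * ?K\<^sup>2" "0 \<le> L * ?K"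
    using pos K0 by simp_all
  have B: "B \<ge> 0" using terms K0 by (simp add: B_def)
  have "\<gamma> * (?X\<^sup>2 + ?Y\<^sup>2) \<le> m * \<tau> * ?X\<^sup>2 + \<epsilon>\<^sup>2 * ?Y\<^sup>2"
    unfolding distrib_left by (intro add_mono mult_right_mono) (auto simp: \<gamma>_def)
  also have "\<dots> \<le> (m * \<tau> + (?K + 1) * ?K) * (S * ?X) + (\<epsilon>\<^sup>2 + ?K + L * ?K\<^sup>2 + L * ?K) * (S * ?Y) + L * ?K\<^sup>2 * S\<^sup>2"
    unfolding id using b1 b2 b3 b4 b5 b6 b7 by (simp add: algebra_simps)
  also have "\<dots> \<le> B * (S * ?X) + B * (S * ?Y) + B * S\<^sup>2"
    using terms K0 S X0 Y0 by (intro add_mono mult_right_mono) (auto simp: B_def)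
  also have "\<dots> = B * S * (?X + ?Y) + B * S\<^sup>2" by (simp add: algebra_simps)
  finally have XY: "?X + ?Y \<le> (4 * B / \<gamma> + 1) * S"
    by (rule quadratic_absorb[OF \<gamma> B S(4) X0 Y0])
  have "grad_norm \<Omega> e + grad_norm \<Omega> \<eta> \<le> (?r + ?Y) + (?s + ?X)"
    using grad_norm_triangle[OF \<rho>S \<theta>S] grad_norm_triangle[OF \<sigma>S \<xi>S] sobolev_norm_1_bounds(2)[OF \<sigma>S]
    by (simp add: e_eq \<eta>_eq)
  also have "\<dots> \<le> stability_const m \<epsilon> \<tau> L * S"
  proof -
    have "stability_const m \<epsilon> \<tau> L * S = (4 * B / \<gamma> + 1) * S + S"
      unfolding stab by (simp add: algebra_simps)
    then show ?thesis using XY n0 unfolding S_def by linarith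
  qed
  also have "\<dots> \<le> stability_const m \<epsilon> \<tau> L * (sobolev_norm \<Omega> 1 (\<lambda>x. c x - P x) + ?s + ?n)"
  proof (rule mult_left_mono)
    have cP: "(\<lambda>x. c x - P x) \<in> sobolev \<Omega> 1" by (rule grad.diff_mem[OF c VS[OF P]])
    \<comment> \<open>The constant shift in \<open>P'\<close> is invisible to the gradient, so the
      bound returns to the original \<open>P\<close>.\<close>
    have "?r = grad_norm \<Omega> (\<lambda>x. c x - P x)"
      using grad_norm_shift[OF cP, of "mean (\<lambda>x. P x - ch x)"] by (simp add: \<rho>_def P'_def algebra_simps)
    then show "S \<le> sobolev_norm \<Omega> 1 (\<lambda>x. c x - P x) + ?s + ?n"
      using sobolev_norm_1_bounds(2)[OF cP] by (simp add: S_def)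
    show "0 \<le> stability_const m \<epsilon> \<tau> L"
      unfolding stab using B \<gamma> by simp
  qed
  finally show "grad_norm \<Omega> (\<lambda>x. c x - ch x) + grad_norm \<Omega> (\<lambda>x. \<mu> x - \<mu>h x) \<le> stability_const m \<epsilon> \<tau> L *
      (sobolev_norm \<Omega> 1 (\<lambda>x. c x - P x) + sobolev_norm \<Omega> 1 (\<lambda>x. \<mu> x - Q x) + L2_norm M (\<lambda>x. p x - ph x))"
    by (simp add: e_def \<eta>_def \<sigma>_def d_def)
qed

end

text \<open>Attainment of the infima is not assumed, so each variable is isolated in turn and the
  resulting lower bound is passed to its infimum.\<close>

lemma le_INF_sum:
  fixes F G :: "'a \<Rightarrow> real"
  assumes "V \<noteq> {}" "K > 0" "\<And>P Q. P \<in> V \<Longrightarrow> Q \<in> V \<Longrightarrow> T \<le> K * (F P + G Q + n)"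
  shows "T \<le> K * ((INF P\<in>V. F P) + (INF Q\<in>V. G Q) + n)"
proof -
  have 1: "T / K - n - G Q \<le> (INF P\<in>V. F P)" if "Q \<in> V" for Q
    by (rule cINF_greatest[OF assms(1)]) (use assms(2,3) that in \<open>simp add: field_simps\<close>)
  have "T / K - n - (INF P\<in>V. F P) \<le> (INF Q\<in>V. G Q)"
    by (rule cINF_greatest[OF assms(1)]) (use 1 in \<open>simp add: algebra_simps\<close>)
  then show ?thesis using assms(2) by (simp add: field_simps)
qed

section \<open>Lagrange finite element spaces as Galerkin spaces\<close>

lemma finite_degree_set: "finite {(i, j). i + j \<le> (r::nat)}"
  by (rule finite_subset[of _ "{..r} \<times> {..r}"]) auto

lemma bivariate_polynomials_add:
  assumes "p \<in> bivariate_polynomials r" "q \<in> bivariate_polynomials r"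
  shows "(\<lambda>x. p x + q x) \<in> bivariate_polynomials r"
proof -
  obtain a b where "\<And>x. p x = (\<Sum>(i, j) | i + j \<le> r. a i j * (x$1) ^ i * (x$2) ^ j)"
    "\<And>x. q x = (\<Sum>(i, j) | i + j \<le> r. b i j * (x$1) ^ i * (x$2) ^ j)"
    using assms unfolding bivariate_polynomials_def by blast
  then have "p x + q x = (\<Sum>(i, j) | i + j \<le> r. (a i j + b i j) * (x$1) ^ i * (x$2) ^ j)" for x
    by (simp add: sum.distrib[symmetric] case_prod_unfold distrib_right)
  then show ?thesis
    unfolding bivariate_polynomials_def by (intro CollectI exI[of _ "\<lambda>i j. a i j + b i j"] allI)
qed

lemma bivariate_polynomials_scale:
  assumes "p \<in> bivariate_polynomials r"
  shows "(\<lambda>x. s * p x) \<in> bivariate_polynomials r"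
proof -
  obtain a where "\<And>x. p x = (\<Sum>(i, j) | i + j \<le> r. a i j * (x$1) ^ i * (x$2) ^ j)"
    using assms unfolding bivariate_polynomials_def by blast
  then have "s * p x = (\<Sum>(i, j) | i + j \<le> r. (s * a i j) * (x$1) ^ i * (x$2) ^ j)" for x
    by (simp add: sum_distrib_left case_prod_unfold mult.assoc)
  then show ?thesis
    unfolding bivariate_polynomials_def by (intro CollectI exI[of _ "\<lambda>i j. s * a i j"] allI)
qed

lemma bivariate_polynomials_const: "(\<lambda>x. s) \<in> bivariate_polynomials r"
proof -
  have "(\<Sum>(i, j) | i + j \<le> r. (if (i, j) = (0, 0) then s else 0) * (x$1) ^ i * (x$2) ^ j) = s" for x :: "real^2"
  proof -
    have "(\<Sum>(i, j) | i + j \<le> r. (if (i, j) = (0, 0) then s else 0) * (x$1) ^ i * (x$2) ^ j)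
      = (\<Sum>k | k \<in> {(i, j). i + j \<le> r}. if k = (0, 0) then s else 0)"
      by (rule sum.cong) (auto split: if_splits)
    also have "\<dots> = s" using finite_degree_set[of r] by simp
    finally show ?thesis .
  qed
  then show ?thesis
    unfolding bivariate_polynomials_def
    by (intro CollectI exI[of _ "\<lambda>i j. if (i, j) = (0, 0) then s else 0"] allI) simp
qed

text \<open>A finite element function is determined on \<Omega> by one coefficient per triangle and
  monomial; a family with one member more than there are coefficients is dependent, whence
  \<open>Suc\<close>.\<close>

lemma (in bounded_convex_set) galerkin_space_lagrange:
  assumes \<T>: "conforming_triangulation \<Omega> \<T>"
  shows "galerkin_space \<Omega> (lagrange_space \<Omega> \<T> r) (Suc (card (\<T> \<times> {(i, j). i + j \<le> r})))"
proof
  let ?V = "lagrange_space \<Omega> \<T> r" and ?D = "\<T> \<times> {(i, j). i + j \<le> r}"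
  let ?N = "Suc (card ?D)"
  have fin: "finite \<T>" and Un: "\<Union>\<T> = closure \<Omega>"
    using \<T> by (auto simp: conforming_triangulation_def triangulation_def)
  have piece: "\<exists>p\<in>bivariate_polynomials r. \<forall>x\<in>K. u x = p x" if "u \<in> ?V" "K \<in> \<T>" for u K
    using that by (simp add: lagrange_space_def)
  have sob: "u \<in> sobolev \<Omega> 1" and cont: "continuous_on (closure \<Omega>) u" if "u \<in> ?V" for u
    using that by (simp_all add: lagrange_space_def)
  have memI: "u \<in> ?V" if "u \<in> sobolev \<Omega> 1" "continuous_on (closure \<Omega>) u"
    "\<And>K. K \<in> \<T> \<Longrightarrow> \<exists>p\<in>bivariate_polynomials r. \<forall>x\<in>K. u x = p x" for u
    using that by (simp add: lagrange_space_def)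
  show "?V \<subseteq> sobolev \<Omega> 1" using sob by blast
  show "(\<lambda>x. u x + v x) \<in> ?V" if u: "u \<in> ?V" and v: "v \<in> ?V" for u v
  proof (rule memI)
    show "(\<lambda>x. u x + v x) \<in> sobolev \<Omega> 1" by (rule sobolev_add(1)[OF sob[OF u] sob[OF v]])
    show "continuous_on (closure \<Omega>) (\<lambda>x. u x + v x)" by (rule continuous_on_add[OF cont[OF u] cont[OF v]])
    fix K assume K: "K \<in> \<T>"
    obtain p where p: "p \<in> bivariate_polynomials r" "\<forall>x\<in>K. u x = p x" using piece[OF u K] by blast
    obtain q where q: "q \<in> bivariate_polynomials r" "\<forall>x\<in>K. v x = q x" using piece[OF v K] by blast
    show "\<exists>p\<in>bivariate_polynomials r. \<forall>x\<in>K. u x + v x = p x"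
      by (rule bexI[OF _ bivariate_polynomials_add[OF p(1) q(1)]]) (use p(2) q(2) in simp)
  qed
  show "(\<lambda>x. a * u x) \<in> ?V" if u: "u \<in> ?V" for a u
  proof (rule memI)
    show "(\<lambda>x. a * u x) \<in> sobolev \<Omega> 1" by (rule sobolev_scale(1)[OF sob[OF u]])
    show "continuous_on (closure \<Omega>) (\<lambda>x. a * u x)" by (rule continuous_on_mult_left[OF cont[OF u]])
    fix K assume K: "K \<in> \<T>"
    obtain p where p: "p \<in> bivariate_polynomials r" "\<forall>x\<in>K. u x = p x" using piece[OF u K] by blast
    show "\<exists>p\<in>bivariate_polynomials r. \<forall>x\<in>K. a * u x = p x"
      by (rule bexI[OF _ bivariate_polynomials_scale[OF p(1), of a]]) (use p(2) in simp)
  qed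
  show "(\<lambda>x. a) \<in> ?V" for a
    by (rule memI[OF sobolev_const(1) continuous_on_const])
      (rule bexI[OF _ bivariate_polynomials_const[of a]], simp)
  show "\<exists>l. (\<exists>i<?N. l i \<noteq> 0) \<and> (\<forall>x\<in>\<Omega>. (\<Sum>i<?N. l i * e i x) = 0)"
    if e: "\<And>i. i < ?N \<Longrightarrow> e i \<in> ?V" for e :: "nat \<Rightarrow> real^2 \<Rightarrow> real"
  proof -
    define represents where "represents i K a \<longleftrightarrow>
        (\<forall>x\<in>K. e i x = (\<Sum>(j, k) | j + k \<le> r. a j k * (x$1) ^ j * (x$2) ^ k))" for i K a
    \<comment> \<open>Coefficients are fixed once per function and triangle, so that one linear
      relation between them serves all points.\<close>
    define a where "a i K = (SOME a. represents i K a)" for i K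
    have a: "represents i K (a i K)" if i: "i < ?N" and K: "K \<in> \<T>" for i K
    proof -
      obtain p where p: "p \<in> bivariate_polynomials r" "\<forall>x\<in>K. e i x = p x"
        using piece[OF e[OF i] K] by blast
      obtain b where "\<forall>x. p x = (\<Sum>(j, k) | j + k \<le> r. b j k * (x$1) ^ j * (x$2) ^ k)"
        using p(1) unfolding bivariate_polynomials_def by blast
      with p(2) have "represents i K b" by (simp add: represents_def)
      then show ?thesis unfolding a_def by (rule someI[of "represents i K"])
    qed
    have finD: "finite ?D" using fin finite_degree_set by (rule finite_cartesian_product)
    obtain l where l: "\<exists>i\<in>{..<?N}. l i \<noteq> 0"
      "\<forall>d\<in>?D. (\<Sum>i<?N. l i * (case d of (K, j, k) \<Rightarrow> a i K j k)) = 0"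
      using exists_linear_dependence[OF finD, of "{..<?N}" "\<lambda>i d. case d of (K, j, k) \<Rightarrow> a i K j k"] by auto
    have "(\<Sum>i<?N. l i * e i x) = 0" if "x \<in> \<Omega>" for x
    proof -
      obtain K where K: "K \<in> \<T>" "x \<in> K" using \<open>x \<in> \<Omega>\<close> Un closure_subset by blast
      have "l i * e i x = (\<Sum>(j, k) | j + k \<le> r. l i * a i K j k * ((x$1) ^ j * (x$2) ^ k))" if "i < ?N" for i
      proof -
        have "e i x = (\<Sum>(j, k) | j + k \<le> r. a i K j k * (x$1) ^ j * (x$2) ^ k)"
          using a[OF that K(1)] K(2) unfolding represents_def by (rule bspec)
        then show ?thesis by (simp only: sum_distrib_left case_prod_unfold mult.assoc)
      qed
      then have "(\<Sum>i<?N. l i * e i x)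
        = (\<Sum>i<?N. \<Sum>(j, k) | j + k \<le> r. l i * a i K j k * ((x$1) ^ j * (x$2) ^ k))"
        by (intro sum.cong refl) (simp only: lessThan_iff)
      also have "\<dots> = (\<Sum>(j, k) | j + k \<le> r. (\<Sum>i<?N. l i * a i K j k) * ((x$1) ^ j * (x$2) ^ k))"
        unfolding case_prod_unfold by (subst sum.swap) (simp only: sum_distrib_right)
      also have "\<dots> = 0"
        using l(2) K(1) by (intro sum.neutral) auto
      finally show ?thesis .
    qed
    with l(1) show ?thesis by auto
  qed
qed

section \<open>The error estimate with a constant uniform in the mesh\<close>

lemma sobolev_norm_ge_0: "sobolev_norm \<Omega> k u \<ge> 0"
  by (simp add: sobolev_norm_def sum_nonneg)

theorem theorem6p1:
  fixes \<Omega> :: "(real^2) set" and m \<epsilon> \<tau> L :: real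
    and f\<^sub>c f\<^sub>e :: "real \<Rightarrow> real" and I :: "real set"
    and H :: "real set" and \<T> :: "real \<Rightarrow> (real^2) set set" and r :: nat
  assumes "convex_polygonal_domain \<Omega>"
    and "m > 0" and "\<epsilon> > 0" and "\<tau> > 0"
    and "f\<^sub>c C1_differentiable_on UNIV" and "convex_on UNIV f\<^sub>c"
    and "f\<^sub>e C1_differentiable_on UNIV" and "convex_on UNIV f\<^sub>e"
    and "shape_regular_family \<Omega> H \<T>"
    and "r \<ge> 1"
    and "approximation_property \<Omega> H \<T> r"
    and "is_interval I" and "L > 0"
    and "\<And>x y. x \<in> I \<Longrightarrow> y \<in> I \<Longrightarrow>
      \<bar>deriv f\<^sub>c x - deriv f\<^sub>c y\<bar> + \<bar>deriv f\<^sub>e x - deriv f\<^sub>e y\<bar> \<le> L * \<bar>x - y\<bar>"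
  shows "\<exists>C>0. \<forall>h\<in>H. \<forall>c\<^sub>n c\<^sub>n\<^sub>h c \<mu> c\<^sub>h \<mu>\<^sub>h.
    c\<^sub>n \<in> sobolev \<Omega> 1 \<longrightarrow>
    c\<^sub>n\<^sub>h \<in> lagrange_space \<Omega> (\<T> h) r \<longrightarrow>
    (LINT x|lebesgue_on \<Omega>. c\<^sub>n\<^sub>h x) = (LINT x|lebesgue_on \<Omega>. c\<^sub>n x) \<longrightarrow>
    convex_splitting_step \<Omega> m \<epsilon> \<tau> f\<^sub>c f\<^sub>e (sobolev \<Omega> 1) c\<^sub>n c \<mu> \<longrightarrow>
    convex_splitting_step \<Omega> m \<epsilon> \<tau> f\<^sub>c f\<^sub>e (lagrange_space \<Omega> (\<T> h) r) c\<^sub>n\<^sub>h c\<^sub>h \<mu>\<^sub>h \<longrightarrow>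
    essential_range \<Omega> c \<union> essential_range \<Omega> c\<^sub>h \<union>
      essential_range \<Omega> c\<^sub>n \<union> essential_range \<Omega> c\<^sub>n\<^sub>h \<subseteq> I \<longrightarrow>
    c \<in> sobolev \<Omega> (r + 1) \<longrightarrow> \<mu> \<in> sobolev \<Omega> (r + 1) \<longrightarrow>
    c \<in> sobolev \<Omega> 2 \<longrightarrow> has_normal_derivative \<Omega> c (\<lambda>x. 0) \<longrightarrow>
    (let R = h ^ r * sobolev_norm \<Omega> (r + 1) c + h ^ r * sobolev_norm \<Omega> (r + 1) \<mu>
           + dual_norm \<Omega> (lagrange_space \<Omega> (\<T> h) r) (\<lambda>x. c\<^sub>n x - c\<^sub>n\<^sub>h x)
           + L2_norm (lebesgue_on \<Omega>) (\<lambda>x. c\<^sub>n x - c\<^sub>n\<^sub>h x)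
     in dual_norm \<Omega> (lagrange_space \<Omega> (\<T> h) r) (\<lambda>x. c x - c\<^sub>h x)
          + grad_norm \<Omega> (\<lambda>x. c x - c\<^sub>h x) + grad_norm \<Omega> (\<lambda>x. \<mu> x - \<mu>\<^sub>h x) \<le> C * R \<and>
        (\<lambda>x. c x - c\<^sub>h x) \<in> L2_zero_mean (lebesgue_on \<Omega>) \<and>
        sobolev_norm \<Omega> 1 (\<lambda>x. c x - c\<^sub>h x) \<le> C * R)"
proof -
  interpret bounded_convex_set \<Omega>
    using assms(1) unfolding convex_polygonal_domain_def by unfold_locales auto
  note lip = assms(14)
  have lip_c: "\<bar>deriv f\<^sub>c x - deriv f\<^sub>c y\<bar> \<le> L * \<bar>x - y\<bar>"
    and lip_e: "\<bar>deriv f\<^sub>e x - deriv f\<^sub>e y\<bar> \<le> L * \<bar>x - y\<bar>" if "x \<in> I" "y \<in> I" for x y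
    using lip[OF that] by linarith+
  obtain A where A: "\<And>h v. h \<in> H \<Longrightarrow> v \<in> sobolev \<Omega> (r + 1) \<Longrightarrow>
      (INF w\<in>lagrange_space \<Omega> (\<T> h) r. sobolev_norm \<Omega> 1 (\<lambda>x. v x - w x))
        \<le> A * h ^ r * sobolev_norm \<Omega> (r + 1) v"
    using assms(11) unfolding approximation_property_def by blast
  \<comment> \<open>At least 1, so that it is positive whatever \<open>A\<close> is and also covers
    the data error, which carries the coefficient 1.\<close>
  define A' where "A' = max 1 A"
  \<comment> \<open>This is \<open>stability_const\<close>, written out because no finite element
    space is fixed yet: the constant has to precede the choice of \<open>h\<close>.\<close>
  define K where "K = 4 * (m * \<tau> + \<epsilon>\<^sup>2 + (poincare_const + 1) * poincare_const + poincare_const + L * poincare_const\<^sup>2 + L * poincare_const) / min (m * \<tau>) (\<epsilon>\<^sup>2) + 2"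
  have K: "K > 0"
    unfolding K_def using poincare_const_pos assms(2,3,4,13)
    by (intro add_nonneg_pos divide_nonneg_pos) auto
  \<comment> \<open>The first factor dominates both \<open>poincare_const\<^sup>2 + 1\<close>, from
    the estimate with the dual norm, and \<open>poincare_const + 1\<close>, from the full H1
    norm.\<close>
  define C where "C = (poincare_const\<^sup>2 + poincare_const + 1) * (K * A')"
  have C: "C > 0" unfolding C_def A'_def using poincare_const_pos K by (intro mult_pos_pos add_nonneg_pos) auto
  show ?thesis
  proof (intro exI[of _ C] conjI C ballI allI impI)
    fix h c\<^sub>n c\<^sub>n\<^sub>h c \<mu> c\<^sub>h \<mu>\<^sub>h
    let ?V = "lagrange_space \<Omega> (\<T> h) r"
    assume h: "h \<in> H" and cn: "c\<^sub>n \<in> sobolev \<Omega> 1" and cnh: "c\<^sub>n\<^sub>h \<in> ?V"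
      and mean: "(LINT x|M. c\<^sub>n\<^sub>h x) = (LINT x|M. c\<^sub>n x)"
      and CS: "convex_splitting_step \<Omega> m \<epsilon> \<tau> f\<^sub>c f\<^sub>e (sobolev \<Omega> 1) c\<^sub>n c \<mu>"
      and CSh: "convex_splitting_step \<Omega> m \<epsilon> \<tau> f\<^sub>c f\<^sub>e ?V c\<^sub>n\<^sub>h c\<^sub>h \<mu>\<^sub>h"
      and ran: "essential_range \<Omega> c \<union> essential_range \<Omega> c\<^sub>h \<union>
        essential_range \<Omega> c\<^sub>n \<union> essential_range \<Omega> c\<^sub>n\<^sub>h \<subseteq> I"
      and reg: "c \<in> sobolev \<Omega> (r + 1)" "\<mu> \<in> sobolev \<Omega> (r + 1)"
    have h0: "h > 0" and tri: "conforming_triangulation \<Omega> (\<T> h)"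
      using assms(9) h unfolding shape_regular_family_def by auto
    interpret galerkin_space \<Omega> ?V "Suc (card (\<T> h \<times> {(i, j). i + j \<le> r}))"
      by (rule galerkin_space_lagrange[OF tri])
    have c: "c \<in> sobolev \<Omega> 1" and \<mu>: "\<mu> \<in> sobolev \<Omega> 1" and ch: "c\<^sub>h \<in> ?V" and \<mu>h: "\<mu>\<^sub>h \<in> ?V"
      using CS CSh unfolding convex_splitting_step_def by auto
    have L2s: "c \<in> L2 M" "c\<^sub>h \<in> L2 M" "c\<^sub>n \<in> L2 M" "c\<^sub>n\<^sub>h \<in> L2 M"
      using c ch cn cnh V_sobolev sobolevD(1) by blast+
    \<comment> \<open>The Lipschitz bounds hold on \<open>I\<close> only, so the functions are first
      located there almost everywhere.\<close>
    have AE_I: "AE x in M. u x \<in> I" if "u \<in> L2 M" "essential_range \<Omega> u \<subseteq> I" for u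
      using AE_essential_range[OF sets_lebesgue L2D(1)[OF that(1)]] that(2)
      by (auto elim!: eventually_mono)
    have I: "AE x in M. c x \<in> I" "AE x in M. c\<^sub>h x \<in> I" "AE x in M. c\<^sub>n x \<in> I" "AE x in M. c\<^sub>n\<^sub>h x \<in> I"
      using AE_I L2s ran by simp_all
    have comp_c: "(\<lambda>x. deriv f\<^sub>c (u x)) \<in> L2 M" if "u \<in> L2 M" "AE x in M. u x \<in> I" for u
      by (rule L2_comp_Lipschitz[OF finite_M that(1) C1_deriv(2)[OF assms(5)] that(2)]) (rule lip_c)
    have comp_e: "(\<lambda>x. deriv f\<^sub>e (u x)) \<in> L2 M" if "u \<in> L2 M" "AE x in M. u x \<in> I" for u
      by (rule L2_comp_Lipschitz[OF finite_M that(1) C1_deriv(2)[OF assms(7)] that(2)]) (rule lip_e)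
    have mono: "0 \<le> (deriv f\<^sub>c x - deriv f\<^sub>c y) * (x - y)" for x y
      by (rule convex_deriv_mono[OF assms(6) C1_deriv(1)[OF assms(5)]])
    have est: "(\<lambda>x. c x - c\<^sub>h x) \<in> L2_zero_mean M"
      "\<And>P Q. P \<in> ?V \<Longrightarrow> Q \<in> ?V \<Longrightarrow>
        grad_norm \<Omega> (\<lambda>x. c x - c\<^sub>h x) + grad_norm \<Omega> (\<lambda>x. \<mu> x - \<mu>\<^sub>h x) \<le> stability_const m \<epsilon> \<tau> L *
        (sobolev_norm \<Omega> 1 (\<lambda>x. c x - P x) + sobolev_norm \<Omega> 1 (\<lambda>x. \<mu> x - Q x)
          + L2_norm M (\<lambda>x. c\<^sub>n x - c\<^sub>n\<^sub>h x))"
    proof -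
      note E = galerkin_estimate[OF assms(2,3,4,13) c \<mu> ch \<mu>h L2s(3,4) mean
          comp_c[OF L2s(1) I(1)] comp_c[OF L2s(2) I(2)] comp_e[OF L2s(3) I(3)] comp_e[OF L2s(4) I(4)]]
      have eqs: "L2_inner M (\<lambda>x. (c x - c\<^sub>n x) / \<tau>) v + m * grad_inner \<Omega> \<mu> v = 0"
        "L2_inner M \<mu> v - \<epsilon>\<^sup>2 * grad_inner \<Omega> c v - L2_inner M (\<lambda>x. deriv f\<^sub>c (c x) - deriv f\<^sub>e (c\<^sub>n x)) v = 0"
        "L2_inner M (\<lambda>x. (c\<^sub>h x - c\<^sub>n\<^sub>h x) / \<tau>) v + m * grad_inner \<Omega> \<mu>\<^sub>h v = 0"
        "L2_inner M \<mu>\<^sub>h v - \<epsilon>\<^sup>2 * grad_inner \<Omega> c\<^sub>h v - L2_inner M (\<lambda>x. deriv f\<^sub>c (c\<^sub>h x) - deriv f\<^sub>e (c\<^sub>n\<^sub>h x)) v = 0"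
        if "v \<in> ?V" for v
        using CS CSh that V_sobolev unfolding convex_splitting_step_def by blast+
      have ae: "AE x in M. \<bar>deriv f\<^sub>c (c x) - deriv f\<^sub>c (c\<^sub>h x)\<bar> \<le> L * \<bar>c x - c\<^sub>h x\<bar>"
        "AE x in M. \<bar>deriv f\<^sub>e (c\<^sub>n x) - deriv f\<^sub>e (c\<^sub>n\<^sub>h x)\<bar> \<le> L * \<bar>c\<^sub>n x - c\<^sub>n\<^sub>h x\<bar>"
      proof -
        show "AE x in M. \<bar>deriv f\<^sub>c (c x) - deriv f\<^sub>c (c\<^sub>h x)\<bar> \<le> L * \<bar>c x - c\<^sub>h x\<bar>"
          using I(1,2) by eventually_elim (rule lip_c)
        show "AE x in M. \<bar>deriv f\<^sub>e (c\<^sub>n x) - deriv f\<^sub>e (c\<^sub>n\<^sub>h x)\<bar> \<le> L * \<bar>c\<^sub>n x - c\<^sub>n\<^sub>h x\<bar>"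
          using I(3,4) by eventually_elim (rule lip_e)
      qed
      note E' = E[OF eqs AE_I2[OF mono] ae]
      show "(\<lambda>x. c x - c\<^sub>h x) \<in> L2_zero_mean M" by (rule E'(1))
      show "grad_norm \<Omega> (\<lambda>x. c x - c\<^sub>h x) + grad_norm \<Omega> (\<lambda>x. \<mu> x - \<mu>\<^sub>h x) \<le> stability_const m \<epsilon> \<tau> L *
        (sobolev_norm \<Omega> 1 (\<lambda>x. c x - P x) + sobolev_norm \<Omega> 1 (\<lambda>x. \<mu> x - Q x)
          + L2_norm M (\<lambda>x. c\<^sub>n x - c\<^sub>n\<^sub>h x))" if "P \<in> ?V" "Q \<in> ?V" for P Q
        by (rule E'(2)) (assumption | rule that)+
    qed
    have K_eq: "stability_const m \<epsilon> \<tau> L = K" by (simp add: stability_const_def K_def)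
    define R where "R = h ^ r * sobolev_norm \<Omega> (r + 1) c + h ^ r * sobolev_norm \<Omega> (r + 1) \<mu>
           + dual_norm \<Omega> ?V (\<lambda>x. c\<^sub>n x - c\<^sub>n\<^sub>h x) + L2_norm M (\<lambda>x. c\<^sub>n x - c\<^sub>n\<^sub>h x)"
    let ?e = "\<lambda>x. c x - c\<^sub>h x"
    define T where "T = grad_norm \<Omega> ?e + grad_norm \<Omega> (\<lambda>x. \<mu> x - \<mu>\<^sub>h x)"
    have T0: "grad_norm \<Omega> ?e \<ge> 0" "grad_norm \<Omega> ?e \<le> T" using grad_norm_nonneg by (auto simp: T_def)
    have "T \<le> K * ((INF P\<in>?V. sobolev_norm \<Omega> 1 (\<lambda>x. c x - P x))
        + (INF Q\<in>?V. sobolev_norm \<Omega> 1 (\<lambda>x. \<mu> x - Q x)) + L2_norm M (\<lambda>x. c\<^sub>n x - c\<^sub>n\<^sub>h x))"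
      unfolding T_def by (rule le_INF_sum[OF _ K]) (use est(2) K_eq V_const in auto)
    also have "\<dots> \<le> K * (A' * R)"
    proof (rule mult_left_mono)
      have best: "(INF P\<in>?V. sobolev_norm \<Omega> 1 (\<lambda>x. v x - P x)) \<le> A' * (h ^ r * sobolev_norm \<Omega> (r + 1) v)"
        if "v \<in> sobolev \<Omega> (r + 1)" for v
      proof -
        have "A * (h ^ r * sobolev_norm \<Omega> (r + 1) v) \<le> A' * (h ^ r * sobolev_norm \<Omega> (r + 1) v)"
          using h0 sobolev_norm_ge_0 by (intro mult_right_mono) (auto simp: A'_def)
        then show ?thesis using A[OF h that] by (simp add: mult.assoc)
      qed
      have "L2_norm M (\<lambda>x. c\<^sub>n x - c\<^sub>n\<^sub>h x) \<le> A' * L2_norm M (\<lambda>x. c\<^sub>n x - c\<^sub>n\<^sub>h x)"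
        using mult_right_mono[OF _ L2_norm_nonneg, of 1 A'] by (simp add: A'_def)
      moreover have "0 \<le> A' * dual_norm \<Omega> ?V (\<lambda>x. c\<^sub>n x - c\<^sub>n\<^sub>h x)"
        unfolding dual_norm_def by (intro mult_nonneg_nonneg grad_norm_nonneg) (simp add: A'_def)
      ultimately show "(INF P\<in>?V. sobolev_norm \<Omega> 1 (\<lambda>x. c x - P x))
        + (INF Q\<in>?V. sobolev_norm \<Omega> 1 (\<lambda>x. \<mu> x - Q x)) + L2_norm M (\<lambda>x. c\<^sub>n x - c\<^sub>n\<^sub>h x) \<le> A' * R"
        using best[OF reg(1)] best[OF reg(2)] unfolding R_def distrib_left by linarith
    qed (use K in simp)
    finally have T: "T \<le> K * A' * R" by (simp add: mult.assoc)
    have eS: "?e \<in> sobolev \<Omega> 1"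
      using semi_inner.diff_mem[OF semi_inner_grad c] ch V_sobolev by blast
    have e_norm: "L2_norm M ?e \<le> poincare_const * T"
    proof -
      have "(LINT x|M. c x - c\<^sub>h x) = 0" using est(1) by (simp add: L2_zero_mean_def)
      from order_trans[OF Poincare[OF eS this] mult_left_mono[OF T0(2)]] show ?thesis using poincare_const_pos by simp
    qed
    have scale: "s * T \<le> C * R" if "s \<le> poincare_const\<^sup>2 + poincare_const + 1" for s
    proof -
      have "s * T \<le> (poincare_const\<^sup>2 + poincare_const + 1) * T" using that T0 by (intro mult_right_mono) auto
      also have "\<dots> \<le> (poincare_const\<^sup>2 + poincare_const + 1) * (K * A' * R)"
        using T poincare_const_pos by (intro mult_left_mono add_nonneg_nonneg) auto
      finally show ?thesis by (simp add: C_def mult.assoc)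
    qed
    have "dual_norm \<Omega> ?V ?e \<le> poincare_const * (poincare_const * T)"
      using dual_norm_le[OF est(1)] mult_left_mono[OF e_norm, of poincare_const] poincare_const_pos by linarith
    then have "dual_norm \<Omega> ?V ?e + grad_norm \<Omega> ?e + grad_norm \<Omega> (\<lambda>x. \<mu> x - \<mu>\<^sub>h x) \<le> (poincare_const\<^sup>2 + 1) * T"
      by (simp add: T_def power2_eq_square distrib_right mult.assoc)
    also have "\<dots> \<le> C * R" by (rule scale) (use poincare_const_pos in simp)
    finally have 1: "dual_norm \<Omega> ?V ?e + grad_norm \<Omega> ?e + grad_norm \<Omega> (\<lambda>x. \<mu> x - \<mu>\<^sub>h x) \<le> C * R" .
    have "sobolev_norm \<Omega> 1 ?e \<le> (poincare_const + 1) * T"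
      using sobolev_norm_1_bounds(3)[OF eS] e_norm T0(2) by (simp add: distrib_right)
    also have "\<dots> \<le> C * R" by (rule scale) simp
    finally show "let R = h ^ r * sobolev_norm \<Omega> (r + 1) c + h ^ r * sobolev_norm \<Omega> (r + 1) \<mu>
           + dual_norm \<Omega> ?V (\<lambda>x. c\<^sub>n x - c\<^sub>n\<^sub>h x) + L2_norm M (\<lambda>x. c\<^sub>n x - c\<^sub>n\<^sub>h x)
       in dual_norm \<Omega> ?V ?e + grad_norm \<Omega> ?e + grad_norm \<Omega> (\<lambda>x. \<mu> x - \<mu>\<^sub>h x) \<le> C * R \<and>
        ?e \<in> L2_zero_mean M \<and> sobolev_norm \<Omega> 1 ?e \<le> C * R"
      using 1 est(1) unfolding R_def[symmetric] Let_def by blast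
  qed
qed

end
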